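(* Let $p>0$, $p\neq\frac12$, let $\eta>0$, and let $\omega_p$ be a positive function on the non-negative integers with $\omega_p(N)= N^p(1+\mathcal{O}(N^{-\eta}))$ for $N\to\infty$. Let $\epsilon=\alpha(\omega_p)$, and let $E_s(z)$, $B_s(z)$ be the moment generating functions of $A_{(\omega_p,\epsilon)}$ over Dyck excursions and Dyck bridges defined in the context. Let $$\eta_s=\begin{cases}1 & s=0\\ \min(\eta,\frac12)& s=1\\ \min(\eta,p,\frac12)& s\ge2.\end{cases}$$ Then, for $s\ge1$, $$E_s(z)=2\mu_s^{\rm (E)}(p)\,(1-z)^{-(p+\frac12)s+\frac12}\big(1+\tilde{\mathcal{O}}((1-z)^{\eta_s})\big)\quad\text{for } z\to1,$$ $$B_s(z)=\mu_s^{\rm (B)}(p)\,(1-z)^{-(p+\frac12)s-\frac12}\big(1+\tilde{\mathcal{O}}((1-z)^{\eta_s})\big)\quad\text{for } z\to1.$$ The coefficients $\mu_s^{\rm (E)}(p)$ satisfy $$\mu_0^{\rm (E)}(p)=-\tfrac12,\qquad \mu_1^{\rm (E)}(p)=\frac{1}{8\sqrt\pi}\Gamma\left(p-\tfrac12\right),$$ $$\mu_s^{\rm (E)}(p)=\mu_{s-1}^{\rm (E)}(p)\frac{\Gamma\left(s(p+\frac12)-1\right)}{2\,\Gamma\left(s(p+\frac12)-p-1\right)}+\sum_{k=1}^{s-1}\mu_k^{\rm (E)}(p)\,\mu_{s-k}^{\rm (E)}(p)\quad\text{for } s\ge2,$$ and the coefficients $\mu_s^{\rm (B)}(p)$ satisfy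 $$\mu_0^{\rm (B)}(p)=1,\qquad \mu_s^{\rm (B)}(p)=2\sum_{k=0}^{s-1}\mu_k^{\rm (B)}(p)\,\mu_{s-k}^{\rm (E)}(p)\quad\text{for } s\ge1.$$
   Context: Paths. A Dyck path (or excursion) of size $N$ is a sequence of $N$ up-steps $(+1,+1)$ and $N$ down-steps $(+1,-1)$ from $(0,0)$ to $(2N,0)$ never reaching negative heights; a Dyck bridge is the same without the non-negativity constraint. $\mathcal{C}_N$, $\mathcal{B}_N$ denote the sets of excursions and bridges of size $N$. Slices. The region between $w$ and the horizontal axis decomposes into $N$ connected horizontal slices $e\in w$: each step number $i$ moving away from the axis, starting at height $h$, is paired with the first later step number $j$ bringing the path back to height $h$; the slice has length $\ell_w(e)=j-i$ (odd). For real $\epsilon$, $$A_{(\omega_p,\epsilon)}(w)=\sum_{e\in w}\Big[\omega_p\Big(\frac{\ell_w(e)-1}{2}\Big)-\epsilon\Big].$$ Generating functions. $$E_s(z)=\frac12\sum_{N\ge0}\sum_{w\in\mathcal{C}_N}\frac{(A_{(\omega_p,\epsilon)}(w))^s}{s!}\Big(\frac z4\Big)^N,\qquad B_s(z)=\sum_{N\ge0}\sum_{w\in\mathcal{B}_N}\frac{(A_{(\omega_p,\epsilon)}(w))^s}{s!}\Big(\frac z4\Big)^N .$$ The constant $\alpha(\omega_p)$. With $c_k=2^{-2k-1}\frac{1}{k+1}\binom{2k}{k}$ (so $E_0(z)=\sum_k c_kz^k=\frac{1-\sqrt{1-z}}{z}$), $\alpha(\omega_p)$ is the limit for $z\to1$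 of the regular part at $z=1$ of $\sum_{k\ge0}c_k\omega_p(k)z^k$, i.e. $$\sum_{k\ge0}c_k\omega_p(k)z^k=\alpha(\omega_p)(1+\mathcal{O}(1-z))+\frac{\Gamma(p-\frac12)}{2\sqrt\pi}(1-z)^{\frac12-p}\big(1+\mathcal{O}((1-z)^{\min(\eta,\frac12)})\big).$$ Notation. $f(z)=g(z)+\tilde{\mathcal{O}}((1-z)^b)$ as $z\to1$ means that there is a finite $c$ with $f(z)=g(z)+\mathcal{O}((1-z)^b(\ln(1-z))^c)$.
   Formalization: For s=1 the printed rate min(η,1/2) fails if p<min(η,1/2); it becomes min(η,p,1/2), or min(η,1/2) after subtracting ε/2 from E_1 and ε/(2(1-z)) from B_1. The factor 1+Õ is multiplied out (matters only if μ_s=0); z→1 is the real limit from below. *)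

theory Defs
  imports "HOL-Analysis.Analysis" "HOL-Library.Landau_Symbols"
begin

section \<open>Paths and their slices\<close>

text \<open>A path is the list of the vertical components, 1 or -1, of its steps.
  Steps are numbered from 0, so step \<open>i\<close> goes from \<open>height w i\<close> to \<open>height w (Suc i)\<close>.\<close>

definition height :: "int list \<Rightarrow> nat \<Rightarrow> int" where
  "height w i = sum_list (take i w)"

definition dyck_bridges :: "nat \<Rightarrow> int list set" where
  "dyck_bridges N = {w. set w \<subseteq> {1, -1} \<and> count_list w 1 = N \<and> count_list w (-1) = N}"

definition dyck_excursions :: "nat \<Rightarrow> int list set" where
  "dyck_excursions N = {w \<in> dyck_bridges N. \<forall>i \<le> length w. 0 \<le> height w i}"

text \<open>Each slice is represented by the step moving away from the axis at which it starts.\<close>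

definition slices :: "int list \<Rightarrow> nat set" where
  "slices w = {i. i < length w \<and> \<bar>height w i\<bar> < \<bar>height w (Suc i)\<bar>}"

definition slice_length :: "int list \<Rightarrow> nat \<Rightarrow> nat" where
  "slice_length w i = (LEAST j. i < j \<and> height w (Suc j) = height w i) - i"

text \<open>Slice lengths are odd, so the integer division below is exact.\<close>

definition path_functional :: "(nat \<Rightarrow> real) \<Rightarrow> real \<Rightarrow> int list \<Rightarrow> real" where
  "path_functional \<omega> \<epsilon> w = (\<Sum>e \<in> slices w. \<omega> ((slice_length w e - 1) div 2) - \<epsilon>)"


section \<open>Moment generating functions\<close>

definition E_gf :: "(nat \<Rightarrow> real) \<Rightarrow> real \<Rightarrow> nat \<Rightarrow> real \<Rightarrow> real" where
  "E_gf \<omega> \<epsilon> s z =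
     1/2 * (\<Sum>N. (\<Sum>w \<in> dyck_excursions N. path_functional \<omega> \<epsilon> w ^ s / fact s) * (z/4) ^ N)"

definition B_gf :: "(nat \<Rightarrow> real) \<Rightarrow> real \<Rightarrow> nat \<Rightarrow> real \<Rightarrow> real" where
  "B_gf \<omega> \<epsilon> s z =
     (\<Sum>N. (\<Sum>w \<in> dyck_bridges N. path_functional \<omega> \<epsilon> w ^ s / fact s) * (z/4) ^ N)"


section \<open>The constant \<open>\<alpha>\<close>\<close>

definition c_coeff :: "nat \<Rightarrow> real" where
  "c_coeff k = (1/2) ^ (2*k+1) * (1 / (real k + 1)) * real ((2*k) choose k)"

text \<open>\<open>is_alpha p \<eta> \<omega> a\<close>: the expansion defining \<open>\<alpha>(\<omega>)\<close> holds with constant \<open>a\<close>. This is a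
  predicate because the expansion determines \<open>a\<close> only if its second error term tends to 0, that
  is, if \<open>p < 1/2 + min \<eta> (1/2)\<close>; otherwise that term absorbs every constant.\<close>

definition is_alpha :: "real \<Rightarrow> real \<Rightarrow> (nat \<Rightarrow> real) \<Rightarrow> real \<Rightarrow> bool" where
  "is_alpha p \<eta> \<omega> a \<longleftrightarrow>
     (\<exists>g h. g \<in> O[at_left 1](\<lambda>z. 1 - z) \<and>
            h \<in> O[at_left 1](\<lambda>z. (1 - z) powr min \<eta> (1/2)) \<and>
            (\<forall>\<^sub>F z in at_left 1.
               (\<Sum>k. c_coeff k * \<omega> k * z ^ k) =
                 a * (1 + g z)
                 + Gamma (p - 1/2) / (2 * sqrt pi) * (1 - z) powr (1/2 - p) * (1 + h z)))"


section \<open>Coefficients and error terms\<close>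

fun mu_E :: "real \<Rightarrow> nat \<Rightarrow> real" where
  "mu_E p s =
     (if s = 0 then -1/2
      else if s = 1 then Gamma (p - 1/2) / (8 * sqrt pi)
      else mu_E p (s-1) * (Gamma (real s * (p + 1/2) - 1)
                             / (2 * Gamma (real s * (p + 1/2) - p - 1)))
           + (\<Sum>k\<in>{1..s-1}. mu_E p k * mu_E p (s-k)))"

fun mu_B :: "real \<Rightarrow> nat \<Rightarrow> real" where
  "mu_B p s = (if s = 0 then 1 else 2 * (\<Sum>k\<in>{0..s-1}. mu_B p k * mu_E p (s-k)))"

declare mu_E.simps [simp del] mu_B.simps [simp del]

text \<open>The functions for \<open>s = 1\<close> contain the terms \<open>\<epsilon>/2\<close> (excursions) and \<open>\<epsilon>/(2(1-z))\<close>
  (bridges), of relative size \<open>(1-z)^p\<close>. So the rate \<open>eta_exp \<eta> p 1 = min \<eta> (1/2)\<close> is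
  attained only after removing them, or if \<open>p \<ge> min \<eta> (1/2)\<close>.\<close>

definition eta_exp :: "real \<Rightarrow> real \<Rightarrow> nat \<Rightarrow> real" where
  "eta_exp \<eta> p s =
     (if s = 0 then 1 else if s = 1 then min \<eta> (1/2) else min \<eta> (min p (1/2)))"

text \<open>The set of functions of size \<open>O((1-z)^b (ln (1-z))^c)\<close> for some finite \<open>c\<close>, as the real
  variable \<open>z\<close> tends to 1 from below; there \<open>ln (1-z)\<close> is negative.\<close>

definition O_tilde :: "real \<Rightarrow> (real \<Rightarrow> real) set" where
  "O_tilde b = {f. \<exists>c::real. f \<in> O[at_left 1](\<lambda>z. (1 - z) powr b * \<bar>ln (1 - z)\<bar> powr c)}"

text \<open>\<open>asymp_rel f m a b\<close>: \<open>f(z) = m (1-z)^a (1 + O_tilde((1-z)^b))\<close>, with the bracket multiplied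
  out. For \<open>m = 0\<close> it only bounds \<open>f\<close>, instead of forcing \<open>f\<close> to vanish near 1.\<close>

definition asymp_rel :: "(real \<Rightarrow> real) \<Rightarrow> real \<Rightarrow> real \<Rightarrow> real \<Rightarrow> bool" where
  "asymp_rel f m a b \<longleftrightarrow> (\<lambda>z. f z - m * (1 - z) powr a) \<in> O_tilde (a + b)"

end

theory Submission
  imports Defs "HOL-Real_Asymp.Real_Asymp"
begin

text \<open>
  Splitting a path at its first return to the axis gives, for the generating functions \<open>E\<close>, \<open>B\<close> in
  \<open>z\<close> and a variable marking \<open>s\<close>, the equations \<open>2 E = 1 + z H E\<close> and \<open>B = 1 + z H B\<close>, where \<open>H\<close>
  arises from \<open>E\<close> by multiplying its coefficients by exponentials of \<open>\<omega> - \<epsilon>\<close>. Since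
  \<open>1 - z E\<^sub>0 = sqrt (1 - z)\<close>, the first one determines \<open>E\<^sub>s\<close> from its predecessors, and elimination of
  \<open>H\<close> gives \<open>B E = B - E\<close>, so \<open>B\<^sub>s\<close> is a polynomial in \<open>(1 - z) powr (-1/2)\<close> and the \<open>E\<^sub>k\<close>.

  The multiplication by powers of \<open>\<omega> - \<epsilon>\<close> acts on coefficients, and knowledge of \<open>E\<^sub>s\<close> for real \<open>z\<close>
  near 1 does not determine them. Hence the induction on \<open>s\<close> is about coefficients: \<open>E\<^sub>s\<close> is a multiple
  of \<open>(1 - z) powr (- a)\<close> up to a series whose coefficients are smaller by a factor \<open>n powr (- \<delta>)\<close>
  and logarithms. Leading terms multiply exactly, and for the errors crude convolution bounds suffice.
  The exception is \<open>E\<^sub>1\<close>, where a series \<open>R\<close> with coefficients that are summable but too large is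
  multiplied by \<open>(1 - z) powr (-1/2)\<close>. The choice of \<open>\<epsilon>\<close> makes \<open>R\<close> vanish at 1, which yields the
  cancellation that is needed.
\<close>

text \<open>Each unit of \<open>s\<close> raises the exponent at the singularity by
  \<open>p + 1/2\<close>: \<open>p\<close> comes from one factor of the weight, \<open>1/2\<close>
  from the division by \<open>sqrt (1 - z)\<close>. Up to terms smaller by a factor
  \<open>n powr (-1/2)\<close>, \<open>2 E_s\<close> is \<open>(1 - z) powr (-1/2)\<close> times the
  sum of the weighted \<open>E_(s-1)\<close> and of the products \<open>E_k E_(s-k)\<close> with
  \<open>0 < k < s\<close>. The coefficients of \<open>(1 - z) powr (- a)\<close> being asymptotic
  to \<open>n powr (a - 1) / Gamma a\<close>, a weight \<open>n powr p\<close> turns this series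
  into \<open>Gamma (a + p) / Gamma a\<close> times the one with \<open>a + p\<close>. This is where
  the Gamma quotient in \<open>mu_E\<close> comes from.

  Weighting is simple for powers of \<open>n\<close>, convolution for binomial series. Changing
  between the two costs a relative error \<open>1/n\<close>, which is below the accuracy pursued.

  Order 1 is treated twice. The induction starts from its coefficients. Their asymptotics do not see
  an additive constant, but for small \<open>p\<close> a constant in \<open>E_1\<close> exceeds the
  claimed error; the sharper statement therefore uses the hypothesis on \<open>\<epsilon>\<close> as
  one about functions of \<open>z\<close>.\<close>

unbundle no vec_syntax
unbundle fps_syntax

section \<open>Decomposition of paths at the first return\<close>

lemma height_0 [simp]: "height w 0 = 0"
  by (simp add: height_def)

lemma height_Suc: "i < length w \<Longrightarrow> height w (Suc i) = height w i + w ! i"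
  by (simp add: height_def take_Suc_conv_app_nth)

lemma height_beyond: "length w \<le> i \<Longrightarrow> height w i = sum_list w"
  by (simp add: height_def)

lemma height_append:
  "height (u @ v) i = (if i \<le> length u then height u i else sum_list u + height v (i - length u))"
  by (simp add: height_def)

lemma height_Cons_Suc [simp]: "height (x # w) (Suc i) = x + height w i"
  by (simp add: height_def)

lemma height_uminus [simp]: "height (map uminus w) i = - height w i"
  by (simp add: height_def take_map uminus_sum_list_map[of id, simplified] comp_def)

lemma height_step:
  assumes "set w \<subseteq> {1, -1}"
  shows "\<bar>height w (Suc i) - height w i\<bar> \<le> 1"
proof (cases "i < length w")
  case True
  then have "w ! i \<in> {1, -1}" using assms nth_mem by blast
  with True show ?thesis by (auto simp: height_Suc)
qed (simp add: height_beyond)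

lemma height_step_eq:
  assumes "set w \<subseteq> {1, -1}" "i < length w"
  shows "height w (Suc i) = height w i + 1 \<or> height w (Suc i) = height w i - 1"
proof -
  have "w ! i \<in> {1, -1}" using assms nth_mem by blast
  with assms show ?thesis by (auto simp: height_Suc)
qed

lemma sum_list_steps:
  assumes "set w \<subseteq> {1, -1}"
  shows "sum_list w = int (count_list w 1) - int (count_list w (-1))"
    and "length w = count_list w 1 + count_list w (-1)"
  using assms by (induction w) auto

lemma dyck_bridges_iff:
  "w \<in> dyck_bridges N \<longleftrightarrow> set w \<subseteq> {1, -1} \<and> sum_list w = 0 \<and> length w = 2 * N"
  using sum_list_steps[of w] by (auto simp: dyck_bridges_def)

text \<open>Past the end of the path the height stays at its final value, so the bound on
  \<open>i\<close> can go; without it the condition survives shifts of indices under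
  concatenation.\<close>

lemma dyck_excursions_iff:
  "w \<in> dyck_excursions N \<longleftrightarrow> w \<in> dyck_bridges N \<and> (\<forall>i. 0 \<le> height w i)"
proof -
  have "height w i = height w (min i (length w))" for i
    by (cases "i \<le> length w") (auto simp: height_beyond min_def)
  then have "(\<forall>i. 0 \<le> height w i) \<longleftrightarrow> (\<forall>i \<le> length w. 0 \<le> height w i)"
    by (metis min.cobounded2)
  then show ?thesis by (simp add: dyck_excursions_def)
qed

lemma finite_dyck_bridges [simp]: "finite (dyck_bridges N)"
  by (rule finite_subset[OF _ finite_lists_length_eq[of "{1, -1}" "2 * N"]])
     (auto simp: dyck_bridges_iff)

lemma finite_dyck_excursions [simp]: "finite (dyck_excursions N)"
  by (rule finite_subset[OF _ finite_dyck_bridges[of N]]) (auto simp: dyck_excursions_iff)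

lemma dyck_bridges_0 [simp]: "dyck_bridges 0 = {[]}"
  by (auto simp: dyck_bridges_iff)

lemma dyck_excursions_0 [simp]: "dyck_excursions 0 = {[]}"
  by (auto simp: dyck_excursions_iff height_def)

section \<open>The functional under concatenation and reflection\<close>

lemma path_functional_Nil [simp]: "path_functional \<omega> \<epsilon> [] = 0"
  by (simp add: path_functional_def slices_def)

text \<open>By the discrete intermediate value theorem: after the step the path is one unit farther
  from the axis, and it must end at height 0, so it meets \<open>height w i\<close> again. Without
  such a \<open>j\<close> the \<open>LEAST\<close> in \<open>slice_length\<close> would be
  unspecified.\<close>

lemma slice_returns:
  assumes w: "set w \<subseteq> {1, -1}" "sum_list w = 0" and i: "i \<in> slices w"
  shows "\<exists>j. i < j \<and> j < length w \<and> height w (Suc j) = height w i"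
proof -
  have i': "i < length w" "\<bar>height w i\<bar> < \<bar>height w (Suc i)\<bar>"
    using i by (auto simp: slices_def)
  have end0: "height w (length w) = 0" using w by (simp add: height_def)
  have "\<exists>k. Suc i \<le> k \<and> k \<le> length w \<and> height w k = height w i"
  proof (cases "height w (Suc i) = height w i - 1")
    case True
    then show ?thesis using i' end0 height_step[OF w(1)]
      by (intro nat_intermed_int_val) auto
  next
    case False
    then have "height w (Suc i) = height w i + 1" using height_step_eq[OF w(1) i'(1)] by auto
    then have "\<exists>k. Suc i \<le> k \<and> k \<le> length w \<and> - height w k = - height w i"
      using i' end0 height_step[OF w(1)]
      by (intro nat_intermed_int_val[where f = "\<lambda>k. - height w k"]) (auto simp: abs_minus_commute)
    then show ?thesis by auto
  qed
  then obtain k where k: "Suc i \<le> k" "k \<le> length w" "height w k = height w i" by auto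
  \<comment> \<open>\<open>k\<close> is a point of the path and \<open>j\<close> a step, which ends
    at point \<open>Suc j\<close>; so \<open>j = k - 1\<close>, and excluding
    \<open>k = Suc i\<close> gives \<open>i < j\<close>.\<close>
  have "k \<noteq> Suc i" using k(3) i'(2) by auto
  then show ?thesis using k by (intro exI[of _ "k - 1"]) auto
qed

text \<open>Heights of a path and of its extension agree only up to the end of the shorter one. A
  witness \<open>n\<close> in that range bounds both minima, so later disagreement is
  harmless.\<close>

lemma Least_nat_cong_upto:
  fixes P Q :: "nat \<Rightarrow> bool"
  assumes "P n" "\<And>j. j \<le> n \<Longrightarrow> P j \<longleftrightarrow> Q j"
  shows "Least P = Least Q"
proof (rule sym, rule Least_equality)
  show "Q (Least P)" using assms Least_le[of P n] LeastI[of P n] by auto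
  show "Least P \<le> y" if "Q y" for y
    using assms that Least_le[of P n] Least_le[of P y] by (cases "y \<le> n") auto
qed

lemma Least_nat_shift:
  fixes P Q :: "nat \<Rightarrow> bool"
  assumes "P n" "\<And>j. Q j \<longleftrightarrow> m \<le> j \<and> P (j - m)"
  shows "Least Q = Least P + m"
proof (rule Least_equality)
  show "Q (Least P + m)" using assms LeastI[of P n] by auto
  show "Least P + m \<le> y" if "Q y" for y
    using assms that Least_le[of P "y - m"] by auto
qed

lemma slices_append:
  assumes "sum_list u = 0"
  shows "slices (u @ v) = slices u \<union> (\<lambda>i. i + length u) ` slices v"
proof -
  have "i \<in> slices (u @ v) \<longleftrightarrow> i \<in> slices u \<or> i \<ge> length u \<and> i - length u \<in> slices v" for i
  proof (cases "i < length u")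
    case True
    then show ?thesis using assms by (auto simp: slices_def height_append)
  next
    case False
    then show ?thesis using assms
      by (auto simp: slices_def height_append height_beyond Suc_diff_le)
  qed
  moreover have "i \<in> (\<lambda>i. i + length u) ` slices v \<longleftrightarrow> i \<ge> length u \<and> i - length u \<in> slices v" for i
    by (force simp: image_iff)
  ultimately show ?thesis by blast
qed

lemma slice_length_append_left:
  assumes "set u \<subseteq> {1, -1}" "sum_list u = 0" "i \<in> slices u"
  shows "slice_length (u @ v) i = slice_length u i"
proof -
  obtain j where j: "i < j" "j < length u" "height u (Suc j) = height u i"
    using slice_returns[OF assms] by auto
  have "(LEAST j. i < j \<and> height u (Suc j) = height u i) =
        (LEAST j. i < j \<and> height (u @ v) (Suc j) = height (u @ v) i)"
    using j by (intro Least_nat_cong_upto[of _ j]) (auto simp: height_append)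
  then show ?thesis by (simp add: slice_length_def)
qed

lemma slice_length_append_right:
  assumes "sum_list u = 0" "set v \<subseteq> {1, -1}" "sum_list v = 0" "i \<in> slices v"
  shows "slice_length (u @ v) (i + length u) = slice_length v i"
proof -
  obtain j where j: "i < j" "height v (Suc j) = height v i"
    using slice_returns[OF assms(2-)] by auto
  have "(LEAST j. i + length u < j \<and> height (u @ v) (Suc j) = height (u @ v) (i + length u)) =
        (LEAST j. i < j \<and> height v (Suc j) = height v i) + length u"
    using j assms
    by (intro Least_nat_shift[of _ j]) (auto simp: height_append height_beyond Suc_diff_le)
  then show ?thesis by (simp add: slice_length_def)
qed

lemma path_functional_append:
  assumes "set u \<subseteq> {1, -1}" "sum_list u = 0" "set v \<subseteq> {1, -1}" "sum_list v = 0"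
  shows "path_functional \<omega> \<epsilon> (u @ v) = path_functional \<omega> \<epsilon> u + path_functional \<omega> \<epsilon> v"
proof -
  have "finite (slices u)" "finite (slices v)" by (auto simp: slices_def)
  moreover have "slices u \<inter> (\<lambda>i. i + length u) ` slices v = {}" by (auto simp: slices_def)
  ultimately show ?thesis using assms
    by (simp add: path_functional_def slices_append sum.union_disjoint sum.reindex inj_on_def
        slice_length_append_left slice_length_append_right)
qed

lemma path_functional_uminus: "path_functional \<omega> \<epsilon> (map uminus w) = path_functional \<omega> \<epsilon> w"
  by (simp add: path_functional_def slices_def slice_length_def)

section \<open>Arches, the prime excursions\<close>

definition arch :: "int list \<Rightarrow> int list" where
  "arch w = 1 # w @ [-1]"

lemma height_arch_Suc: "i \<le> length w \<Longrightarrow> height (arch w) (Suc i) = 1 + height w i"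
  by (simp add: arch_def height_append)

lemma height_arch_end: "sum_list w = 0 \<Longrightarrow> length w < i \<Longrightarrow> height (arch w) (Suc i) = 0"
  by (cases "i - length w") (auto simp: arch_def height_append height_beyond)

text \<open>The slices of \<open>w\<close> are lifted by one unit with their lengths unchanged. The
  one new slice runs from step 0 to step \<open>2 * k + 1\<close>; its length
  \<open>2 * k + 1\<close> gives the argument \<open>k\<close> of \<open>\<omega>\<close>.\<close>

lemma path_functional_arch:
  assumes "w \<in> dyck_excursions k"
  shows "path_functional \<omega> \<epsilon> (arch w) = path_functional \<omega> \<epsilon> w + (\<omega> k - \<epsilon>)"
proof -
  have w: "set w \<subseteq> {1, -1}" "sum_list w = 0" "length w = 2 * k" "\<And>i. height w i \<ge> 0"
    using assms by (auto simp: dyck_excursions_iff dyck_bridges_iff)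
  have "i \<in> slices (arch w) \<longleftrightarrow> i = 0 \<or> i \<in> Suc ` slices w" for i
  proof (cases i)
    case 0
    then show ?thesis by (simp add: slices_def height_arch_Suc arch_def)
  next
    case (Suc l)
    consider "l < length w" | "l = length w" | "l > length w" by linarith
    then show ?thesis
    proof cases
      case 1
      then show ?thesis using Suc w(4)[of l] w(4)[of "Suc l"]
        by (auto simp: slices_def height_arch_Suc image_iff) (auto simp: arch_def)
    next
      case 2
      then show ?thesis using Suc w(2) by (auto simp: slices_def height_arch_end image_iff)
    next
      case 3
      then show ?thesis using Suc by (auto simp: slices_def arch_def)
    qed
  qed
  then have slices: "slices (arch w) = insert 0 (Suc ` slices w)" by blast
  have len0: "slice_length (arch w) 0 = Suc (length w)"
    unfolding slice_length_def
  proof (subst Least_equality)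
    show "0 < Suc (length w) \<and> height (arch w) (Suc (Suc (length w))) = height (arch w) 0"
      using w(2) by (simp add: height_arch_end)
    show "Suc (length w) \<le> j" if "0 < j \<and> height (arch w) (Suc j) = height (arch w) 0" for j
      using that w(4)[of j] by (cases "j \<le> length w") (auto simp: height_arch_Suc)
  qed simp
  have len: "slice_length (arch w) (Suc i) = slice_length w i" if i: "i \<in> slices w" for i
  proof -
    obtain j where j: "i < j" "j < length w" "height w (Suc j) = height w i"
      using slice_returns[OF w(1,2) i] by auto
    \<comment> \<open>Point \<open>Suc j\<close> of the arch lies one unit above point
      \<open>j\<close> of \<open>w\<close>. What remains is the return condition of \<open>w\<close>
      with \<open>j\<close> shifted by 1.\<close>
    have "(LEAST j. Suc i < j \<and> height (arch w) (Suc j) = height (arch w) (Suc i)) =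
          (LEAST j. 1 \<le> j \<and> i < j - 1 \<and> height w j = height w i)"
      using j by (intro Least_nat_cong_upto[of _ "Suc j"]) (auto simp: height_arch_Suc)
    also have "\<dots> = (LEAST j. i < j \<and> height w (Suc j) = height w i) + 1"
      using j by (intro Least_nat_shift[of _ j]) auto
    finally show ?thesis by (simp add: slice_length_def)
  qed
  have "finite (slices w)" by (auto simp: slices_def)
  then show ?thesis using w(3)
    by (simp add: path_functional_def slices len0 len sum.reindex)
qed

section \<open>Splitting off the first arch\<close>

lemma arch_append_bridge_iff:
  assumes "w \<in> dyck_excursions k"
  shows "arch w @ v \<in> dyck_bridges (Suc N) \<longleftrightarrow> k \<le> N \<and> v \<in> dyck_bridges (N - k)"
  using assms by (auto simp: dyck_excursions_iff dyck_bridges_iff arch_def)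

lemma height_arch_nonneg:
  assumes "w \<in> dyck_excursions k"
  shows "0 \<le> height (arch w) i"
proof (cases i)
  case (Suc j)
  then show ?thesis using assms
    by (cases "j \<le> length w")
       (auto simp: height_arch_Suc height_arch_end dyck_excursions_iff dyck_bridges_iff intro: add_nonneg_nonneg)
qed simp

lemma arch_append_excursion_iff:
  assumes w: "w \<in> dyck_excursions k"
  shows "arch w @ v \<in> dyck_excursions (Suc N) \<longleftrightarrow> k \<le> N \<and> v \<in> dyck_excursions (N - k)"
proof -
  have sum0: "sum_list (arch w) = 0"
    using w by (auto simp: arch_def dyck_excursions_iff dyck_bridges_iff)
  have "(\<forall>i. 0 \<le> height (arch w @ v) i) \<longleftrightarrow> (\<forall>i. 0 \<le> height v i)" (is "?l \<longleftrightarrow> ?r")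
  proof
    assume l: ?l
    show ?r
    proof
      fix i show "0 \<le> height v i"
        using l[rule_format, of "i + length (arch w)"] sum0
        by (cases i) (auto simp: height_append)
    qed
  next
    assume ?r then show ?l using sum0 height_arch_nonneg[OF w] by (auto simp: height_append)
  qed
  then show ?thesis using arch_append_bridge_iff[OF w] by (auto simp: dyck_excursions_iff)
qed

text \<open>If one excursion were shorter, the down-step closing its arch would bring the other
  excursion to height -1.\<close>

lemma arch_append_inj:
  assumes w: "w \<in> dyck_excursions k" "w' \<in> dyck_excursions k'" and eq: "arch w @ v = arch w' @ v'"
  shows "w = w' \<and> v = v'"
proof -
  have not_less: "\<not> length x < length y"
    if xy: "x \<in> dyck_excursions l" "y \<in> dyck_excursions l'" "x @ (-1) # u = y @ (-1) # u'"
    for x y u u' l l'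
  proof
    assume less: "length x < length y"
    have "height y (Suc (length x)) = height (y @ (-1) # u') (Suc (length x))"
      using less by (simp add: height_append)
    also have "\<dots> = height (x @ (-1) # u) (Suc (length x))" using xy(3) by simp
    also have "\<dots> = -1" using xy(1) by (simp add: height_append dyck_excursions_iff dyck_bridges_iff)
    finally have "height y (Suc (length x)) = -1" .
    moreover have "0 \<le> height y (Suc (length x))" using xy(2) by (simp add: dyck_excursions_iff)
    ultimately show False by simp
  qed
  have "w @ (-1) # v = w' @ (-1) # v'" using eq by (simp add: arch_def)
  moreover from this have "length w = length w'"
    using not_less[OF w(1,2)] not_less[OF w(2,1)] by (metis linorder_less_linear)
  ultimately show ?thesis by simp
qed

lemma first_return_decomposition:
  assumes w: "w \<in> dyck_bridges (Suc N)" and hd: "hd w = 1"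
  shows "\<exists>k u v. k \<le> N \<and> u \<in> dyck_excursions k \<and> v \<in> dyck_bridges (N - k) \<and> w = arch u @ v"
proof -
  have w': "set w \<subseteq> {1, -1}" "sum_list w = 0" "length w = 2 * Suc N"
    using w by (auto simp: dyck_bridges_iff)
  then have "w \<noteq> []" by auto
  then have w0: "w = 1 # tl w" using hd by (metis list.collapse)
  define w0 where "w0 = tl w"
  have w0: "w = 1 # w0" using w0 by (simp add: w0_def)
  \<comment> \<open>\<open>m\<close> is the first return to the axis. Before it the path is
    positive, since from height 1 it cannot reach negative heights without meeting 0.\<close>
  define m where "m = (LEAST m. 0 < m \<and> height w m = 0)"
  have ex: "0 < length w \<and> height w (length w) = 0" using w' by (simp add: height_def)
  have m: "0 < m" "height w m = 0" unfolding m_def using LeastI[of "\<lambda>m. 0 < m \<and> height w m = 0", OF ex] by auto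
  have m_le: "m \<le> length w" unfolding m_def using ex by (rule Least_le)
  have m_min: "height w i \<noteq> 0" if "0 < i" "i < m" for i
    using that not_less_Least[of i "\<lambda>m. 0 < m \<and> height w m = 0"] unfolding m_def by auto
  have h1: "height w 1 = 1" unfolding w0 by simp
  have pos: "height w i > 0" if i: "0 < i" "i < m" for i
  proof (rule ccontr)
    assume "\<not> height w i > 0"
    then have "\<exists>j. 1 \<le> j \<and> j \<le> i \<and> - height w j = 0"
      using i h1 height_step[OF w'(1)]
      by (intro nat_intermed_int_val[where f = "\<lambda>k. - height w k"]) (auto simp: abs_minus_commute)
    then show False using m_min i by auto
  qed
  have "m \<noteq> 1" using m h1 by auto
  with m have m2: "m \<ge> 2" by simp
  \<comment> \<open>Of the \<open>m\<close> steps up to the return, the first and the last form the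
    arch, and \<open>m - 2\<close> are left for the excursion.\<close>
  define u where "u = take (m - 2) w0"
  define v where "v = drop m w"
  have mS: "m = Suc (Suc (m - 2))" using m2 by simp
  have last: "w ! (m - 1) = -1"
  proof -
    have "height w m = height w (m - 1) + w ! (m - 1)"
      using height_Suc[of "m - 1" w] m m_le by simp
    moreover have "w ! (m - 1) \<in> set w" using m m_le by (intro nth_mem) simp
    then have "w ! (m - 1) \<in> {1, -1}" using w'(1) by blast
    ultimately show ?thesis using pos[of "m - 1"] m m2 by auto
  qed
  have len_u: "length u = m - 2" using m_le m2 w0 by (simp add: u_def)
  have "take m w = 1 # take (Suc (m - 2)) w0" unfolding w0 using m2 by (subst mS) simp
  also have "take (Suc (m - 2)) w0 = u @ [w0 ! (m - 2)]"
    unfolding u_def using m_le m2 w0 by (intro take_Suc_conv_app_nth) simp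
  also have "w0 ! (m - 2) = -1" using last w0 m2 by (simp add: nth_Cons' numeral_2_eq_2)
  finally have arch_u: "take m w = arch u" by (simp add: arch_def)
  have eq: "w = arch u @ v" using arch_u append_take_drop_id[of m w] by (simp add: v_def)
  have set_u: "set u \<subseteq> {1, -1}" using w'(1) eq by (auto simp: arch_def)
  have sum_u: "sum_list u = 0" using m(2) arch_u by (simp add: height_def arch_def)
  define k where "k = count_list u 1"
  have len_k: "length u = 2 * k" using sum_list_steps[OF set_u] sum_u by (simp add: k_def)
  have "0 \<le> height u i" for i
  proof (cases "i \<le> m - 2")
    case True
    then have "1 + height u i = height w (Suc i)"
      using len_u by (simp add: eq height_append height_arch_Suc) (simp add: arch_def)
    moreover have "Suc i < m" using True m2 by simp
    ultimately show ?thesis using pos[of "Suc i"] by simp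
  qed (use len_u sum_u in \<open>simp add: height_beyond\<close>)
  then have u: "u \<in> dyck_excursions k"
    using set_u sum_u len_k by (simp add: dyck_excursions_iff dyck_bridges_iff)
  show ?thesis using u w arch_append_bridge_iff[OF u, of v N] unfolding eq by blast
qed

text \<open>Stated for a family \<open>Y\<close> so as to serve excursions and bridges alike; the
  first hypothesis says that \<open>Y\<close> is preserved when a leading arch is added or
  removed.\<close>

lemma sum_first_return:
  fixes f :: "int list \<Rightarrow> 'a :: comm_monoid_add"
  assumes Y: "\<And>k u v N. u \<in> dyck_excursions k \<Longrightarrow>
                arch u @ v \<in> Y (Suc N) \<longleftrightarrow> k \<le> N \<and> v \<in> Y (N - k)"
    and sub: "\<And>N. Y N \<subseteq> dyck_bridges N"
  shows "(\<Sum>w | w \<in> Y (Suc N) \<and> hd w = 1. f w) =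
         (\<Sum>k\<le>N. \<Sum>u\<in>dyck_excursions k. \<Sum>v\<in>Y (N - k). f (arch u @ v))"
proof -
  have fin: "finite (Y N)" for N using sub finite_dyck_bridges by (rule finite_subset)
  let ?S = "SIGMA k:{..N}. dyck_excursions k \<times> Y (N - k)"
  have "bij_betw (\<lambda>(k, u, v). arch u @ v) ?S {w. w \<in> Y (Suc N) \<and> hd w = 1}"
  proof (rule bij_betw_imageI)
    show "inj_on (\<lambda>(k, u, v). arch u @ v) ?S"
    proof (rule inj_onI, clarify, goal_cases)
      case (1 k u v k' u' v')
      with arch_append_inj[of u k u' k' v v'] have "u = u'" "v = v'" by auto
      with 1 show ?case by (auto simp: dyck_excursions_iff dyck_bridges_iff)
    qed
    show "(\<lambda>(k, u, v). arch u @ v) ` ?S = {w. w \<in> Y (Suc N) \<and> hd w = 1}" (is "?l = ?r")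
    proof (intro equalityI subsetI)
      fix w assume "w \<in> ?l"
      then show "w \<in> ?r" using Y by (auto simp: arch_def)
    next
      fix w assume w: "w \<in> ?r"
      with sub have "w \<in> dyck_bridges (Suc N)" "hd w = 1" by auto
      then obtain k u v where "k \<le> N" "u \<in> dyck_excursions k" "w = arch u @ v"
        using first_return_decomposition by blast
      then show "w \<in> ?l" using Y w by (auto intro!: image_eqI[of _ _ "(k, u, v)"])
    qed
  qed
  then have "(\<Sum>w | w \<in> Y (Suc N) \<and> hd w = 1. f w) = (\<Sum>(k, u, v)\<in>?S. f (arch u @ v))"
    by (subst sum.reindex_bij_betw[symmetric]) (auto simp: case_prod_unfold)
  also have "\<dots> = (\<Sum>k\<le>N. \<Sum>(u, v)\<in>dyck_excursions k \<times> Y (N - k). f (arch u @ v))"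
    using fin by (subst sum.Sigma) (auto simp: case_prod_unfold)
  finally show ?thesis by (simp add: sum.cartesian_product)
qed

lemma sum_excursions_Suc:
  fixes f :: "int list \<Rightarrow> 'a :: comm_monoid_add"
  shows "(\<Sum>w\<in>dyck_excursions (Suc N). f w) =
         (\<Sum>k\<le>N. \<Sum>u\<in>dyck_excursions k. \<Sum>v\<in>dyck_excursions (N - k). f (arch u @ v))"
proof -
  have "hd w = 1" if w: "w \<in> dyck_excursions (Suc N)" for w
  proof -
    obtain x w0 where "w = x # w0" "x = 1 \<or> x = -1"
      using w by (cases w) (auto simp: dyck_excursions_iff dyck_bridges_iff)
    moreover have "height w 1 \<ge> 0" using w by (auto simp: dyck_excursions_iff)
    ultimately show ?thesis by auto
  qed
  then have "dyck_excursions (Suc N) = {w. w \<in> dyck_excursions (Suc N) \<and> hd w = 1}" by auto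
  then have "(\<Sum>w\<in>dyck_excursions (Suc N). f w) = (\<Sum>w | w \<in> dyck_excursions (Suc N) \<and> hd w = 1. f w)"
    by simp
  also have "\<dots> = (\<Sum>k\<le>N. \<Sum>u\<in>dyck_excursions k. \<Sum>v\<in>dyck_excursions (N - k). f (arch u @ v))"
    using arch_append_excursion_iff by (rule sum_first_return) (auto simp: dyck_excursions_def)
  finally show ?thesis .
qed

text \<open>Reflection in the axis exchanges the bridges that start upwards with those that start
  downwards. The sum is written twice because a \<open>comm_monoid_add\<close> has no factor
  2.\<close>

lemma sum_bridges_Suc:
  fixes f :: "int list \<Rightarrow> 'a :: comm_monoid_add"
  assumes neg: "\<And>w. f (map uminus w) = f w"
  shows "(\<Sum>w\<in>dyck_bridges (Suc N). f w) =
         (\<Sum>k\<le>N. \<Sum>u\<in>dyck_excursions k. \<Sum>v\<in>dyck_bridges (N - k). f (arch u @ v)) +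
         (\<Sum>k\<le>N. \<Sum>u\<in>dyck_excursions k. \<Sum>v\<in>dyck_bridges (N - k). f (arch u @ v))"
proof -
  let ?P = "{w. w \<in> dyck_bridges (Suc N) \<and> hd w = 1}"
  let ?M = "{w. w \<in> dyck_bridges (Suc N) \<and> hd w = -1}"
  have split: "dyck_bridges (Suc N) = ?P \<union> ?M"
  proof -
    have "hd w = 1 \<or> hd w = -1" if "w \<in> dyck_bridges (Suc N)" for w
      using that by (cases w) (auto simp: dyck_bridges_iff)
    then show ?thesis by auto
  qed
  have neg_bridge: "map uminus w \<in> dyck_bridges (Suc N)" if "w \<in> dyck_bridges (Suc N)" for w
    using that uminus_sum_list_map[of id w] by (auto simp: dyck_bridges_iff comp_def)
  have hd_neg: "hd (map uminus w) = - hd w" if "w \<in> dyck_bridges (Suc N)" for w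
    using that by (cases w) (auto simp: dyck_bridges_iff)
  have "(\<Sum>w\<in>?M. f w) = (\<Sum>w\<in>?P. f w)"
    by (rule sum.reindex_bij_witness[of _ "map uminus" "map uminus"])
       (auto simp: neg neg_bridge hd_neg comp_def)
  moreover have "(\<Sum>w\<in>dyck_bridges (Suc N). f w) = (\<Sum>w\<in>?P. f w) + (\<Sum>w\<in>?M. f w)"
    by (subst split, rule sum.union_disjoint) auto
  moreover have "(\<Sum>w\<in>?P. f w) =
      (\<Sum>k\<le>N. \<Sum>u\<in>dyck_excursions k. \<Sum>v\<in>dyck_bridges (N - k). f (arch u @ v))"
    by (rule sum_first_return) (auto simp: arch_append_bridge_iff)
  ultimately show ?thesis by simp
qed

section \<open>Power series with coefficients of polynomial order\<close>

text \<open>Finitely many exceptional indices go into the constant, which is possible because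
  \<open>g\<close> never vanishes. This is the reason for \<open>real (Suc n)\<close> in the weights
  below.\<close>

lemma bigo_nat_bound:
  fixes f g :: "nat \<Rightarrow> real"
  assumes "f \<in> O(g)" "\<And>n. g n > 0"
  obtains C where "C > 0" "\<And>n. \<bar>f n\<bar> \<le> C * g n"
proof -
  obtain c where c: "c > 0" "\<forall>\<^sub>F n in sequentially. \<bar>f n\<bar> \<le> c * \<bar>g n\<bar>"
    using assms(1) by (elim landau_o.bigE) auto
  then obtain N where N: "\<And>n. n \<ge> N \<Longrightarrow> \<bar>f n\<bar> \<le> c * \<bar>g n\<bar>" by (auto simp: eventually_sequentially)
  define C where "C = c + (\<Sum>k<N. \<bar>f k\<bar> / g k)"
  have sum0: "(\<Sum>k<N. \<bar>f k\<bar> / g k) \<ge> 0" using assms(2) by (intro sum_nonneg) (simp add: less_imp_le)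
  have "\<bar>f n\<bar> \<le> C * g n" for n
  proof (cases "n \<ge> N")
    case True
    have "\<bar>f n\<bar> \<le> c * g n" using N[OF True] assms(2)[of n] by simp
    also have "\<dots> \<le> C * g n" using sum0 assms(2)[of n] by (intro mult_right_mono) (auto simp: C_def)
    finally show ?thesis .
  next
    case False
    have "\<bar>f n\<bar> / g n \<le> (\<Sum>k<N. \<bar>f k\<bar> / g k)"
      using False assms(2) by (intro member_le_sum) (auto simp: less_imp_le)
    then have "\<bar>f n\<bar> / g n \<le> C" using c by (simp add: C_def)
    then show ?thesis using assms(2)[of n] by (simp add: field_simps)
  qed
  moreover have "C > 0" using c sum0 by (simp add: C_def)
  ultimately show thesis using that by blast
qed

text \<open>The \<open>1 +\<close> and \<open>Suc\<close> keep the weight positive at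
  \<open>n = 0\<close>. The power of the logarithm is left open because every convolution may raise
  it.\<close>

definition plog :: "real \<Rightarrow> real fps set" where
  "plog u = {F. \<exists>C c. \<forall>n. \<bar>F $ n\<bar> \<le> C * (real (Suc n) powr u * (1 + ln (real (Suc n))) ^ c)}"

lemma plogE:
  assumes "F \<in> plog u"
  obtains C c where "C \<ge> 0" "\<And>n. \<bar>F $ n\<bar> \<le> C * (real (Suc n) powr u * (1 + ln (real (Suc n))) ^ c)"
proof -
  obtain C c where *: "\<And>n. \<bar>F $ n\<bar> \<le> C * (real (Suc n) powr u * (1 + ln (real (Suc n))) ^ c)"
    using assms by (auto simp: plog_def)
  from *[of 0] have "C \<ge> 0" by simp
  with * show thesis using that by blast
qed

lemma plog_weight_mono:
  assumes "u \<le> v" "c \<le> d"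
  shows "real (Suc n) powr u * (1 + ln (real (Suc n))) ^ c \<le>
         real (Suc n) powr v * (1 + ln (real (Suc n))) ^ d"
  using assms by (intro mult_mono powr_mono power_increasing) auto

lemma plog_weight_nonneg: "0 \<le> real (Suc n) powr u * (1 + ln (real (Suc n))) ^ c"
  by (intro mult_nonneg_nonneg zero_le_power) auto

lemma plog_mono:
  assumes "F \<in> plog u" "u \<le> v"
  shows "F \<in> plog v"
proof -
  obtain C c where F: "C \<ge> 0" "\<And>n. \<bar>F $ n\<bar> \<le> C * (real (Suc n) powr u * (1 + ln (real (Suc n))) ^ c)"
    using assms(1) by (rule plogE) blast
  have "\<bar>F $ n\<bar> \<le> C * (real (Suc n) powr v * (1 + ln (real (Suc n))) ^ c)" for n
    using F(1) assms(2) by (intro order_trans[OF F(2)] mult_left_mono plog_weight_mono) auto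
  then show ?thesis unfolding plog_def by blast
qed

lemma plog_bigo:
  assumes "(\<lambda>n. F $ n) \<in> O(\<lambda>n. real (Suc n) powr u)"
  shows "F \<in> plog u"
proof -
  obtain C where "C > 0" "\<And>n. \<bar>F $ n\<bar> \<le> C * real (Suc n) powr u"
    using bigo_nat_bound[OF assms] by auto
  then show ?thesis unfolding plog_def by (intro CollectI exI[of _ C] exI[of _ 0]) simp
qed

lemma plog_add:
  assumes "F \<in> plog u" "G \<in> plog u"
  shows "F + G \<in> plog u"
proof -
  obtain C c where F: "C \<ge> 0" "\<And>n. \<bar>F $ n\<bar> \<le> C * (real (Suc n) powr u * (1 + ln (real (Suc n))) ^ c)"
    using assms(1) by (rule plogE) blast
  obtain D d where G: "D \<ge> 0" "\<And>n. \<bar>G $ n\<bar> \<le> D * (real (Suc n) powr u * (1 + ln (real (Suc n))) ^ d)"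
    using assms(2) by (rule plogE) blast
  have "\<bar>(F + G) $ n\<bar> \<le> (C + D) * (real (Suc n) powr u * (1 + ln (real (Suc n))) ^ max c d)" for n
  proof -
    have "\<bar>(F + G) $ n\<bar> \<le> \<bar>F $ n\<bar> + \<bar>G $ n\<bar>" by (simp add: abs_triangle_ineq)
    also have "\<dots> \<le> C * (real (Suc n) powr u * (1 + ln (real (Suc n))) ^ max c d) +
                    D * (real (Suc n) powr u * (1 + ln (real (Suc n))) ^ max c d)"
      using F(1) G(1) by (intro add_mono order_trans[OF F(2)] order_trans[OF G(2)] mult_left_mono plog_weight_mono) auto
    finally show ?thesis by (simp add: algebra_simps)
  qed
  then show ?thesis unfolding plog_def by blast
qed

lemma plog_cmult:
  assumes "F \<in> plog u"
  shows "fps_const k * F \<in> plog u"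
proof -
  obtain C c where F: "C \<ge> 0" "\<And>n. \<bar>F $ n\<bar> \<le> C * (real (Suc n) powr u * (1 + ln (real (Suc n))) ^ c)"
    using assms by (rule plogE) blast
  have "\<bar>(fps_const k * F) $ n\<bar> \<le> (\<bar>k\<bar> * C) * (real (Suc n) powr u * (1 + ln (real (Suc n))) ^ c)" for n
    using mult_left_mono[OF F(2)[of n], of "\<bar>k\<bar>"] by (simp add: abs_mult mult.assoc)
  then show ?thesis unfolding plog_def by blast
qed

lemma plog_0 [simp]: "0 \<in> plog u"
  unfolding plog_def by (auto intro!: exI[of _ 0])

lemma plog_uminus: "F \<in> plog u \<Longrightarrow> - F \<in> plog u"
  by (simp add: plog_def)

lemma plog_diff: "F \<in> plog u \<Longrightarrow> G \<in> plog u \<Longrightarrow> F - G \<in> plog u"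
  using plog_add[of F u "- G"] plog_uminus[of G] by simp

lemma plog_sum: "(\<And>i. i \<in> A \<Longrightarrow> F i \<in> plog u) \<Longrightarrow> sum F A \<in> plog u"
  by (induction A rule: infinite_finite_induct) (auto intro: plog_add)

text \<open>Write the summand as \<open>1 / real (Suc k)\<close> times
  \<open>real (Suc k) powr (u + 1)\<close>. The second factor is monotone in \<open>k\<close>, hence
  at most its value at one of the two ends, and the harmonic sum produces the logarithm.\<close>

lemma sum_powr_le:
  "(\<Sum>k\<le>n. real (Suc k) powr u) \<le> (1 + ln (real (Suc n))) * max 1 (real (Suc n) powr (u + 1))"
proof -
  have harm: "(\<Sum>k\<le>n. 1 / real (Suc k)) \<le> 1 + ln (real (Suc n))"
  proof (induction n)
    case (Suc n)
    have "1 / real (Suc (Suc n)) \<le> ln (real (Suc (Suc n))) - ln (real (Suc n))"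
    proof -
      have "ln (real (Suc n) / real (Suc (Suc n))) \<le> real (Suc n) / real (Suc (Suc n)) - 1"
        by (intro ln_le_minus_one) simp
      then show ?thesis by (simp add: ln_div field_simps)
    qed
    then show ?case using Suc.IH by simp
  qed simp
  have "real (Suc k) powr u \<le> 1 / real (Suc k) * max 1 (real (Suc n) powr (u + 1))" if "k \<le> n" for k
  proof -
    have "real (Suc k) powr u = 1 / real (Suc k) * real (Suc k) powr (u + 1)"
      by (simp add: powr_add)
    also have "real (Suc k) powr (u + 1) \<le> max 1 (real (Suc n) powr (u + 1))"
    proof (cases "u + 1 \<ge> 0")
      case True
      then have "real (Suc k) powr (u + 1) \<le> real (Suc n) powr (u + 1)"
        using that by (intro powr_mono2) auto
      then show ?thesis by simp
    next
      case False
      then have "real (Suc k) powr (u + 1) \<le> 1" using powr_mono[of "u + 1" 0 "real (Suc k)"] by simp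
      then show ?thesis by simp
    qed
    finally show ?thesis by (simp add: divide_right_mono)
  qed
  then have "(\<Sum>k\<le>n. real (Suc k) powr u) \<le> (\<Sum>k\<le>n. 1 / real (Suc k) * max 1 (real (Suc n) powr (u + 1)))"
    by (intro sum_mono) auto
  also have "\<dots> = (\<Sum>k\<le>n. 1 / real (Suc k)) * max 1 (real (Suc n) powr (u + 1))"
    by (simp add: sum_distrib_right)
  also have "\<dots> \<le> (1 + ln (real (Suc n))) * max 1 (real (Suc n) powr (u + 1))"
    using harm by (intro mult_right_mono) auto
  finally show ?thesis .
qed

text \<open>Between \<open>n / 2\<close> and \<open>n\<close> all powers are comparable; the
  absolute value covers both signs of \<open>v\<close>.\<close>

lemma powr_half_le:
  assumes "n \<le> 2 * m + 1" "m \<le> n"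
  shows "real (Suc m) powr v \<le> 2 powr \<bar>v\<bar> * real (Suc n) powr v"
proof (cases "v \<ge> 0")
  case True
  have "real (Suc m) powr v \<le> real (Suc n) powr v" using assms True by (intro powr_mono2) auto
  also have "\<dots> \<le> 2 powr \<bar>v\<bar> * real (Suc n) powr v"
    using mult_right_mono[OF ge_one_powr_ge_zero[of 2 "\<bar>v\<bar>"], of "real (Suc n) powr v"] by simp
  finally show ?thesis .
next
  case False
  have "real (Suc m) powr v \<le> (real (Suc n) / 2) powr v"
    using assms False by (intro powr_mono2') auto
  also have "\<dots> = 2 powr (-v) * real (Suc n) powr v" by (simp add: powr_divide powr_minus field_simps)
  finally show ?thesis using False by simp
qed

text \<open>Every term of the convolution has a factor whose index is at least \<open>n div 2\<close>.\<close>

lemma sum_powr_convolution_le: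
  assumes "w \<ge> u" "w \<ge> v" "w \<ge> u + v + 1"
  shows "(\<Sum>k\<le>n. real (Suc k) powr u * real (Suc (n - k)) powr v) \<le>
         2 * (2 powr \<bar>u\<bar> + 2 powr \<bar>v\<bar>) * ((1 + ln (real (Suc n))) * real (Suc n) powr w)"
proof -
  let ?x = "real (Suc n)" and ?l = "1 + ln (real (Suc n))"
  \<comment> \<open>\<open>b\<close> belongs to the factor whose index is at least
    \<open>n div 2\<close>, \<open>a\<close> to the factor that is summed over all indices.\<close>
  have half: "2 powr \<bar>b\<bar> * ?x powr b * (\<Sum>k\<le>n. real (Suc k) powr a) \<le> 2 * 2 powr \<bar>b\<bar> * (?l * ?x powr w)"
    if ab: "w \<ge> b" "w \<ge> a + b + 1" for a b
  proof -
    have "?x powr b * (\<Sum>k\<le>n. real (Suc k) powr a) \<le> ?x powr b * (?l * max 1 (?x powr (a + 1)))"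
      by (intro mult_left_mono sum_powr_le) auto
    also have "\<dots> = ?l * (?x powr b * max 1 (?x powr (a + 1)))" by simp
    also have "?x powr b * max 1 (?x powr (a + 1)) \<le> ?x powr w"
      using powr_mono[OF ab(1), of ?x] powr_mono[OF ab(2), of ?x] by (auto simp: max_def powr_add[symmetric] algebra_simps)
    finally have "?x powr b * (\<Sum>k\<le>n. real (Suc k) powr a) \<le> ?l * ?x powr w"
      by (simp add: mult_left_mono)
    then have "2 powr \<bar>b\<bar> * (?x powr b * (\<Sum>k\<le>n. real (Suc k) powr a)) \<le> 2 powr \<bar>b\<bar> * (?l * ?x powr w)"
      by (intro mult_left_mono) auto
    moreover have "0 \<le> 2 powr \<bar>b\<bar> * (?l * ?x powr w)" by simp
    ultimately show ?thesis unfolding mult.assoc by linarith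
  qed
  have "real (Suc k) powr u * real (Suc (n - k)) powr v \<le>
        2 powr \<bar>v\<bar> * ?x powr v * real (Suc k) powr u + 2 powr \<bar>u\<bar> * ?x powr u * real (Suc (n - k)) powr v"
    if "k \<le> n" for k
  proof (cases "2 * k \<le> n")
    case True
    have "real (Suc k) powr u * real (Suc (n - k)) powr v \<le> real (Suc k) powr u * (2 powr \<bar>v\<bar> * ?x powr v)"
      using that True by (intro mult_left_mono powr_half_le) auto
    moreover have "0 \<le> 2 powr \<bar>u\<bar> * ?x powr u * real (Suc (n - k)) powr v" by simp
    ultimately show ?thesis by (simp only: mult_ac)
  next
    case False
    have "real (Suc k) powr u * real (Suc (n - k)) powr v \<le> (2 powr \<bar>u\<bar> * ?x powr u) * real (Suc (n - k)) powr v"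
      using that False by (intro mult_right_mono powr_half_le) auto
    moreover have "0 \<le> 2 powr \<bar>v\<bar> * ?x powr v * real (Suc k) powr u" by simp
    ultimately show ?thesis by linarith
  qed
  then have "(\<Sum>k\<le>n. real (Suc k) powr u * real (Suc (n - k)) powr v) \<le>
    (\<Sum>k\<le>n. 2 powr \<bar>v\<bar> * ?x powr v * real (Suc k) powr u + 2 powr \<bar>u\<bar> * ?x powr u * real (Suc (n - k)) powr v)"
    by (intro sum_mono) auto
  also have "\<dots> = 2 powr \<bar>v\<bar> * ?x powr v * (\<Sum>k\<le>n. real (Suc k) powr u) +
                  2 powr \<bar>u\<bar> * ?x powr u * (\<Sum>k\<le>n. real (Suc (n - k)) powr v)"
    by (simp only: sum.distrib sum_distrib_left)
  also have "(\<Sum>k\<le>n. real (Suc (n - k)) powr v) = (\<Sum>k\<le>n. real (Suc k) powr v)"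
    by (rule sum.nat_diff_reindex[of "\<lambda>k. real (Suc k) powr v" "Suc n", simplified lessThan_Suc_atMost diff_Suc_Suc])
  also have "2 powr \<bar>v\<bar> * ?x powr v * (\<Sum>k\<le>n. real (Suc k) powr u) + 2 powr \<bar>u\<bar> * ?x powr u * (\<Sum>k\<le>n. real (Suc k) powr v)
     \<le> 2 * 2 powr \<bar>v\<bar> * (?l * ?x powr w) + 2 * 2 powr \<bar>u\<bar> * (?l * ?x powr w)"
    using assms by (intro add_mono half) auto
  finally show ?thesis by (simp add: algebra_simps)
qed

text \<open>The three bounds on \<open>w\<close> are the sizes of the three parts of the
  convolution: the two ends, where one index is small, and the bulk. No cancellation is
  used.\<close>

lemma plog_mult:
  assumes F: "F \<in> plog u" and G: "G \<in> plog v" and w: "u \<le> w" "v \<le> w" "u + v + 1 \<le> w"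
  shows "F * G \<in> plog w"
proof -
  obtain C c where F': "C \<ge> 0" "\<And>n. \<bar>F $ n\<bar> \<le> C * (real (Suc n) powr u * (1 + ln (real (Suc n))) ^ c)"
    using F by (rule plogE) blast
  obtain D d where G': "D \<ge> 0" "\<And>n. \<bar>G $ n\<bar> \<le> D * (real (Suc n) powr v * (1 + ln (real (Suc n))) ^ d)"
    using G by (rule plogE) blast
  define K where "K = 2 * (2 powr \<bar>u\<bar> + 2 powr \<bar>v\<bar>)"
  have "\<bar>(F * G) $ n\<bar> \<le> (C * D * K) * (real (Suc n) powr w * (1 + ln (real (Suc n))) ^ (c + d + 1))" for n
  proof -
    let ?l = "1 + ln (real (Suc n))"
    have "\<bar>(F * G) $ n\<bar> \<le> (\<Sum>k\<le>n. \<bar>F $ k\<bar> * \<bar>G $ (n - k)\<bar>)"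
      by (simp add: fps_mult_nth atLeast0AtMost sum_abs abs_mult[symmetric])
    also have "\<dots> \<le> (\<Sum>k\<le>n. (C * (real (Suc k) powr u * ?l ^ c)) * (D * (real (Suc (n - k)) powr v * ?l ^ d)))"
      using F'(1) G'(1) by (intro sum_mono mult_mono order_trans[OF F'(2)] order_trans[OF G'(2)] mult_left_mono
          power_mono mult_nonneg_nonneg zero_le_power) auto
    also have "\<dots> = C * D * ?l ^ (c + d) * (\<Sum>k\<le>n. real (Suc k) powr u * real (Suc (n - k)) powr v)"
      by (simp add: sum_distrib_left power_add mult_ac)
    also have "\<dots> \<le> C * D * ?l ^ (c + d) * (K * (?l * real (Suc n) powr w))"
      unfolding K_def using F'(1) G'(1) w by (intro mult_left_mono sum_powr_convolution_le) auto
    finally show ?thesis by (simp add: mult_ac)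
  qed
  then show ?thesis unfolding plog_def by blast
qed

lemma plog_X_mult:
  assumes "F \<in> plog u"
  shows "fps_X * F \<in> plog u"
proof -
  obtain C c where F: "C \<ge> 0" "\<And>n. \<bar>F $ n\<bar> \<le> C * (real (Suc n) powr u * (1 + ln (real (Suc n))) ^ c)"
    using assms by (rule plogE) blast
  have "\<bar>(fps_X * F) $ n\<bar> \<le> (C * 2 powr \<bar>u\<bar>) * (real (Suc n) powr u * (1 + ln (real (Suc n))) ^ c)" for n
  proof (cases n)
    case 0
    then show ?thesis using F(1) by simp
  next
    case (Suc m)
    have "\<bar>(fps_X * F) $ n\<bar> \<le> C * (real (Suc m) powr u * (1 + ln (real (Suc m))) ^ c)"
      using F(2)[of m] Suc by simp
    also have "\<dots> \<le> C * (2 powr \<bar>u\<bar> * real (Suc n) powr u * (1 + ln (real (Suc n))) ^ c)"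
      using Suc F(1) by (intro mult_left_mono mult_mono powr_half_le power_mono) auto
    finally show ?thesis by (simp add: mult_ac)
  qed
  then show ?thesis unfolding plog_def by blast
qed

lemma plog_conv_radius:
  assumes "F \<in> plog u"
  shows "fps_conv_radius F \<ge> 1"
proof -
  obtain C c where F: "C \<ge> 0" "\<And>n. \<bar>F $ n\<bar> \<le> C * (real (Suc n) powr u * (1 + ln (real (Suc n))) ^ c)"
    using assms by (rule plogE) blast
  have "conv_radius (\<lambda>n. F $ n) \<ge> ereal 1"
  proof (rule conv_radius_geI_ex')
    fix r :: real assume r: "0 < r" "ereal r < ereal 1"
    obtain q where q: "r < q" "q < 1" using r dense[of r 1] by auto
    have "(\<lambda>n. (real (Suc n) powr u * (1 + ln (real (Suc n))) ^ c) * r ^ n) \<in> O(\<lambda>n. q ^ n)"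
      using r q by real_asymp
    then have "(\<lambda>n. F $ n * r ^ n) \<in> O(\<lambda>n. q ^ n)"
    proof (rule landau_o.big_trans[rotated])
      show "(\<lambda>n. F $ n * r ^ n) \<in> O(\<lambda>n. real (Suc n) powr u * (1 + ln (real (Suc n))) ^ c * r ^ n)"
        using F r by (intro landau_o.bigI[of "C + 1"]) (auto simp: abs_mult mult.assoc[symmetric] intro!: always_eventually mult_right_mono order_trans[OF F(2)])
    qed
    moreover have "summable (\<lambda>n. norm (q ^ n))" using q r by (simp add: summable_geometric)
    ultimately show "summable (\<lambda>n. F $ n * of_real r ^ n)"
      using summable_comparison_test_bigo by fastforce
  qed
  then show ?thesis by (simp add: fps_conv_radius_def one_ereal_def)
qed

section \<open>Binomial series\<close>

text \<open>The coefficients of \<open>(1 - X) powr (- a)\<close>. Rising factorials keep them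
  positive for positive \<open>a\<close>, and multiplication of the series adds the
  parameters.\<close>

definition binser :: "real \<Rightarrow> real fps" where
  "binser a = Abs_fps (\<lambda>n. pochhammer a n / fact n)"

lemma binser_nth: "binser a $ n = pochhammer a n / fact n"
  by (simp add: binser_def)

lemma binser_nth_0 [simp]: "binser a $ 0 = 1"
  by (simp add: binser_nth)

lemma binser_Suc: "binser a $ Suc n = binser a $ n * ((a + real n) / (real n + 1))"
  by (simp add: binser_nth pochhammer_Suc field_simps)

text \<open>Vandermonde's identity for rising factorials, divided by \<open>fact n\<close>.\<close>

lemma binser_mult: "binser a * binser b = binser (a + b)"
proof (rule fps_ext)
  fix n
  have "(\<Sum>i\<le>n. (pochhammer a i / fact i) * (pochhammer b (n - i) / fact (n - i))) =
        (\<Sum>i\<le>n. real (n choose i) * pochhammer a i * pochhammer b (n - i) / fact n)"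
    by (intro sum.cong) (auto simp: binomial_fact field_simps)
  then show "(binser a * binser b) $ n = binser (a + b) $ n"
    by (simp add: fps_mult_nth binser_nth pochhammer_binomial_sum atLeast0AtMost sum_divide_distrib)
qed

lemma binser_0: "binser 0 = 1"
  by (rule fps_ext) (auto simp: binser_nth pochhammer_0_left)

lemma binser_minus_1: "binser (-1) = 1 - fps_X"
proof (rule fps_ext)
  fix n
  have "binser (-1) $ Suc (Suc m) = 0" for m
    by (induction m) (simp_all add: binser_Suc)
  then show "binser (-1) $ n = (1 - fps_X) $ n"
    by (cases n rule: nat.exhaust; cases "n - 1") (auto simp: binser_Suc fps_X_def)
qed

lemma binser_sums:
  assumes "\<bar>z\<bar> < 1"
  shows "(\<lambda>n. binser a $ n * z ^ n) sums (1 - z) powr (-a)"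
proof -
  have "(- a gchoose n) * (- z) ^ n = binser a $ n * z ^ n" for n
    by (simp add: gbinomial_pochhammer binser_nth power_minus[of z] flip: mult.assoc)
  then show ?thesis using gen_binomial_real[of "-z" "-a"] assms by simp
qed

lemma eval_binser: "\<bar>z\<bar> < 1 \<Longrightarrow> eval_fps (binser a) z = (1 - z) powr (-a)"
  using binser_sums[of z a] by (simp add: eval_fps_def sums_iff)

lemma binser_pos: "a > 0 \<Longrightarrow> binser a $ n > 0"
  by (simp add: binser_nth pochhammer_pos)

text \<open>\<open>r + g\<close> decreases to \<open>L\<close> and \<open>r - g\<close> increases to
  \<open>L\<close>.\<close>

lemma LIMSEQ_dist_le:
  fixes r g :: "nat \<Rightarrow> real"
  assumes r: "r \<longlonglongrightarrow> L" and g: "g \<longlonglongrightarrow> 0"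
    and step: "\<And>n. \<bar>r (Suc n) - r n\<bar> \<le> g n - g (Suc n)"
  shows "\<bar>r n - L\<bar> \<le> g n"
proof -
  have "decseq (\<lambda>n. r n + g n)"
    by (rule decseq_SucI) (use step in \<open>smt (verit)\<close>)
  then have "L + 0 \<le> r n + g n" by (intro decseq_ge tendsto_add r g)
  moreover have "incseq (\<lambda>n. r n - g n)"
    by (rule incseq_SucI) (use step in \<open>smt (verit)\<close>)
  then have "r n - g n \<le> L - 0" by (intro incseq_le tendsto_diff r g)
  ultimately show ?thesis by (simp add: abs_le_iff)
qed

text \<open>Gauss's limit for the Gamma function. With \<open>rGamma\<close> it also covers the
  poles of \<open>Gamma\<close>, where the limit is 0 and the series is a polynomial.\<close>

lemma binser_limit: "(\<lambda>n. binser a $ n * real (Suc n) powr (1 - a)) \<longlonglongrightarrow> rGamma a"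
proof -
  have "(\<lambda>n. ((a - 1 + real n) gchoose n) * exp (- (a - 1) * ln (real n))) \<longlonglongrightarrow> rGamma (a - 1 + 1)"
    using Gamma_gbinomial[of "a - 1"] by simp
  also have "(\<lambda>n. ((a - 1 + real n) gchoose n) * exp (- (a - 1) * ln (real n))) =
             (\<lambda>n. binser a $ n * exp ((1 - a) * ln (real n)))"
    by (rule ext) (simp add: gbinomial_pochhammer' binser_nth)
  finally have "(\<lambda>n. binser a $ n * exp ((1 - a) * ln (real n))) \<longlonglongrightarrow> rGamma a" by simp
  moreover have "(\<lambda>n. real (Suc n) powr (1 - a) / exp ((1 - a) * ln (real n))) \<longlonglongrightarrow> 1"
    by real_asymp
  ultimately have "(\<lambda>n. binser a $ n * exp ((1 - a) * ln (real n)) *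
      (real (Suc n) powr (1 - a) / exp ((1 - a) * ln (real n)))) \<longlonglongrightarrow> rGamma a * 1"
    by (rule tendsto_mult)
  then show ?thesis by simp
qed

text \<open>The limit alone has no rate. The rate comes from the consecutive ratios of the
  normalised coefficients, which are \<open>1 + O(1/n^2)\<close> because the terms of order
  \<open>1/n\<close> cancel; summing the increments leaves \<open>O(1/n)\<close>.\<close>

lemma binser_asymp:
  "(\<lambda>n. binser a $ n - rGamma a * real (Suc n) powr (a - 1)) \<in> O(\<lambda>n. real (Suc n) powr (a - 2))"
proof -
  define r where "r = (\<lambda>n. binser a $ n * real (Suc n) powr (1 - a))"
  have r: "r \<longlonglongrightarrow> rGamma a" unfolding r_def by (rule binser_limit)
  have step: "r (Suc n) - r n = r n * (((a + real n) / (real n + 1)) * ((real n + 2) / (real n + 1)) powr (1 - a) - 1)" for n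
  proof -
    have "((real n + 2) / (real n + 1)) powr (1 - a) = (real n + 2) powr (1 - a) / (real n + 1) powr (1 - a)"
      by (simp add: powr_divide)
    then show ?thesis by (simp add: r_def binser_Suc field_simps)
  qed
  have "r \<in> O(\<lambda>_. 1)" using r by (intro bigoI_tendsto[where c = "rGamma a"]) auto
  \<comment> \<open>The difference in the bound is of order \<open>1/n^2\<close> and telescopes to
    \<open>1 / (real n + 1)\<close>.\<close>
  moreover have "(\<lambda>n::nat. ((a + real n)/(real n+1)) * ((real n + 2)/(real n+1)) powr (1 - a) - 1)
      \<in> O(\<lambda>n. 1 / (real n + 1) - 1 / (real n + 2))"
    by real_asymp
  ultimately have "(\<lambda>n. r (Suc n) - r n) \<in> O(\<lambda>n. 1 * (1 / (real n + 1) - 1 / (real n + 2)))"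
    unfolding step by (rule landau_o.big.mult)
  then obtain C where C: "C > 0" "\<And>n. \<bar>r (Suc n) - r n\<bar> \<le> C * (1 * (1 / (real n + 1) - 1 / (real n + 2)))"
    by (rule bigo_nat_bound) (auto intro!: divide_strict_left_mono)
  have "\<bar>r n - rGamma a\<bar> \<le> C * (1 / (real n + 1))" for n
  proof (rule LIMSEQ_dist_le[OF r])
    show "(\<lambda>n. C * (1 / (real n + 1))) \<longlonglongrightarrow> 0" by real_asymp
    show "\<bar>r (Suc n) - r n\<bar> \<le> C * (1 / (real n + 1)) - C * (1 / (real (Suc n) + 1))" for n
      using C(2)[of n] by (simp add: algebra_simps)
  qed
  have "\<bar>binser a $ n - rGamma a * real (Suc n) powr (a - 1)\<bar> \<le> C * real (Suc n) powr (a - 2)" for n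
  proof -
    have "binser a $ n = r n * real (Suc n) powr (a - 1)"
      by (simp add: r_def powr_add[symmetric] mult.assoc)
    then have "\<bar>binser a $ n - rGamma a * real (Suc n) powr (a - 1)\<bar> = \<bar>r n - rGamma a\<bar> * real (Suc n) powr (a - 1)"
      by (simp add: abs_mult left_diff_distrib[symmetric])
    also have "\<dots> \<le> C * (1 / (real n + 1)) * real (Suc n) powr (a - 1)"
      by (intro mult_right_mono \<open>\<bar>r n - rGamma a\<bar> \<le> C * (1 / (real n + 1))\<close>) auto
    also have "C * (1 / (real n + 1)) * real (Suc n) powr (a - 1) = C * real (Suc n) powr (a - 2)"
    proof -
      have "real (Suc n) powr (a - 1) = real (Suc n) powr ((a - 2) + 1)" by simp
      also have "\<dots> = real (Suc n) powr (a - 2) * real (Suc n)" by (simp only: powr_add) simp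
      finally show ?thesis by (simp add: add_ac)
    qed
    finally show ?thesis .
  qed
  then show ?thesis by (intro landau_o.bigI[of C] C(1) always_eventually) auto
qed

lemma binser_bigo: "(\<lambda>n. binser a $ n) \<in> O(\<lambda>n. real (Suc n) powr (a - 1))"
proof -
  have "(\<lambda>n. real (Suc n) powr (a - 2)) \<in> O(\<lambda>n. real (Suc n) powr (a - 1))"
    by (intro landau_o.bigI[of 1] always_eventually) (auto intro: powr_mono)
  with binser_asymp[of a] have "(\<lambda>n. binser a $ n - rGamma a * real (Suc n) powr (a - 1)) \<in> O(\<lambda>n. real (Suc n) powr (a - 1))"
    by (rule landau_o.big_trans)
  then have "(\<lambda>n. (binser a $ n - rGamma a * real (Suc n) powr (a - 1)) + rGamma a * real (Suc n) powr (a - 1))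
     \<in> O(\<lambda>n. real (Suc n) powr (a - 1))"
    by (rule sum_in_bigo) simp
  then show ?thesis by simp
qed

lemma binser_plog: "a - 1 \<le> u \<Longrightarrow> binser a \<in> plog u"
  by (rule plog_mono[OF plog_bigo[OF binser_bigo]])

text \<open>The converse of \<open>binser_bigo\<close>: a power weight is majorised by coefficients
  whose generating function is known in closed form. \<open>v > -1\<close> keeps the limit
  \<open>rGamma (v + 1)\<close> away from 0.\<close>

lemma powr_le_binser:
  assumes "v > -1"
  obtains C where "C > 0" "\<And>n. real (Suc n) powr v \<le> C * binser (v + 1) $ n"
proof -
  have nonzero: "rGamma (v + 1) \<noteq> 0" using assms by (simp add: rGamma_inverse_Gamma Gamma_real_pos less_imp_neq[symmetric])
  have "(\<lambda>n. inverse (binser (v + 1) $ n * real (Suc n) powr (1 - (v + 1)))) \<longlonglongrightarrow> inverse (rGamma (v + 1))"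
    by (intro tendsto_inverse binser_limit nonzero)
  then have "(\<lambda>n. inverse (binser (v + 1) $ n * real (Suc n) powr (1 - (v + 1)))) \<in> O(\<lambda>_. 1)"
    by (intro bigoI_tendsto[where c = "inverse (rGamma (v + 1))"]) auto
  then obtain C where C: "C > 0" "\<And>n. \<bar>inverse (binser (v + 1) $ n * real (Suc n) powr (1 - (v + 1)))\<bar> \<le> C * 1"
    by (rule bigo_nat_bound) auto
  have "real (Suc n) powr v \<le> C * binser (v + 1) $ n" for n
  proof -
    have pos: "binser (v + 1) $ n > 0" using assms by (intro binser_pos) simp
    have "inverse (binser (v + 1) $ n * real (Suc n) powr (1 - (v + 1))) = real (Suc n) powr v / binser (v + 1) $ n"
      by (simp add: powr_minus field_simps)
    then show ?thesis using C(2)[of n] pos by (simp add: field_simps)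
  qed
  with C(1) show thesis using that by blast
qed

section \<open>Behaviour at the singularity\<close>

text \<open>The majorant is summed exactly by \<open>binser_sums\<close>, so only the logarithm
  needs care. With \<open>y = 1 - z\<close> and \<open>x = real (Suc n)\<close> it obeys
  \<open>1 + ln x \<le> (1 - ln y) * (1 + x * y)\<close>; the powers of \<open>x\<close> introduced
  in this way are paid for by the same powers of \<open>y\<close>. For \<open>u < -1\<close> the
  value at 1 could be a nonzero constant, which the bound would not allow.\<close>

lemma plog_eval_O_tilde:
  assumes F: "F \<in> plog u" and u: "u > -1"
  shows "(\<lambda>z. eval_fps F z) \<in> O_tilde (- u - 1)"
proof -
  obtain C c where F': "C \<ge> 0" "\<And>n. \<bar>F $ n\<bar> \<le> C * (real (Suc n) powr u * (1 + ln (real (Suc n))) ^ c)"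
    using F by (rule plogE) blast
  obtain A where A: "A > 0" "\<And>n. real (Suc n) powr u \<le> A * binser (u + 1) $ n"
    using powr_le_binser[OF u] by blast
  obtain B where B: "B > 0" "\<And>n. real (Suc n) powr (u + real c) \<le> B * binser (u + real c + 1) $ n"
    using powr_le_binser[of "u + real c"] u by auto
  define K where "K = C * 2 ^ c * (A + B)"
  have bound: "\<bar>eval_fps F z\<bar> \<le> K * ((1 - ln (1 - z)) ^ c * (1 - z) powr (- u - 1))"
    if z: "0 < z" "z < 1" for z
  proof -
    let ?y = "1 - z" and ?l = "1 - ln (1 - z)"
    have l: "?l \<ge> 1" using z by simp
    then have l_nonneg: "ln (1 - z) \<le> 1" by linarith
    define h where "h = (\<lambda>n. C * (2 ^ c * ?l ^ c) * (A * (binser (u + 1) $ n * z ^ n) + ?y ^ c * B * (binser (u + real c + 1) $ n * z ^ n)))"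
    have coeff_le: "norm (F $ n * z ^ n) \<le> h n" for n
    proof -
      let ?x = "real (Suc n)"
      have "ln ?x = ln (?x * ?y) - ln ?y" using z by (simp add: ln_mult)
      also have "ln (?x * ?y) \<le> ?x * ?y" using ln_le_minus_one[of "?x * ?y"] z by simp
      finally have "1 + ln ?x \<le> ?x * ?y + ?l" by simp
      also have "\<dots> \<le> ?l * (1 + ?x * ?y)"
        using mult_right_mono[OF l, of "?x * ?y"] z by (simp only: distrib_left mult_1_right) simp
      finally have "(1 + ln ?x) ^ c \<le> (?l * (1 + ?x * ?y)) ^ c" by (intro power_mono) auto
      also have "\<dots> = ?l ^ c * (1 + ?x * ?y) ^ c" by (simp add: power_mult_distrib)
      also have "(1 + ?x * ?y) ^ c \<le> 2 ^ c * (1 + (?x * ?y) ^ c)"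
      proof (cases "?x * ?y \<le> 1")
        case True
        have "(1 + ?x * ?y) ^ c \<le> 2 ^ c" using True z by (intro power_mono) auto
        also have "\<dots> \<le> 2 ^ c * (1 + (?x * ?y) ^ c)" using z by simp
        finally show ?thesis .
      next
        case False
        have "(1 + ?x * ?y) ^ c \<le> (2 * (?x * ?y)) ^ c"
          using False z by (intro power_mono add_nonneg_nonneg mult_nonneg_nonneg) linarith+
        also have "\<dots> \<le> 2 ^ c * (1 + (?x * ?y) ^ c)" by (simp add: power_mult_distrib)
        finally show ?thesis .
      qed
      finally have "(1 + ln ?x) ^ c \<le> ?l ^ c * (2 ^ c * (1 + (?x * ?y) ^ c))"
        using l by (simp add: mult_left_mono)
      then have "?x powr u * (1 + ln ?x) ^ c \<le> ?x powr u * (?l ^ c * (2 ^ c * (1 + (?x * ?y) ^ c)))"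
        by (intro mult_left_mono) auto
      also have "\<dots> = 2 ^ c * ?l ^ c * (?x powr u + ?y ^ c * (?x powr u * ?x ^ c))"
        by (simp only: power_mult_distrib distrib_left mult_1_right mult_ac)
      also have "?x powr u * ?x ^ c = ?x powr (u + real c)" by (simp add: powr_add powr_realpow)
      also have "2 ^ c * ?l ^ c * (?x powr u + ?y ^ c * ?x powr (u + real c)) \<le>
                 2 ^ c * ?l ^ c * (A * binser (u + 1) $ n + ?y ^ c * (B * binser (u + real c + 1) $ n))"
        using A B z l_nonneg by (intro mult_left_mono add_mono mult_nonneg_nonneg zero_le_power) auto
      finally have "?x powr u * (1 + ln ?x) ^ c \<le> 2 ^ c * ?l ^ c * (A * binser (u + 1) $ n + ?y ^ c * (B * binser (u + real c + 1) $ n))" .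
      then have "\<bar>F $ n\<bar> \<le> C * (2 ^ c * ?l ^ c * (A * binser (u + 1) $ n + ?y ^ c * (B * binser (u + real c + 1) $ n)))"
        using F'(1) by (intro order_trans[OF F'(2)] mult_left_mono)
      then have "\<bar>F $ n\<bar> * z ^ n \<le> C * (2 ^ c * ?l ^ c * (A * binser (u + 1) $ n + ?y ^ c * (B * binser (u + real c + 1) $ n))) * z ^ n"
        using z by (intro mult_right_mono) auto
      then show ?thesis using z by (simp add: h_def abs_mult algebra_simps)
    qed
    have "h sums (C * (2 ^ c * ?l ^ c) * (A * ?y powr (- (u + 1)) + ?y ^ c * B * ?y powr (- (u + real c + 1))))"
      unfolding h_def using z by (intro sums_mult sums_add binser_sums) auto
    also have "?y ^ c * B * ?y powr (- (u + real c + 1)) = B * ?y powr (- (u + 1))"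
    proof -
      have "?y ^ c * ?y powr (- (u + real c + 1)) = ?y powr (real c + (- (u + real c + 1)))"
        unfolding powr_add using z by (simp add: powr_realpow)
      then show ?thesis by (simp add: algebra_simps)
    qed
    finally have h: "h sums (C * (2 ^ c * ?l ^ c) * (A * ?y powr (- (u + 1)) + B * ?y powr (- (u + 1))))" .
    have "norm (\<Sum>n. F $ n * z ^ n) \<le> suminf h" using coeff_le sums_summable[OF h] by (rule norm_suminf_le)
    also have "suminf h = K * (?l ^ c * ?y powr (- (u + 1)))"
      using sums_unique[OF h, symmetric] by (simp add: K_def algebra_simps)
    also have "- (u + 1) = - u - 1" by simp
    finally show ?thesis by (simp add: eval_fps_def)
  qed
  have "(\<lambda>z. eval_fps F z) \<in> O[at_left 1](\<lambda>z. (1 - ln (1 - z)) ^ c * (1 - z) powr (- u - 1))"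
  proof (rule bigoI)
    have "\<forall>\<^sub>F z in at_left (1::real). z \<in> {0<..<1}" by (rule eventually_at_left_real) simp
    then show "\<forall>\<^sub>F z in at_left 1. norm (eval_fps F z) \<le> K * norm ((1 - ln (1 - z)) ^ c * (1 - z) powr (- u - 1))"
    proof eventually_elim
      case (elim z)
      then have "ln (1 - z) < 0" by simp
      then have "0 \<le> (1 - ln (1 - z)) ^ c" by (intro zero_le_power) linarith
      then show ?case using bound[of z] elim by (simp add: abs_mult)
    qed
  qed
  also have "(\<lambda>z. (1 - ln (1 - z)) ^ c * (1 - z) powr (- u - 1)) \<in>
     O[at_left 1](\<lambda>z. (1 - z) powr (- u - 1) * \<bar>ln (1 - z)\<bar> powr real c)"
    by real_asymp
  finally show ?thesis by (auto simp: O_tilde_def)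
qed

section \<open>Summable series that vanish at 1\<close>

lemma Abel_limit_abs:
  assumes "summable (\<lambda>n. \<bar>F $ n\<bar>)"
  shows "((\<lambda>z. eval_fps F z) \<longlongrightarrow> (\<Sum>n. F $ n)) (at_left (1::real))"
proof -
  have "uniform_limit {0..1::real} (\<lambda>N z. \<Sum>n<N. F $ n * z ^ n) (\<lambda>z. \<Sum>n. F $ n * z ^ n) sequentially"
  proof (rule Weierstrass_m_test[OF _ assms])
    fix n :: nat and z :: real assume "z \<in> {0..1}"
    then show "norm (F $ n * z ^ n) \<le> \<bar>F $ n\<bar>"
      by (simp add: abs_mult mult_left_le power_le_one)
  qed
  then have "continuous_on {0..1} (\<lambda>z::real. \<Sum>n. F $ n * z ^ n)"
    by (rule uniform_limit_theorem[rotated]) (auto intro!: always_eventually continuous_intros)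
  then have "((\<lambda>z::real. \<Sum>n. F $ n * z ^ n) \<longlongrightarrow> (\<Sum>n. F $ n * 1 ^ n)) (at 1 within {0..1})"
    by (auto simp: continuous_on_def dest!: bspec[of _ _ 1])
  moreover have "at (1::real) within {0..1} = at_left 1" by (rule at_within_Icc_at_left) simp
  ultimately show ?thesis by (simp add: eval_fps_def)
qed

text \<open>As the total is 0, a partial sum is minus a tail. The bound is the integral of
  \<open>C * x powr u\<close> from \<open>real (Suc n)\<close> to infinity; the mean value theorem
  compares each term with an increment of this integral.\<close>

lemma sum_powr_tail:
  fixes f :: "nat \<Rightarrow> real"
  assumes f: "\<And>n. \<bar>f n\<bar> \<le> C * real (Suc n) powr u" and u: "u < -1" and C: "C \<ge> 0"
    and sums: "f sums 0"
  shows "\<bar>\<Sum>k\<le>n. f k\<bar> \<le> C / (- u - 1) * real (Suc n) powr (u + 1)"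
proof -
  let ?g = "\<lambda>n. C / (- u - 1) * real (Suc n) powr (u + 1)"
  have "\<bar>(\<Sum>k\<le>n. f k) - 0\<bar> \<le> ?g n"
  proof (rule LIMSEQ_dist_le[where r = "\<lambda>n. \<Sum>k\<le>n. f k" and g = ?g])
    show "(\<lambda>n. \<Sum>k\<le>n. f k) \<longlonglongrightarrow> 0"
      using sums LIMSEQ_Suc[of "\<lambda>n. \<Sum>k<n. f k" 0] by (simp add: sums_def lessThan_Suc_atMost)
    show "?g \<longlonglongrightarrow> 0" using u by real_asymp
    fix m
    have "((\<lambda>x. x powr (u + 1)) has_real_derivative (u + 1) * x powr u) (at x)"
      if "real (Suc m) \<le> x" for x
      using that has_real_derivative_powr[of x "u + 1"] by simp
    then obtain \<xi> where "real (Suc m) < \<xi>" "\<xi> < real (Suc (Suc m))"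
        "real (Suc (Suc m)) powr (u + 1) - real (Suc m) powr (u + 1) =
         (real (Suc (Suc m)) - real (Suc m)) * ((u + 1) * \<xi> powr u)"
      using MVT2[of "real (Suc m)" "real (Suc (Suc m))" "\<lambda>x. x powr (u + 1)" "\<lambda>x. (u + 1) * x powr u"] by auto
    then have \<xi>: "real (Suc m) < \<xi>" "\<xi> < real (Suc (Suc m))"
        "real (Suc (Suc m)) powr (u + 1) - real (Suc m) powr (u + 1) = (u + 1) * \<xi> powr u"
      by simp_all
    have "\<bar>f (Suc m)\<bar> \<le> C * real (Suc (Suc m)) powr u" by (rule f)
    also have "\<dots> \<le> C * \<xi> powr u" using \<xi> u C by (intro mult_left_mono powr_mono2') auto
    also have "\<dots> = - (C / (- u - 1)) * ((u + 1) * \<xi> powr u)" using u by (simp add: field_simps)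
    also have "\<dots> = ?g m - ?g (Suc m)" unfolding \<xi>(3)[symmetric] by (simp add: algebra_simps)
    finally show "\<bar>(\<Sum>k\<le>Suc m. f k) - (\<Sum>k\<le>m. f k)\<bar> \<le> ?g m - ?g (Suc m)" by simp
  qed
  then show ?thesis by simp
qed

text \<open>The hypothesis \<open>sums 0\<close> improves the general convolution bound by the factor \<open>n powr (u + 1)\<close>:
  in the half of the convolution where the factor \<open>F\<close> has a small index, \<open>binser (1/2)\<close> may be
  replaced by its increments.\<close>

lemma binser_half_mult_plog:
  assumes F: "\<And>n. \<bar>F $ n\<bar> \<le> C * real (Suc n) powr u" and u: "-3/2 \<le> u" "u < -1"
    and sums: "(\<lambda>n. F $ n) sums 0"
  shows "binser (1/2) * F \<in> plog (u + 1/2)"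
proof -
  let ?b = "\<lambda>n. binser (1/2) $ n" and ?x = "\<lambda>n. real (Suc n)"
  have C: "C \<ge> 0" using F[of 0] by simp
  obtain A where A: "A > 0" "\<And>n. \<bar>?b n\<bar> \<le> A * ?x n powr (-1/2)"
    using bigo_nat_bound[OF binser_bigo[of "1/2"]] by auto
  have step: "\<bar>?b (Suc j) - ?b j\<bar> \<le> A * ?x j powr (-3/2)" for j
  proof -
    have "?b (Suc j) - ?b j = - ?b j / (2 * ?x j)" by (simp add: binser_Suc field_simps)
    then have "\<bar>?b (Suc j) - ?b j\<bar> = \<bar>?b j\<bar> / (2 * ?x j)" by (simp add: abs_divide)
    also have "\<dots> \<le> \<bar>?b j\<bar> / ?x j" by (intro divide_left_mono) auto
    also have "\<dots> \<le> A * ?x j powr (-1/2) / ?x j" by (intro divide_right_mono A) auto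
    also have "\<dots> = A * (?x j powr (-1/2) * ?x j powr (-1))" by (simp add: powr_minus field_simps)
    also have "?x j powr (-1/2) * ?x j powr (-1) = ?x j powr (-3/2)" by (subst powr_add[symmetric]) simp
    finally show ?thesis .
  qed
  \<comment> \<open>The three summands are the constants of \<open>part1\<close>,
    \<open>part2\<close> and \<open>part3\<close>.\<close>
  define K where "K = C * A * 2 powr (3/2) + A * (C / (- u - 1) * 2 powr \<bar>u + 1\<bar>) + C * 2 powr \<bar>u\<bar> * A"
  have "\<bar>(binser (1/2) * F) $ n\<bar> \<le> K * (?x n powr (u + 1/2) * (1 + ln (?x n)) ^ 1)" for n
  proof -
    define m where "m = n div 2"
    have m: "m \<le> n" "n \<le> 2 * m + 1" by (auto simp: m_def)
    let ?l = "1 + ln (?x n)"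
    have "(binser (1/2) * F) $ n = (\<Sum>k\<le>n. F $ k * ?b (n - k))"
      by (simp add: mult.commute[of "binser (1/2)"] fps_mult_nth atLeast0AtMost)
    also have "{..n} = {..m} \<union> {m<..n}" using m by auto
    also have "(\<Sum>k\<in>{..m} \<union> {m<..n}. F $ k * ?b (n - k)) =
        (\<Sum>k\<le>m. F $ k * ?b (n - k)) + (\<Sum>k\<in>{m<..n}. F $ k * ?b (n - k))"
      by (rule sum.union_disjoint) auto
    \<comment> \<open>Replacing \<open>?b (n - k)\<close> by \<open>?b n\<close> for small
      \<open>k\<close> leaves differences of size \<open>k * n powr (-3/2)\<close> and a partial sum
      of \<open>F\<close>, which is small because the total is 0.\<close>
    also have "(\<Sum>k\<le>m. F $ k * ?b (n - k)) = (\<Sum>k\<le>m. F $ k * (?b (n - k) - ?b n)) + ?b n * (\<Sum>k\<le>m. F $ k)"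
      by (simp add: right_diff_distrib sum_subtractf sum_distrib_right mult.commute[of "?b n"])
    finally have split: "(binser (1/2) * F) $ n =
       (\<Sum>k\<le>m. F $ k * (?b (n - k) - ?b n)) + ?b n * (\<Sum>k\<le>m. F $ k) + (\<Sum>k\<in>{m<..n}. F $ k * ?b (n - k))" .
    have "\<bar>F $ k * (?b (n - k) - ?b n)\<bar> \<le> C * A * 2 powr (3/2) * ?x n powr (-3/2) * ?x k powr (u + 1)" if k: "k \<le> m" for k
    proof -
      have "?b n - ?b (n - k) = (\<Sum>j\<in>{n-k..<n}. ?b (Suc j) - ?b j)" by (simp add: sum_Suc_diff')
      also have "\<bar>\<dots>\<bar> \<le> (\<Sum>j\<in>{n-k..<n}. A * (2 powr (3/2) * ?x n powr (-3/2)))"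
      proof (rule order_trans[OF sum_abs], rule sum_mono)
        fix j assume j: "j \<in> {n-k..<n}"
        have "?x j powr (-3/2) \<le> 2 powr \<bar>-3/2\<bar> * ?x n powr (-3/2)"
          using j k m by (intro powr_half_le) (auto simp: m_def)
        then show "\<bar>?b (Suc j) - ?b j\<bar> \<le> A * (2 powr (3/2) * ?x n powr (-3/2))"
          using A(1) by (intro order_trans[OF step] mult_left_mono) auto
      qed
      also have "\<dots> = real k * (A * (2 powr (3/2) * ?x n powr (-3/2)))" using k m by simp
      also have "\<dots> \<le> ?x k * (A * (2 powr (3/2) * ?x n powr (-3/2)))" using A by (intro mult_right_mono) auto
      finally have "\<bar>?b (n - k) - ?b n\<bar> \<le> ?x k * (A * (2 powr (3/2) * ?x n powr (-3/2)))"
        by (simp add: abs_minus_commute)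
      then have "\<bar>F $ k * (?b (n - k) - ?b n)\<bar> \<le> (C * ?x k powr u) * (?x k * (A * (2 powr (3/2) * ?x n powr (-3/2))))"
        unfolding abs_mult using C by (intro mult_mono F) auto
      then show ?thesis by (simp add: powr_add mult_ac)
    qed
    then have "\<bar>\<Sum>k\<le>m. F $ k * (?b (n - k) - ?b n)\<bar> \<le> (\<Sum>k\<le>m. C * A * 2 powr (3/2) * ?x n powr (-3/2) * ?x k powr (u + 1))"
      by (intro order_trans[OF sum_abs] sum_mono) auto
    also have "\<dots> \<le> (\<Sum>k\<le>n. C * A * 2 powr (3/2) * ?x n powr (-3/2) * ?x k powr (u + 1))"
      using m C A by (intro sum_mono2) auto
    also have "\<dots> = C * A * 2 powr (3/2) * ?x n powr (-3/2) * (\<Sum>k\<le>n. ?x k powr (u + 1))"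
      by (simp add: sum_distrib_left)
    also have "\<dots> \<le> C * A * 2 powr (3/2) * ?x n powr (-3/2) * (?l * max 1 (?x n powr (u + 1 + 1)))"
      using C A by (intro mult_left_mono sum_powr_le) auto
    also have "max 1 (?x n powr (u + 1 + 1)) = ?x n powr (u + 2)"
      using u ge_one_powr_ge_zero[of "?x n" "u + 2"] by (simp add: max_def add_ac)
    also have "C * A * 2 powr (3/2) * ?x n powr (-3/2) * (?l * ?x n powr (u + 2)) =
               C * A * 2 powr (3/2) * ((?x n powr (-3/2) * ?x n powr (u + 2)) * ?l)" by simp
    also have "?x n powr (-3/2) * ?x n powr (u + 2) = ?x n powr (u + 1/2)"
      by (subst powr_add[symmetric]) (simp add: add_ac)
    finally have part1: "\<bar>\<Sum>k\<le>m. F $ k * (?b (n - k) - ?b n)\<bar> \<le> C * A * 2 powr (3/2) * (?x n powr (u + 1/2) * ?l)" .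
    have "\<bar>\<Sum>k\<le>m. F $ k\<bar> \<le> C / (- u - 1) * ?x m powr (u + 1)"
      using F u(2) C sums by (rule sum_powr_tail)
    also have "\<dots> \<le> C / (- u - 1) * (2 powr \<bar>u + 1\<bar> * ?x n powr (u + 1))"
      using C u m by (intro mult_left_mono powr_half_le) auto
    finally have "\<bar>?b n * (\<Sum>k\<le>m. F $ k)\<bar> \<le> (A * ?x n powr (-1/2)) * (C / (- u - 1) * (2 powr \<bar>u + 1\<bar> * ?x n powr (u + 1)))"
      unfolding abs_mult using A by (intro mult_mono) auto
    also have "\<dots> = A * (C / (- u - 1) * 2 powr \<bar>u + 1\<bar>) * (?x n powr (-1/2) * ?x n powr (u + 1))" by simp
    also have "?x n powr (-1/2) * ?x n powr (u + 1) = ?x n powr (u + 1/2)"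
      by (subst powr_add[symmetric]) (simp add: add_ac)
    also have "A * (C / (- u - 1) * 2 powr \<bar>u + 1\<bar>) * ?x n powr (u + 1/2) \<le>
               A * (C / (- u - 1) * 2 powr \<bar>u + 1\<bar>) * (?x n powr (u + 1/2) * ?l)"
      using A C u by (intro mult_left_mono) (auto simp: mult_le_cancel_left1)
    finally have part2: "\<bar>?b n * (\<Sum>k\<le>m. F $ k)\<bar> \<le> A * (C / (- u - 1) * 2 powr \<bar>u + 1\<bar>) * (?x n powr (u + 1/2) * ?l)" .
    have "\<bar>F $ k * ?b (n - k)\<bar> \<le> C * (2 powr \<bar>u\<bar> * ?x n powr u) * (A * ?x (n - k) powr (-1/2))" if "k \<in> {m<..n}" for k
    proof -
      have "\<bar>F $ k\<bar> \<le> C * (2 powr \<bar>u\<bar> * ?x n powr u)"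
        using that m C by (intro order_trans[OF F] mult_left_mono powr_half_le) auto
      then show ?thesis unfolding abs_mult using C by (intro mult_mono A) auto
    qed
    then have "\<bar>\<Sum>k\<in>{m<..n}. F $ k * ?b (n - k)\<bar> \<le> (\<Sum>k\<in>{m<..n}. C * (2 powr \<bar>u\<bar> * ?x n powr u) * (A * ?x (n - k) powr (-1/2)))"
      by (intro order_trans[OF sum_abs] sum_mono) auto
    also have "\<dots> \<le> (\<Sum>k\<le>n. C * (2 powr \<bar>u\<bar> * ?x n powr u) * (A * ?x (n - k) powr (-1/2)))"
      using C A by (intro sum_mono2) auto
    also have "\<dots> = C * (2 powr \<bar>u\<bar> * ?x n powr u) * A * (\<Sum>k\<le>n. ?x (n - k) powr (-1/2))"
      by (simp add: sum_distrib_left mult_ac)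
    also have "(\<Sum>k\<le>n. ?x (n - k) powr (-1/2)) = (\<Sum>k\<le>n. ?x k powr (-1/2))"
      by (rule sum.nat_diff_reindex[of "\<lambda>k. ?x k powr (-1/2)" "Suc n", simplified lessThan_Suc_atMost diff_Suc_Suc])
    also have "C * (2 powr \<bar>u\<bar> * ?x n powr u) * A * \<dots> \<le> C * (2 powr \<bar>u\<bar> * ?x n powr u) * A * (?l * max 1 (?x n powr (-1/2 + 1)))"
      using C A by (intro mult_left_mono sum_powr_le) auto
    also have "max 1 (?x n powr (-1/2 + 1)) = ?x n powr (1/2)"
      using ge_one_powr_ge_zero[of "?x n" "1/2"] by (simp add: max_def)
    also have "C * (2 powr \<bar>u\<bar> * ?x n powr u) * A * (?l * ?x n powr (1/2)) =
               C * 2 powr \<bar>u\<bar> * A * ((?x n powr u * ?x n powr (1/2)) * ?l)" by simp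
    also have "?x n powr u * ?x n powr (1/2) = ?x n powr (u + 1/2)"
      by (subst powr_add[symmetric]) (simp add: add_ac)
    finally have part3: "\<bar>\<Sum>k\<in>{m<..n}. F $ k * ?b (n - k)\<bar> \<le> C * 2 powr \<bar>u\<bar> * A * (?x n powr (u + 1/2) * ?l)" .
    have "\<bar>(binser (1/2) * F) $ n\<bar> \<le> C * A * 2 powr (3/2) * (?x n powr (u + 1/2) * ?l) +
        A * (C / (- u - 1) * 2 powr \<bar>u + 1\<bar>) * (?x n powr (u + 1/2) * ?l) + C * 2 powr \<bar>u\<bar> * A * (?x n powr (u + 1/2) * ?l)"
      unfolding split using part1 part2 part3 by linarith
    then show ?thesis by (simp add: K_def distrib_right)
  qed
  then show ?thesis unfolding plog_def by blast
qed

section \<open>Generating functions as formal power series\<close>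

definition exc_fps :: "(nat \<Rightarrow> real) \<Rightarrow> real \<Rightarrow> nat \<Rightarrow> real fps" where
  "exc_fps \<omega> \<epsilon> s =
     Abs_fps (\<lambda>N. (\<Sum>w\<in>dyck_excursions N. path_functional \<omega> \<epsilon> w ^ s / fact s) / (2 * 4 ^ N))"

definition bri_fps :: "(nat \<Rightarrow> real) \<Rightarrow> real \<Rightarrow> nat \<Rightarrow> real fps" where
  "bri_fps \<omega> \<epsilon> s =
     Abs_fps (\<lambda>N. (\<Sum>w\<in>dyck_bridges N. path_functional \<omega> \<epsilon> w ^ s / fact s) / 4 ^ N)"

text \<open>This is \<open>H\<close> of the overview: each excursion is counted with the value of
  its arch, as computed by \<open>path_functional_arch\<close>.\<close>

definition arch_fps :: "(nat \<Rightarrow> real) \<Rightarrow> real \<Rightarrow> nat \<Rightarrow> real fps" where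
  "arch_fps \<omega> \<epsilon> s =
     Abs_fps (\<lambda>N. (\<Sum>w\<in>dyck_excursions N. (path_functional \<omega> \<epsilon> w + (\<omega> N - \<epsilon>)) ^ s / fact s) / (2 * 4 ^ N))"

text \<open>The terms of \<open>arch_fps\<close> in which the weight occurs at least once. They
  involve only orders below \<open>s\<close>, so the recursion can be solved for order
  \<open>s\<close>.\<close>

definition twist_fps :: "(nat \<Rightarrow> real) \<Rightarrow> real \<Rightarrow> nat \<Rightarrow> real fps" where
  "twist_fps \<omega> \<epsilon> s =
     (\<Sum>i<s. Abs_fps (\<lambda>N. exc_fps \<omega> \<epsilon> i $ N * ((\<omega> N - \<epsilon>) ^ (s - i) / fact (s - i))))"

lemma divided_power_add:
  fixes x y :: real
  shows "(x + y) ^ s / fact s = (\<Sum>i\<le>s. (x ^ i / fact i) * (y ^ (s - i) / fact (s - i)))"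
  by (simp add: binomial_ring sum_divide_distrib binomial_fact field_simps)

lemma arch_fps_eq: "arch_fps \<omega> \<epsilon> s = exc_fps \<omega> \<epsilon> s + twist_fps \<omega> \<epsilon> s"
proof (rule fps_ext)
  fix N
  have "arch_fps \<omega> \<epsilon> s $ N = (\<Sum>w\<in>dyck_excursions N. \<Sum>i\<le>s.
      (path_functional \<omega> \<epsilon> w ^ i / fact i) * ((\<omega> N - \<epsilon>) ^ (s - i) / fact (s - i))) / (2 * 4 ^ N)"
    unfolding arch_fps_def by (simp only: fps_nth_Abs_fps divided_power_add)
  also have "\<dots> = (\<Sum>i\<le>s. exc_fps \<omega> \<epsilon> i $ N * ((\<omega> N - \<epsilon>) ^ (s - i) / fact (s - i)))"
    unfolding sum.swap[where B = "{..s}"]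
    by (simp only: exc_fps_def fps_nth_Abs_fps sum_distrib_right sum_divide_distrib) (simp add: field_simps)
  also have "{..s} = insert s {..<s}" by auto
  finally show "arch_fps \<omega> \<epsilon> s $ N = (exc_fps \<omega> \<epsilon> s + twist_fps \<omega> \<epsilon> s) $ N"
    by (simp add: twist_fps_def fps_sum_nth)
qed

text \<open>The functional is additive over arch and remainder, and \<open>divided_power_add\<close>
  turns its powers into a convolution in \<open>s\<close>. The factor \<open>2 * 4 ^ N\<close>
  undoes the normalisations of \<open>arch_fps\<close> and \<open>y\<close>.\<close>

lemma first_return_convolution:
  fixes \<omega> :: "nat \<Rightarrow> real" and \<epsilon> :: real and Y :: "nat \<Rightarrow> int list set"
  assumes Y: "\<And>N. Y N \<subseteq> dyck_bridges N"
  defines "y s N \<equiv> (\<Sum>w\<in>Y N. path_functional \<omega> \<epsilon> w ^ s / fact s) / 4 ^ N"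
  shows "(\<Sum>k\<le>N. \<Sum>u\<in>dyck_excursions k. \<Sum>v\<in>Y (N - k). path_functional \<omega> \<epsilon> (arch u @ v) ^ s / fact s) =
         2 * 4 ^ N * (\<Sum>j\<le>s. \<Sum>k\<le>N. arch_fps \<omega> \<epsilon> j $ k * y (s - j) (N - k))"
proof -
  let ?P = "path_functional \<omega> \<epsilon>"
  have "(\<Sum>u\<in>dyck_excursions k. \<Sum>v\<in>Y (N - k). ?P (arch u @ v) ^ s / fact s) =
        (\<Sum>j\<le>s. 2 * 4 ^ N * (arch_fps \<omega> \<epsilon> j $ k * y (s - j) (N - k)))" if k: "k \<le> N" for k
  proof -
    have "?P (arch u @ v) = (?P u + (\<omega> k - \<epsilon>)) + ?P v"
      if uv: "u \<in> dyck_excursions k" "v \<in> Y (N - k)" for u v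
    proof -
      have "v \<in> dyck_bridges (N - k)" using uv Y by blast
      then have "?P (arch u @ v) = ?P (arch u) + ?P v"
        using uv by (intro path_functional_append) (auto simp: arch_def dyck_excursions_iff dyck_bridges_iff)
      then show ?thesis using uv by (simp add: path_functional_arch)
    qed
    then have "(\<Sum>u\<in>dyck_excursions k. \<Sum>v\<in>Y (N - k). ?P (arch u @ v) ^ s / fact s) =
      (\<Sum>u\<in>dyck_excursions k. \<Sum>v\<in>Y (N - k). \<Sum>j\<le>s.
         (?P u + (\<omega> k - \<epsilon>)) ^ j / fact j * (?P v ^ (s - j) / fact (s - j)))"
      by (simp add: divided_power_add del: times_divide_eq_left times_divide_eq_right times_divide_times_eq)
    also have "\<dots> = (\<Sum>j\<le>s. (\<Sum>u\<in>dyck_excursions k. (?P u + (\<omega> k - \<epsilon>)) ^ j / fact j) *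
         (\<Sum>v\<in>Y (N - k). ?P v ^ (s - j) / fact (s - j)))"
      by (simp only: sum_product sum.swap[where B = "{..s}"])
    also have "\<dots> = (\<Sum>j\<le>s. 2 * 4 ^ N * (arch_fps \<omega> \<epsilon> j $ k * y (s - j) (N - k)))"
    proof (rule sum.cong[OF refl])
      fix j
      have "(4::real) ^ N = 4 ^ k * 4 ^ (N - k)" using k by (simp flip: power_add)
      then show "(\<Sum>u\<in>dyck_excursions k. (?P u + (\<omega> k - \<epsilon>)) ^ j / fact j) *
         (\<Sum>v\<in>Y (N - k). ?P v ^ (s - j) / fact (s - j)) = 2 * 4 ^ N * (arch_fps \<omega> \<epsilon> j $ k * y (s - j) (N - k))"
        by (simp add: arch_fps_def y_def)
    qed
    finally show ?thesis .
  qed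
  then have "(\<Sum>k\<le>N. \<Sum>u\<in>dyck_excursions k. \<Sum>v\<in>Y (N - k). ?P (arch u @ v) ^ s / fact s) =
    (\<Sum>k\<le>N. \<Sum>j\<le>s. 2 * 4 ^ N * (arch_fps \<omega> \<epsilon> j $ k * y (s - j) (N - k)))"
    by (intro sum.cong) auto
  then show ?thesis by (subst (asm) sum.swap) (simp only: sum_distrib_left)
qed

lemma exc_fps_rec:
  "2 * exc_fps \<omega> \<epsilon> s =
     (if s = 0 then 1 else 0) + fps_X * (\<Sum>j\<le>s. arch_fps \<omega> \<epsilon> j * exc_fps \<omega> \<epsilon> (s - j))"
proof (rule fps_ext)
  fix n
  show "(2 * exc_fps \<omega> \<epsilon> s) $ n =
     ((if s = 0 then 1 else 0) + fps_X * (\<Sum>j\<le>s. arch_fps \<omega> \<epsilon> j * exc_fps \<omega> \<epsilon> (s - j))) $ n"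
  proof (cases n)
    case 0
    then show ?thesis by (auto simp: exc_fps_def)
  next
    case (Suc N)
    have "(2 * exc_fps \<omega> \<epsilon> s) $ n = 2 * exc_fps \<omega> \<epsilon> s $ n"
      by (simp only: mult_2 fps_add_nth)
    also have "\<dots> =
       (\<Sum>w\<in>dyck_excursions (Suc N). path_functional \<omega> \<epsilon> w ^ s / fact s) / 4 ^ Suc N"
      using Suc by (simp add: exc_fps_def)
    also have "\<dots> = (\<Sum>k\<le>N. \<Sum>u\<in>dyck_excursions k. \<Sum>v\<in>dyck_excursions (N - k).
        path_functional \<omega> \<epsilon> (arch u @ v) ^ s / fact s) / 4 ^ Suc N"
      by (simp only: sum_excursions_Suc)
    also have "\<dots> = (\<Sum>j\<le>s. \<Sum>k\<le>N. arch_fps \<omega> \<epsilon> j $ k * exc_fps \<omega> \<epsilon> (s - j) $ (N - k))"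
      by (subst first_return_convolution)
         (auto simp: dyck_excursions_iff exc_fps_def sum_distrib_left sum_divide_distrib field_simps)
    finally show ?thesis using Suc
      by (simp add: fps_sum_nth) (simp add: fps_mult_nth atLeast0AtMost)
  qed
qed

text \<open>The two orientations of the first arch make up for the factor \<open>1/2\<close> in
  \<open>arch_fps\<close>; hence there is no 2 on the left as in \<open>exc_fps_rec\<close>.\<close>

lemma bri_fps_rec:
  "bri_fps \<omega> \<epsilon> s =
     (if s = 0 then 1 else 0) + fps_X * (\<Sum>j\<le>s. arch_fps \<omega> \<epsilon> j * bri_fps \<omega> \<epsilon> (s - j))"
proof (rule fps_ext)
  fix n
  show "bri_fps \<omega> \<epsilon> s $ n =
     ((if s = 0 then 1 else 0) + fps_X * (\<Sum>j\<le>s. arch_fps \<omega> \<epsilon> j * bri_fps \<omega> \<epsilon> (s - j))) $ n"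
  proof (cases n)
    case 0
    then show ?thesis by (auto simp: bri_fps_def)
  next
    case (Suc N)
    let ?S = "\<Sum>k\<le>N. \<Sum>u\<in>dyck_excursions k. \<Sum>v\<in>dyck_bridges (N - k).
        path_functional \<omega> \<epsilon> (arch u @ v) ^ s / fact s"
    have "bri_fps \<omega> \<epsilon> s $ n =
       (\<Sum>w\<in>dyck_bridges (Suc N). path_functional \<omega> \<epsilon> w ^ s / fact s) / 4 ^ Suc N"
      using Suc by (simp add: bri_fps_def)
    also have "\<dots> = (?S + ?S) / 4 ^ Suc N"
      by (subst sum_bridges_Suc) (simp_all only: path_functional_uminus)
    also have "\<dots> = (\<Sum>j\<le>s. \<Sum>k\<le>N. arch_fps \<omega> \<epsilon> j $ k * bri_fps \<omega> \<epsilon> (s - j) $ (N - k))"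
      by (subst first_return_convolution, simp, subst first_return_convolution)
         (auto simp: bri_fps_def sum_distrib_left sum_divide_distrib field_simps)
    finally show ?thesis using Suc
      by (simp add: fps_sum_nth) (simp add: fps_mult_nth atLeast0AtMost)
  qed
qed

section \<open>Order zero, and the recursions solved for their top order\<close>

lemma arch_fps_0 [simp]: "arch_fps \<omega> \<epsilon> 0 = exc_fps \<omega> \<epsilon> 0"
  by (simp add: arch_fps_eq twist_fps_def)

text \<open>Completing the square in the quadratic equation gives
  \<open>(1 - X E)^2 = 1 - X\<close>. Formal power series form an integral domain, so two square
  roots remain, and the constant term decides between them.\<close>

lemma X_exc_fps_0: "fps_X * exc_fps \<omega> \<epsilon> 0 = 1 - binser (-1/2)"
proof -
  let ?E = "exc_fps \<omega> \<epsilon> 0"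
  have rec: "2 * ?E = 1 + fps_X * (?E * ?E)" using exc_fps_rec[of \<omega> \<epsilon> 0] by simp
  have "(1 - fps_X * ?E) * (1 - fps_X * ?E) = 1 - fps_X * (2 * ?E - fps_X * (?E * ?E))"
    by (simp add: algebra_simps)
  also have "\<dots> = 1 - fps_X" by (simp add: rec)
  also have "\<dots> = binser (-1/2) * binser (-1/2)" by (simp add: binser_mult binser_minus_1)
  finally have "(1 - fps_X * ?E) * (1 - fps_X * ?E) = binser (-1/2) * binser (-1/2)" .
  then have "1 - fps_X * ?E = binser (-1/2) \<or> 1 - fps_X * ?E = - binser (-1/2)"
    by (simp only: square_eq_iff)
  moreover have "1 - fps_X * ?E \<noteq> - binser (-1/2)"
  proof
    assume "1 - fps_X * ?E = - binser (-1/2)"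
    then have "(1 - fps_X * ?E) $ 0 = (- binser (-1/2)) $ 0" by simp
    then show False by simp
  qed
  ultimately have "1 - fps_X * ?E = binser (-1/2)" by blast
  then show ?thesis by (simp add: algebra_simps)
qed

lemma exc_fps_0_inverse: "exc_fps \<omega> \<epsilon> 0 * (1 + binser (-1/2)) = 1"
proof -
  let ?E = "exc_fps \<omega> \<epsilon> 0"
  have "2 * ?E = 1 + fps_X * (?E * ?E)" using exc_fps_rec[of \<omega> \<epsilon> 0] by simp
  then have "2 * ?E = 1 + (fps_X * ?E) * ?E" by (simp add: mult.assoc)
  then show ?thesis unfolding X_exc_fps_0 by (simp add: algebra_simps)
qed

lemma binser_half_inverse: "binser (1/2) * binser (-1/2) = 1"
  by (simp add: binser_mult binser_0)

text \<open>The unknown occurs in the terms \<open>j = 0\<close> and \<open>j = s\<close> of the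
  recursion. Collecting it yields the factor \<open>1 - X E_0 = binser (-1/2)\<close>, which
  \<open>binser (1/2)\<close> inverts.\<close>

lemma exc_fps_formula:
  assumes "s \<ge> 1"
  shows "2 * exc_fps \<omega> \<epsilon> s = (binser (1/2) - 1) * twist_fps \<omega> \<epsilon> s +
           binser (1/2) * (fps_X * (\<Sum>j=1..s-1. arch_fps \<omega> \<epsilon> j * exc_fps \<omega> \<epsilon> (s - j)))"
proof -
  let ?E = "exc_fps \<omega> \<epsilon>" and ?H = "arch_fps \<omega> \<epsilon>" and ?K = "twist_fps \<omega> \<epsilon>"
  let ?S = "\<Sum>j=1..s-1. ?H j * ?E (s - j)"
  have "{..s} = insert 0 (insert s {1..s-1})" using assms by auto
  then have "(\<Sum>j\<le>s. ?H j * ?E (s - j)) = ?E 0 * ?E s + (?H s * ?E 0 + ?S)"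
    using assms by simp
  then have "2 * ?E s = fps_X * (?E 0 * ?E s + (?H s * ?E 0 + ?S))"
    using exc_fps_rec[of \<omega> \<epsilon> s] assms by simp
  also have "\<dots> = (fps_X * ?E 0) * (2 * ?E s) + (fps_X * ?E 0) * ?K s + fps_X * ?S"
    by (simp add: arch_fps_eq[of _ _ s] algebra_simps)
  finally have "binser (-1/2) * (2 * ?E s) = (1 - binser (-1/2)) * ?K s + fps_X * ?S"
    unfolding X_exc_fps_0 by (simp add: algebra_simps)
  then have "binser (1/2) * (binser (-1/2) * (2 * ?E s)) = binser (1/2) * ((1 - binser (-1/2)) * ?K s + fps_X * ?S)"
    by simp
  then have "(binser (1/2) * binser (-1/2)) * (2 * ?E s) =
      (binser (1/2) - binser (1/2) * binser (-1/2)) * ?K s + binser (1/2) * (fps_X * ?S)"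
    by (simp add: algebra_simps)
  then show ?thesis unfolding binser_half_inverse by simp
qed

lemma bri_fps_0: "bri_fps \<omega> \<epsilon> 0 = binser (1/2)"
proof -
  have "bri_fps \<omega> \<epsilon> 0 = 1 + (fps_X * exc_fps \<omega> \<epsilon> 0) * bri_fps \<omega> \<epsilon> 0"
    using bri_fps_rec[of \<omega> \<epsilon> 0] by (simp add: mult.assoc)
  then have "binser (-1/2) * bri_fps \<omega> \<epsilon> 0 = 1"
    unfolding X_exc_fps_0 by (simp add: algebra_simps)
  then have "binser (1/2) = binser (1/2) * (binser (-1/2) * bri_fps \<omega> \<epsilon> 0)" by simp
  also have "\<dots> = (binser (1/2) * binser (-1/2)) * bri_fps \<omega> \<epsilon> 0" by (simp only: mult.assoc)
  finally show ?thesis unfolding binser_half_inverse by simp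
qed

lemma fps_const_mult_convolution_nth:
  fixes c :: "'a :: comm_ring_1"
  shows "(fps_const c * Abs_fps a * Abs_fps b) $ n = c * (\<Sum>j\<le>n. a j * b (n - j))"
  by (simp only: mult.assoc fps_mult_left_const_nth) (simp only: fps_mult_nth atLeast0AtMost fps_nth_Abs_fps)

text \<open>With an additional variable marking \<open>s\<close>, the recursions read \<open>(2 - X H) E = 1\<close> and
  \<open>(1 - X H) B = 1\<close>, so \<open>B E = B - E\<close>.\<close>

lemma bri_exc_convolution:
  "(\<Sum>k\<le>s. bri_fps \<omega> \<epsilon> k * exc_fps \<omega> \<epsilon> (s - k)) = bri_fps \<omega> \<epsilon> s - exc_fps \<omega> \<epsilon> s"
proof -
  define E B H where "E = Abs_fps (exc_fps \<omega> \<epsilon>)" and "B = Abs_fps (bri_fps \<omega> \<epsilon>)"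
    and "H = fps_const fps_X * Abs_fps (arch_fps \<omega> \<epsilon>)"
  have E: "E + E = 1 + H * E"
  proof (rule fps_ext)
    fix n
    show "(E + E) $ n = (1 + H * E) $ n"
    proof -
      have "(1 + H * E) $ n = (if n = 0 then 1 else 0) +
          fps_X * (\<Sum>j\<le>n. arch_fps \<omega> \<epsilon> j * exc_fps \<omega> \<epsilon> (n - j))"
        by (simp only: E_def H_def fps_add_nth fps_const_mult_convolution_nth fps_one_nth)
      also have "\<dots> = (E + E) $ n"
        by (simp only: E_def fps_add_nth fps_nth_Abs_fps exc_fps_rec[unfolded mult_2, symmetric])
      finally show ?thesis ..
    qed
  qed
  have B: "B = 1 + H * B"
  proof (rule fps_ext)
    fix n
    show "B $ n = (1 + H * B) $ n"
      by (simp only: B_def H_def fps_add_nth fps_const_mult_convolution_nth fps_one_nth fps_nth_Abs_fps)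
         (rule bri_fps_rec)
  qed
  have "B * E + B * E = B * (E + E)" by (simp add: distrib_left)
  also have "\<dots> = B + (H * B) * E" unfolding E by (simp add: algebra_simps)
  also have "H * B = B - 1" using B by (metis add_diff_cancel_left')
  finally have "B * E = B - E" by (simp add: algebra_simps)
  then have "(B * E) $ s = (B - E) $ s" by simp
  then show ?thesis by (simp add: fps_mult_nth atLeast0AtMost B_def E_def)
qed

text \<open>Collecting the unknown in \<open>bri_exc_convolution\<close> yields the factor
  \<open>1 - E_0\<close>. For \<open>y = (1 - X) powr (1/2)\<close> one has
  \<open>E_0 = 1 / (1 + y)\<close>, so the inverse of that factor is
  \<open>1 + 1 / y\<close>.\<close>

lemma bri_fps_formula:
  assumes "s \<ge> 1"
  shows "bri_fps \<omega> \<epsilon> s = (1 + binser (1/2)) *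
           (exc_fps \<omega> \<epsilon> s + (\<Sum>k=0..s-1. bri_fps \<omega> \<epsilon> k * exc_fps \<omega> \<epsilon> (s - k)))"
proof -
  let ?E = "exc_fps \<omega> \<epsilon>" and ?B = "bri_fps \<omega> \<epsilon>"
  let ?R = "?E s + (\<Sum>k=0..s-1. ?B k * ?E (s - k))"
  have "{..s} = insert s {0..s-1}" using assms by auto
  then have "?B s * ?E 0 + (\<Sum>k=0..s-1. ?B k * ?E (s - k)) = ?B s - ?E s"
    using bri_exc_convolution[of \<omega> \<epsilon> s] assms by simp
  then have R: "?R = ?B s * (1 - ?E 0)" by (simp add: algebra_simps)
  have "(1 + binser (1/2)) * (1 - ?E 0) = (1 + binser (1/2)) * (?E 0 * (1 + binser (-1/2)) - ?E 0)"
    by (simp only: exc_fps_0_inverse)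
  also have "\<dots> = ?E 0 * (binser (-1/2) + binser (1/2) * binser (-1/2))" by (simp add: algebra_simps)
  also have "\<dots> = ?E 0 * (1 + binser (-1/2))" unfolding binser_half_inverse by (simp add: add_ac)
  also have "\<dots> = 1" by (rule exc_fps_0_inverse)
  finally have "?B s * ((1 + binser (1/2)) * (1 - ?E 0)) = ?B s" by simp
  then show ?thesis unfolding R by (simp add: mult_ac)
qed

text \<open>The Catalan numbers come out of the square root, by comparing the ratios of consecutive
  coefficients; no paths are counted.\<close>

lemma exc_fps_0_nth: "exc_fps \<omega> \<epsilon> 0 $ k = c_coeff k"
proof -
  have "exc_fps \<omega> \<epsilon> 0 $ k = (fps_X * exc_fps \<omega> \<epsilon> 0) $ Suc k" by simp
  also have "\<dots> = - binser (-1/2) $ Suc k" unfolding X_exc_fps_0 by simp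
  also have "\<dots> = c_coeff k"
  proof (induction k)
    case 0
    then show ?case by (simp add: binser_Suc c_coeff_def)
  next
    case (Suc k)
    have binom: "real (2 * Suc k choose Suc k) = 2 * (2 * real k + 1) / (real k + 1) * real (2 * k choose k)"
    proof -
      have f: "fact (2 * Suc k) = ((2 * real k + 2) * (2 * real k + 1)) * (fact (2 * k) :: real)"
        by (simp add: algebra_simps)
      have "real (2 * Suc k choose Suc k) = fact (2 * Suc k) / (fact (Suc k) * fact (Suc k))"
      proof -
        have "2 * Suc k - Suc k = Suc k" by simp
        then show ?thesis using binomial_fact[of "Suc k" "2 * Suc k", where 'a = real] by (simp only: le_add1 mult_2)
      qed
      also have "\<dots> = ((2 * real k + 2) * (2 * real k + 1)) * fact (2 * k) / ((real k + 1) * fact k * ((real k + 1) * fact k))"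
        by (simp only: f) (simp add: add.commute)
      also have "\<dots> = 2 * (2 * real k + 1) / (real k + 1) * (fact (2 * k) / (fact k * fact k))"
        by (simp add: divide_simps) (simp add: algebra_simps)
      also have "fact (2 * k) / (fact k * fact k) = real (2 * k choose k)"
      proof -
        have "2 * k - k = k" by simp
        then show ?thesis using binomial_fact[of k "2 * k", where 'a = real] by (simp only: le_add1 mult_2)
      qed
      finally show ?thesis .
    qed
    have "- binser (-1/2) $ Suc (Suc k) = - binser (-1/2) $ Suc k * ((2 * real k + 1) / (2 * (real k + 2)))"
    proof -
      have "(-1/2 + real (Suc k)) / (real (Suc k) + 1) = (2 * real k + 1) / (2 * (real k + 2))"
        by (simp add: divide_simps) (simp add: algebra_simps)
      then show ?thesis by (simp only: fps_neg_nth binser_Suc[of _ "Suc k"] minus_mult_left)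
    qed
    also have "\<dots> = c_coeff k * ((2 * real k + 1) / (2 * (real k + 2)))" by (simp only: Suc.IH)
    also have "\<dots> = c_coeff (Suc k)"
    proof -
      have p: "(1/2::real) ^ (2 * Suc k + 1) = (1/2) ^ (2 * k + 1) / 4" by simp
      show ?thesis unfolding c_coeff_def binom p by (simp add: divide_simps) (simp add: algebra_simps)
    qed
    finally show ?case .
  qed
  finally show ?thesis .
qed

section \<open>Coefficient asymptotics\<close>

lemma powr_Suc_bigo_mono: "u \<le> v \<Longrightarrow> (\<lambda>n. real (Suc n) powr u) \<in> O(\<lambda>n. real (Suc n) powr v)"
  by (intro landau_o.bigI[of 1] always_eventually) (auto intro: powr_mono)

text \<open>Pointwise products combine pure powers, just as convolutions combine
  \<open>binser\<close>. No logarithms occur, since this is applied only to the weight,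
  \<open>c_coeff\<close>, \<open>binser\<close> and their products.\<close>

definition powr_asymp :: "(nat \<Rightarrow> real) \<Rightarrow> real \<Rightarrow> real \<Rightarrow> real \<Rightarrow> bool" where
  "powr_asymp f c u d \<longleftrightarrow> (\<lambda>n. f n - c * real (Suc n) powr u) \<in> O(\<lambda>n. real (Suc n) powr (u - d))"

lemma powr_asymp_bigo:
  assumes "powr_asymp f c u d" "d \<ge> 0"
  shows "f \<in> O(\<lambda>n. real (Suc n) powr u)"
proof -
  have "(\<lambda>n. f n - c * real (Suc n) powr u) \<in> O(\<lambda>n. real (Suc n) powr u)"
    by (rule landau_o.big_trans[OF assms(1)[unfolded powr_asymp_def] powr_Suc_bigo_mono]) (use assms in simp)
  then have "(\<lambda>n. (f n - c * real (Suc n) powr u) + c * real (Suc n) powr u) \<in> O(\<lambda>n. real (Suc n) powr u)"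
    by (rule sum_in_bigo) simp
  then show ?thesis by simp
qed

lemma powr_asymp_weaken: "powr_asymp f c u d \<Longrightarrow> d' \<le> d \<Longrightarrow> powr_asymp f c u d'"
  unfolding powr_asymp_def by (erule landau_o.big_trans, rule powr_Suc_bigo_mono) simp

lemma powr_asymp_mult:
  assumes f: "powr_asymp f a u d" and g: "powr_asymp g b v d" and d: "d \<ge> 0"
  shows "powr_asymp (\<lambda>n. f n * g n) (a * b) (u + v) d"
proof -
  let ?W = "\<lambda>u n. real (Suc n) powr u"
  have "(\<lambda>n. (f n - a * ?W u n) * g n) \<in> O(\<lambda>n. ?W (u - d) n * ?W v n)"
    using f powr_asymp_bigo[OF g d] unfolding powr_asymp_def by (rule landau_o.big.mult)
  moreover have "(\<lambda>n. (a * ?W u n) * (g n - b * ?W v n)) \<in> O(\<lambda>n. ?W u n * ?W (v - d) n)"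
    using g unfolding powr_asymp_def by (intro landau_o.big.mult) auto
  ultimately have "(\<lambda>n. (f n - a * ?W u n) * g n + (a * ?W u n) * (g n - b * ?W v n)) \<in> O(?W (u + v - d))"
    by (intro sum_in_bigo) (auto simp: powr_add[symmetric] algebra_simps)
  then show ?thesis by (simp add: powr_asymp_def powr_add algebra_simps)
qed

lemma powr_asymp_binser: "powr_asymp (\<lambda>n. binser a $ n) (rGamma a) (a - 1) 1"
  using binser_asymp[of a] by (simp add: powr_asymp_def)

lemma plog_hadamard:
  assumes F: "F \<in> plog u" and g: "g \<in> O(\<lambda>n. real (Suc n) powr v)"
  shows "Abs_fps (\<lambda>n. F $ n * g n) \<in> plog (u + v)"
proof -
  obtain C c where F': "C \<ge> 0" "\<And>n. \<bar>F $ n\<bar> \<le> C * (real (Suc n) powr u * (1 + ln (real (Suc n))) ^ c)"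
    using F by (rule plogE) blast
  obtain D where D: "D > 0" "\<And>n. \<bar>g n\<bar> \<le> D * real (Suc n) powr v"
    using bigo_nat_bound[OF g] by auto
  have "\<bar>F $ n * g n\<bar> \<le> (C * D) * (real (Suc n) powr (u + v) * (1 + ln (real (Suc n))) ^ c)" for n
  proof -
    have "\<bar>F $ n * g n\<bar> \<le> (C * (real (Suc n) powr u * (1 + ln (real (Suc n))) ^ c)) * (D * real (Suc n) powr v)"
      unfolding abs_mult using F'(1) D(1)
      by (intro mult_mono F' D mult_nonneg_nonneg plog_weight_nonneg) auto
    then show ?thesis by (simp add: powr_add mult_ac)
  qed
  then show ?thesis unfolding plog_def by auto
qed

text \<open>\<open>binser a\<close> is the expansion of \<open>(1 - X) powr (- a)\<close>, whose coefficients have order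
  \<open>n powr (a - 1)\<close>. So \<open>d\<close> measures the relative accuracy.\<close>

definition binser_lead :: "real fps \<Rightarrow> real \<Rightarrow> real \<Rightarrow> real \<Rightarrow> bool" where
  "binser_lead F c a d \<longleftrightarrow> F - fps_const c * binser a \<in> plog (a - 1 - d)"

lemma binser_lead_plog:
  assumes "binser_lead F c a d" "d \<ge> 0"
  shows "F \<in> plog (a - 1)"
proof -
  have "F - fps_const c * binser a \<in> plog (a - 1)"
    using assms unfolding binser_lead_def by (auto intro: plog_mono)
  then have "(F - fps_const c * binser a) + fps_const c * binser a \<in> plog (a - 1)"
    by (intro plog_add plog_cmult binser_plog) auto
  then show ?thesis by simp
qed

lemma plog_binser_lead: "F \<in> plog (a - 1 - d) \<Longrightarrow> binser_lead F 0 a d"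
  by (simp add: binser_lead_def)

lemma binser_lead_add:
  assumes "binser_lead F b a d" "binser_lead G c a d"
  shows "binser_lead (F + G) (b + c) a d"
proof -
  have "(F - fps_const b * binser a) + (G - fps_const c * binser a) \<in> plog (a - 1 - d)"
    using assms unfolding binser_lead_def by (rule plog_add)
  moreover have "(F - fps_const b * binser a) + (G - fps_const c * binser a) =
      F + G - fps_const (b + c) * binser a"
    by (simp add: algebra_simps flip: fps_const_add)
  ultimately show ?thesis by (simp add: binser_lead_def)
qed

lemma binser_lead_sum:
  "(\<And>i. i \<in> A \<Longrightarrow> binser_lead (F i) (c i) a d) \<Longrightarrow> binser_lead (sum F A) (sum c A) a d"
proof (induction A rule: infinite_finite_induct)
  case (insert x A)
  then show ?case by (simp add: binser_lead_add)
qed (simp_all add: plog_binser_lead)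

lemma binser_lead_cmult:
  assumes "binser_lead F c a d"
  shows "binser_lead (fps_const k * F) (k * c) a d"
proof -
  have "fps_const k * (F - fps_const c * binser a) \<in> plog (a - 1 - d)"
    using assms unfolding binser_lead_def by (rule plog_cmult)
  moreover have "fps_const k * (F - fps_const c * binser a) = fps_const k * F - fps_const (k * c) * binser a"
    by (simp add: right_diff_distrib mult.assoc[symmetric])
  ultimately show ?thesis by (simp add: binser_lead_def)
qed

text \<open>The leading parts multiply exactly. \<open>d \<le> u\<close> and
  \<open>d \<le> v\<close> keep the ends of the error convolutions, where one index is small, within
  the target order.\<close>

lemma binser_lead_mult:
  assumes F: "binser_lead F b u d" and G: "binser_lead G c v d" and d: "0 \<le> d" "d \<le> u" "d \<le> v"
  shows "binser_lead (F * G) (b * c) (u + v) d"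
proof -
  have "(F - fps_const b * binser u) * G \<in> plog (u + v - 1 - d)"
    using F binser_lead_plog[OF G d(1)] d unfolding binser_lead_def by (elim plog_mult) auto
  moreover have "(fps_const b * binser u) * (G - fps_const c * binser v) \<in> plog (u + v - 1 - d)"
    using G d unfolding binser_lead_def by (intro plog_mult[OF plog_cmult[OF binser_plog[OF order_refl]]]) auto
  ultimately have "(F - fps_const b * binser u) * G + (fps_const b * binser u) * (G - fps_const c * binser v) \<in> plog (u + v - 1 - d)"
    by (rule plog_add)
  moreover have "(fps_const b * binser u) * (fps_const c * binser v) = fps_const (b * c) * binser (u + v)"
  proof -
    have "(fps_const b * binser u) * (fps_const c * binser v) = (fps_const b * fps_const c) * (binser u * binser v)"
      by (simp only: mult_ac)
    then show ?thesis by (simp only: binser_mult fps_const_mult)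
  qed
  then have "(F - fps_const b * binser u) * G + (fps_const b * binser u) * (G - fps_const c * binser v) =
      F * G - fps_const (b * c) * binser (u + v)"
    by (simp only: right_diff_distrib left_diff_distrib) simp
  ultimately show ?thesis by (simp add: binser_lead_def)
qed

text \<open>Serves the orders \<open>s \<ge> 2\<close>. For \<open>K 1\<close> the exponent
  \<open>p - 1/2\<close> may be below \<open>\<delta>\<close>, and the cancellation in
  \<open>R\<close> takes its place.\<close>

lemma binser_lead_half_mult:
  assumes F: "binser_lead F c a d" and d: "0 \<le> d" "d \<le> a"
  shows "binser_lead (binser (1/2) * F) c (a + 1/2) d"
proof -
  have "binser (1/2) * (F - fps_const c * binser a) \<in> plog (a + 1/2 - 1 - d)"
    using F d unfolding binser_lead_def by (intro plog_mult[OF binser_plog[OF order_refl]]) auto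
  moreover have "binser (1/2) * (fps_const c * binser a) = fps_const c * binser (a + 1/2)"
    by (simp only: mult.left_commute[of "binser (1/2)"] binser_mult add.commute)
  then have "binser (1/2) * (F - fps_const c * binser a) = binser (1/2) * F - fps_const c * binser (a + 1/2)"
    by (simp only: right_diff_distrib)
  ultimately show ?thesis by (simp add: binser_lead_def)
qed

text \<open>Since \<open>X = 1 - (1 - X)\<close>, the factor \<open>X\<close> only adds a term whose
  exponent is lower by 1; \<open>d \<le> 1\<close> makes it part of the error.\<close>

lemma binser_lead_X_mult:
  assumes F: "binser_lead F c a d" and d: "d \<le> 1"
  shows "binser_lead (fps_X * F) c a d"
proof -
  have "fps_X * (F - fps_const c * binser a) - fps_const c * binser (a - 1) \<in> plog (a - 1 - d)"
    using d by (intro plog_diff plog_X_mult[OF F[unfolded binser_lead_def]] plog_cmult[OF binser_plog]) auto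
  moreover have "fps_X * binser a = binser a - binser (a - 1)"
  proof -
    have "fps_X * binser a = (1 - binser (-1)) * binser a" by (simp add: binser_minus_1)
    then show ?thesis by (simp add: left_diff_distrib binser_mult)
  qed
  then have "fps_X * (fps_const c * binser a) = fps_const c * (binser a - binser (a - 1))"
    by (simp add: mult.left_commute)
  then have "fps_X * (F - fps_const c * binser a) - fps_const c * binser (a - 1) = fps_X * F - fps_const c * binser a"
    by (simp add: algebra_simps)
  ultimately show ?thesis by (simp add: binser_lead_def)
qed

lemma binser_lead_weaken_exponent:
  assumes F: "binser_lead F c a d" and "d \<ge> 0" "d \<le> e"
  shows "binser_lead F 0 (a + e) d"
  using binser_lead_plog[OF assms(1,2)] assms(3) by (intro plog_binser_lead) (auto intro: plog_mono)

lemma binser_lead_diff: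
  assumes "binser_lead F b a d" "binser_lead G c a d"
  shows "binser_lead (F - G) (b - c) a d"
  using binser_lead_add[OF assms(1) binser_lead_cmult[OF assms(2), of "-1"]]
  by (simp flip: fps_const_neg)

section \<open>Catalan coefficients, and auxiliary facts near 1\<close>

lemma c_coeff_binser: "c_coeff n = binser (1/2) $ n / (2 * real (Suc n))"
proof -
  have "c_coeff n = (fps_X * exc_fps (\<lambda>_. 0) 0 0) $ Suc n" by (simp add: exc_fps_0_nth)
  also have "\<dots> = - (pochhammer (-1/2) (Suc n) / fact (Suc n))"
    unfolding X_exc_fps_0 by (simp add: binser_nth)
  also have "pochhammer (-1/2) (Suc n) = -1/2 * pochhammer (1/2 :: real) n"
    by (simp add: pochhammer_rec)
  finally show ?thesis by (simp add: binser_nth field_simps)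
qed

lemma powr_asymp_c_coeff: "powr_asymp c_coeff (1 / (2 * sqrt pi)) (-3/2) 1"
proof -
  have "(\<lambda>n. (binser (1/2) $ n - rGamma (1/2) * real (Suc n) powr (1/2 - 1)) * (1 / (2 * real (Suc n))))
     \<in> O(\<lambda>n. real (Suc n) powr (1/2 - 2) * (1 / (2 * real (Suc n))))"
    by (intro landau_o.big.mult binser_asymp) auto
  also have "(\<lambda>n. real (Suc n) powr (1/2 - 2) * (1 / (2 * real (Suc n)))) \<in> O(\<lambda>n. real (Suc n) powr (-3/2 - 1))"
    by real_asymp
  also have "(\<lambda>n. (binser (1/2) $ n - rGamma (1/2) * real (Suc n) powr (1/2 - 1)) * (1 / (2 * real (Suc n)))) =
     (\<lambda>n. c_coeff n - 1 / (2 * sqrt pi) * real (Suc n) powr (-3/2))"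
  proof
    fix n
    have "real (Suc n) powr (-3/2) = real (Suc n) powr (1/2 - 1 - 1)" by simp
    also have "\<dots> = real (Suc n) powr (1/2 - 1) / real (Suc n)"
      by (subst powr_diff) simp
    finally have pow: "real (Suc n) powr (-3/2) = real (Suc n) powr (1/2 - 1) / real (Suc n)" .
    have rG: "rGamma (1/2) = 1 / sqrt pi"
      by (simp add: rGamma_inverse_Gamma Gamma_one_half_real inverse_eq_divide)
    show "(binser (1/2) $ n - rGamma (1/2) * real (Suc n) powr (1/2 - 1)) * (1 / (2 * real (Suc n))) =
       c_coeff n - 1 / (2 * sqrt pi) * real (Suc n) powr (-3/2)"
      unfolding c_coeff_binser pow rG by (simp add: left_diff_distrib diff_divide_distrib)
  qed
  finally show ?thesis by (simp add: powr_asymp_def)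
qed

lemma at_left_1_unit: "\<forall>\<^sub>F z in at_left (1::real). 0 < z \<and> z < 1"
proof -
  have "\<forall>\<^sub>F z in at_left (1::real). z \<in> {0<..<1}" by (rule eventually_at_left_real) simp
  then show ?thesis by eventually_elim simp
qed

lemma cmult_bigo:
  fixes f g :: "'a \<Rightarrow> real"
  shows "f \<in> O[F](g) \<Longrightarrow> (\<lambda>x. c * f x) \<in> O[F](g)"
  by (cases "c = 0") auto

lemma powr_at_left_bigo_mono:
  assumes "b \<le> a"
  shows "(\<lambda>z. (1 - z) powr a) \<in> O[at_left 1](\<lambda>z::real. (1 - z) powr b)"
proof (rule landau_o.bigI[of 1])
  show "\<forall>\<^sub>F z in at_left 1. norm ((1 - z) powr a) \<le> 1 * norm ((1 - z) powr b)"
    using at_left_1_unit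
  proof eventually_elim
    case (elim z)
    then show ?case using assms by (simp add: powr_mono')
  qed
qed simp

lemma Gamma_nonzero:
  fixes x :: real
  assumes "x > -1" "x \<noteq> 0"
  shows "Gamma x \<noteq> 0"
proof -
  have "x \<notin> \<int>\<^sub>\<le>\<^sub>0" using assms by (auto elim!: nonpos_Ints_cases)
  then show ?thesis by (simp add: Gamma_eq_zero_iff)
qed

lemma less_conv_radius:
  "fps_conv_radius F \<ge> 1 \<Longrightarrow> \<bar>z\<bar> < 1 \<Longrightarrow> ereal (norm z) < fps_conv_radius F"
  for z :: real
  by (rule less_le_trans[of _ 1]) (simp_all add: one_ereal_def)

lemma exc_fps_0_plog: "exc_fps \<omega> \<epsilon> 0 \<in> plog (-3/2)"
  using powr_asymp_bigo[OF powr_asymp_c_coeff] by (intro plog_bigo) (simp add: exc_fps_0_nth)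

lemma eval_exc_fps_0:
  assumes "0 < z" "z < 1"
  shows "eval_fps (exc_fps \<omega> \<epsilon> 0) z = (1 - (1 - z) powr (1/2)) / z"
proof -
  have radius: "fps_conv_radius (exc_fps \<omega> \<epsilon> 0) \<ge> 1" "fps_conv_radius (binser a) \<ge> 1" for a
    using plog_conv_radius[OF exc_fps_0_plog] plog_conv_radius[OF binser_plog[OF order_refl]] by auto
  have z: "ereal (norm z) < fps_conv_radius F" if "fps_conv_radius F \<ge> 1" for F :: "real fps"
    using assms that by (intro less_conv_radius) auto
  have "z * eval_fps (exc_fps \<omega> \<epsilon> 0) z = eval_fps (fps_X * exc_fps \<omega> \<epsilon> 0) z"
    by (subst eval_fps_mult) (use z radius in auto)
  also have "\<dots> = 1 - (1 - z) powr (1/2)"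
    unfolding X_exc_fps_0 using assms by (subst eval_fps_diff) (use z radius in \<open>auto simp: eval_binser\<close>)
  finally show ?thesis using assms by (simp add: field_simps)
qed

section \<open>The weight and the series of order one\<close>

locale slice_weight =
  fixes p \<eta> \<epsilon> :: real and \<omega> :: "nat \<Rightarrow> real"
  assumes p_pos: "p > 0" and p_half: "p \<noteq> 1/2" and \<eta>_pos: "\<eta> > 0"
    and \<omega>_asymp: "(\<lambda>N. \<omega> N / real N powr p - 1) \<in> O(\<lambda>N. real N powr (-\<eta>))"
    and alpha: "is_alpha p \<eta> \<omega> \<epsilon>"
begin

abbreviation "E \<equiv> exc_fps \<omega> \<epsilon>"
abbreviation "K \<equiv> twist_fps \<omega> \<epsilon>"
abbreviation "\<kappa> \<equiv> Gamma (p - 1/2) / (2 * sqrt pi)"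

text \<open>\<open>\<eta>\<close> is the accuracy of the weight, \<open>p\<close> comes from the
  constant \<open>\<epsilon>\<close> beside \<open>n powr p\<close>, and \<open>1/2\<close> from
  neglected terms such as \<open>K s\<close> beside \<open>binser (1/2) * K s\<close>.\<close>

definition \<delta> :: real where "\<delta> = min \<eta> (min p (1/2))"

lemma \<delta>: "\<delta> > 0" "\<delta> \<le> \<eta>" "\<delta> \<le> p" "\<delta> \<le> 1/2"
  using p_pos \<eta>_pos by (auto simp: \<delta>_def)

lemma powr_asymp_weight: "powr_asymp (\<lambda>n. \<omega> n - \<epsilon>) 1 p \<delta>"
proof -
  have "(\<lambda>n. real n powr p * (\<omega> n / real n powr p - 1)) \<in> O(\<lambda>n. real n powr p * real n powr (-\<eta>))"
    by (intro landau_o.big.mult \<omega>_asymp) auto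
  also have "(\<lambda>n. real n powr p * real n powr (-\<eta>)) \<in> O(\<lambda>n. real (Suc n) powr (p - \<eta>))" by real_asymp
  also have "(\<lambda>n. real (Suc n) powr (p - \<eta>)) \<in> O(\<lambda>n. real (Suc n) powr (p - \<delta>))"
    using \<delta> by (intro powr_Suc_bigo_mono) simp
  finally have 1: "(\<lambda>n. real n powr p * (\<omega> n / real n powr p - 1)) \<in> O(\<lambda>n. real (Suc n) powr (p - \<delta>))" .
  \<comment> \<open>At \<open>n = 0\<close> the quotient is a division by 0 with value 0, so this
    holds only eventually.\<close>
  have ev: "\<forall>\<^sub>F n in sequentially. real n powr p * (\<omega> n / real n powr p - 1) = \<omega> n - real n powr p"
    using eventually_gt_at_top[of 0] by eventually_elim (simp add: field_simps)
  have "(\<lambda>n. \<omega> n - real n powr p) \<in> O(\<lambda>n. real (Suc n) powr (p - \<delta>))"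
    using 1 unfolding landau_o.big.in_cong[OF ev] .
  moreover have "(\<lambda>n. real n powr p - real (Suc n) powr p) \<in> O(\<lambda>n. real (Suc n) powr (p - 1))"
    by real_asymp
  then have "(\<lambda>n. real n powr p - real (Suc n) powr p) \<in> O(\<lambda>n. real (Suc n) powr (p - \<delta>))"
    using \<delta> by (elim landau_o.big_trans) (intro powr_Suc_bigo_mono, simp)
  moreover have "(\<lambda>n. \<epsilon>) \<in> O(\<lambda>n. real (Suc n) powr 0)"
    by (intro landau_o.bigI[of "\<bar>\<epsilon>\<bar> + 1"]) auto
  then have "(\<lambda>n. \<epsilon>) \<in> O(\<lambda>n. real (Suc n) powr (p - \<delta>))"
    using \<delta> by (elim landau_o.big_trans) (intro powr_Suc_bigo_mono, simp)
  ultimately have "(\<lambda>n. (\<omega> n - real n powr p) + (real n powr p - real (Suc n) powr p) - \<epsilon>) \<in> O(\<lambda>n. real (Suc n) powr (p - \<delta>))"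
    by (rule sum_in_bigo(2)[OF sum_in_bigo(1)])
  then show ?thesis by (simp add: powr_asymp_def algebra_simps)
qed

lemma weight_power_bigo: "(\<lambda>n. (\<omega> n - \<epsilon>) ^ q / fact q) \<in> O(\<lambda>n. real (Suc n) powr (p * real q))"
proof -
  have "(\<lambda>n. (\<omega> n - \<epsilon>) ^ q) \<in> O(\<lambda>n. (real (Suc n) powr p) ^ q)"
    using powr_asymp_bigo[OF powr_asymp_weight] \<delta>(1) by (intro landau_o.big_power) simp
  then show ?thesis by (simp add: powr_power mult.commute)
qed

lemma K_1: "K 1 = Abs_fps (\<lambda>n. c_coeff n * (\<omega> n - \<epsilon>))"
  by (rule fps_ext) (simp add: twist_fps_def exc_fps_0_nth)

text \<open>The error of \<open>K 1\<close>. The bound on its coefficients found next is summable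
  exactly for \<open>p - \<delta> < 1/2\<close>, and then the value at 1 matters.\<close>

definition R :: "real fps" where "R = K 1 - fps_const \<kappa> * binser (p - 1/2)"

lemma R_bigo: "(\<lambda>n. R $ n) \<in> O(\<lambda>n. real (Suc n) powr (p - 3/2 - \<delta>))"
proof -
  have c: "powr_asymp c_coeff (1 / (2 * sqrt pi)) (-3/2) \<delta>"
    using \<delta> by (intro powr_asymp_weaken[OF powr_asymp_c_coeff]) simp
  have "powr_asymp (\<lambda>n. c_coeff n * (\<omega> n - \<epsilon>)) (1 / (2 * sqrt pi) * 1) (-3/2 + p) \<delta>"
    using \<delta> by (intro powr_asymp_mult c powr_asymp_weight) simp
  then have "(\<lambda>n. c_coeff n * (\<omega> n - \<epsilon>) - 1 / (2 * sqrt pi) * real (Suc n) powr (p - 3/2)) \<in> O(\<lambda>n. real (Suc n) powr (p - 3/2 - \<delta>))"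
    by (simp add: powr_asymp_def algebra_simps)
  moreover have "(\<lambda>n. \<kappa> * (binser (p - 1/2) $ n - rGamma (p - 1/2) * real (Suc n) powr (p - 1/2 - 1))) \<in> O(\<lambda>n. real (Suc n) powr (p - 1/2 - 2))"
    using binser_asymp[of "p - 1/2"] by simp
  then have "(\<lambda>n. \<kappa> * (binser (p - 1/2) $ n - rGamma (p - 1/2) * real (Suc n) powr (p - 1/2 - 1))) \<in> O(\<lambda>n. real (Suc n) powr (p - 3/2 - \<delta>))"
    using \<delta> by (elim landau_o.big_trans) (intro powr_Suc_bigo_mono, simp)
  ultimately have "(\<lambda>n. (c_coeff n * (\<omega> n - \<epsilon>) - 1 / (2 * sqrt pi) * real (Suc n) powr (p - 3/2)) -
      \<kappa> * (binser (p - 1/2) $ n - rGamma (p - 1/2) * real (Suc n) powr (p - 1/2 - 1))) \<in> O(\<lambda>n. real (Suc n) powr (p - 3/2 - \<delta>))"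
    by (rule sum_in_bigo)
  moreover have "(c_coeff n * (\<omega> n - \<epsilon>) - 1 / (2 * sqrt pi) * real (Suc n) powr (p - 3/2)) -
      \<kappa> * (binser (p - 1/2) $ n - rGamma (p - 1/2) * real (Suc n) powr (p - 1/2 - 1)) = R $ n" for n
  proof -
    \<comment> \<open>The constant \<open>\<kappa>\<close> is the one that gives
      \<open>\<kappa> * binser (p - 1/2)\<close> the leading constant
      \<open>1 / (2 * sqrt pi)\<close> of \<open>c_coeff\<close>; \<open>p \<noteq> 1/2\<close>
      avoids the pole at 0.\<close>
    have "Gamma (p - 1/2) \<noteq> 0" using p_pos p_half by (intro Gamma_nonzero) auto
    then have "\<kappa> * rGamma (p - 1/2) = 1 / (2 * sqrt pi)"
      by (simp add: rGamma_inverse_Gamma field_simps)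
    then have "\<kappa> * (rGamma (p - 1/2) * real (Suc n) powr (p - 1/2 - 1)) = 1 / (2 * sqrt pi) * real (Suc n) powr (p - 3/2)"
      by (simp only: mult.assoc[symmetric]) simp
    then show ?thesis unfolding right_diff_distrib[of \<kappa>] by (simp add: R_def K_1[unfolded One_nat_def] algebra_simps)
  qed
  ultimately show ?thesis by simp
qed

lemma conv_radius_K_1: "fps_conv_radius (K 1) \<ge> 1" "fps_conv_radius R \<ge> 1"
proof -
  have R: "R \<in> plog (max (p - 3/2 - \<delta>) (p - 3/2))"
    by (rule plog_mono[OF plog_bigo[OF R_bigo]]) simp
  moreover have "fps_const \<kappa> * binser (p - 1/2) \<in> plog (max (p - 3/2 - \<delta>) (p - 3/2))"
    by (intro plog_cmult binser_plog) simp
  ultimately have "R + fps_const \<kappa> * binser (p - 1/2) \<in> plog (max (p - 3/2 - \<delta>) (p - 3/2))"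
    by (rule plog_add)
  then show "fps_conv_radius (K 1) \<ge> 1" "fps_conv_radius R \<ge> 1"
    using plog_conv_radius R by (auto simp: R_def)
qed

abbreviation "m \<equiv> min \<eta> (1/2)"

text \<open>The only place where the hypothesis on \<open>\<epsilon>\<close> enters.\<close>

lemma eval_K_1:
  "(\<lambda>z. eval_fps (K 1) z - (\<kappa> * (1 - z) powr (1/2 - p) + \<epsilon> * (1 - z) powr (1/2)))
     \<in> O[at_left 1](\<lambda>z. (1 - z) powr min 1 (1/2 - p + m))"
proof -
  obtain g h where g: "g \<in> O[at_left 1](\<lambda>z. 1 - z)"
    and h: "h \<in> O[at_left 1](\<lambda>z. (1 - z) powr m)"
    and gh: "\<forall>\<^sub>F z in at_left 1. (\<Sum>k. c_coeff k * \<omega> k * z ^ k) =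
       \<epsilon> * (1 + g z) + \<kappa> * (1 - z) powr (1/2 - p) * (1 + h z)"
    using alpha unfolding is_alpha_def by auto
  let ?r = "\<lambda>z. \<epsilon> * g z - \<epsilon> * ((1 - z) * ((1 - (1 - z) powr (1/2)) / z)) + \<kappa> * ((1 - z) powr (1/2 - p) * h z)"
  have ev: "\<forall>\<^sub>F z in at_left 1. eval_fps (K 1) z - (\<kappa> * (1 - z) powr (1/2 - p) + \<epsilon> * (1 - z) powr (1/2)) = ?r z"
    using gh at_left_1_unit
  proof eventually_elim
    case (elim z)
    have z: "ereal (norm z) < fps_conv_radius F" if "fps_conv_radius F \<ge> 1" for F :: "real fps"
      using elim that by (intro less_conv_radius) auto
    have K: "(\<lambda>n. K 1 $ n * z ^ n) sums eval_fps (K 1) z"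
      by (rule sums_eval_fps) (rule z[OF conv_radius_K_1(1)])
    have E: "(\<lambda>n. E 0 $ n * z ^ n) sums eval_fps (E 0) z"
      by (rule sums_eval_fps) (rule z[OF plog_conv_radius[OF exc_fps_0_plog]])
    have "(\<lambda>n. K 1 $ n * z ^ n + \<epsilon> * (E 0 $ n * z ^ n)) sums (eval_fps (K 1) z + \<epsilon> * eval_fps (E 0) z)"
      by (intro sums_add sums_mult K E)
    also have "(\<lambda>n. K 1 $ n * z ^ n + \<epsilon> * (E 0 $ n * z ^ n)) = (\<lambda>n. c_coeff n * \<omega> n * z ^ n)"
      by (rule ext) (simp add: K_1[unfolded One_nat_def] exc_fps_0_nth algebra_simps)
    finally have "eval_fps (K 1) z = (\<Sum>k. c_coeff k * \<omega> k * z ^ k) - \<epsilon> * eval_fps (E 0) z"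
      by (simp add: sums_iff)
    moreover define w where "w = (1 - (1 - z) powr (1/2)) / z"
    moreover have "eval_fps (E 0) z = w"
      unfolding w_def using elim by (intro eval_exc_fps_0) auto
    moreover have "z * w = 1 - (1 - z) powr (1/2)"
      using elim by (simp add: w_def)
    \<comment> \<open>With \<open>w\<close> the value of \<open>E 0\<close>, this is its expansion
      at 1: the constant 1 cancels the \<open>\<epsilon>\<close> of the hypothesis, the square root
      survives in the statement, and the rest is \<open>O(1 - z)\<close>.\<close>
    then have "w = 1 - (1 - z) powr (1/2) + (1 - z) * w" by (simp add: left_diff_distrib)
    ultimately have "eval_fps (K 1) z = \<epsilon> * (1 + g z) + \<kappa> * (1 - z) powr (1/2 - p) * (1 + h z) -
        \<epsilon> * (1 - (1 - z) powr (1/2) + (1 - z) * w)"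
      using elim(1) by metis
    then have "eval_fps (K 1) z - (\<kappa> * (1 - z) powr (1/2 - p) + \<epsilon> * (1 - z) powr (1/2)) =
        \<epsilon> * g z - \<epsilon> * ((1 - z) * w) + \<kappa> * ((1 - z) powr (1/2 - p) * h z)"
      by (simp add: distrib_left right_diff_distrib mult.assoc)
    then show ?case unfolding w_def .
  qed
  have "?r \<in> O[at_left 1](\<lambda>z. (1 - z) powr min 1 (1/2 - p + m))"
  proof -
    have min1: "(\<lambda>z. (1 - z) powr 1) \<in> O[at_left 1](\<lambda>z::real. (1 - z) powr min 1 (1/2 - p + m))"
      and min2: "(\<lambda>z. (1 - z) powr (1/2 - p + m)) \<in> O[at_left 1](\<lambda>z::real. (1 - z) powr min 1 (1/2 - p + m))"
      by (intro powr_at_left_bigo_mono; simp)+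
    have "g \<in> O[at_left 1](\<lambda>z::real. (1 - z) powr 1)"
      by (rule landau_o.big_trans[OF g]) real_asymp
    then have "(\<lambda>z. \<epsilon> * g z) \<in> O[at_left 1](\<lambda>z. (1 - z) powr min 1 (1/2 - p + m))"
      using min1 by (auto intro: landau_o.big_trans)
    moreover have "(\<lambda>z. (1 - z) * ((1 - (1 - z) powr (1/2)) / z)) \<in> O[at_left 1](\<lambda>z::real. (1 - z) powr 1)"
      by real_asymp
    then have "(\<lambda>z. \<epsilon> * ((1 - z) * ((1 - (1 - z) powr (1/2)) / z))) \<in> O[at_left 1](\<lambda>z. (1 - z) powr min 1 (1/2 - p + m))"
      by (intro cmult_bigo) (rule landau_o.big_trans[OF _ min1])
    moreover have "(\<lambda>z. (1 - z) powr (1/2 - p) * h z) \<in> O[at_left 1](\<lambda>z. (1 - z) powr (1/2 - p) * (1 - z) powr m)"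
      using h by (intro landau_o.big.mult) auto
    then have "(\<lambda>z. (1 - z) powr (1/2 - p) * h z) \<in> O[at_left 1](\<lambda>z. (1 - z) powr (1/2 - p + m))"
      by (simp add: powr_add)
    then have "(\<lambda>z. \<kappa> * ((1 - z) powr (1/2 - p) * h z)) \<in> O[at_left 1](\<lambda>z. (1 - z) powr min 1 (1/2 - p + m))"
      by (intro cmult_bigo) (rule landau_o.big_trans[OF _ min2])
    ultimately show ?thesis by (rule sum_in_bigo(1)[OF sum_in_bigo(2)])
  qed
  then show ?thesis unfolding landau_o.big.in_cong[OF ev] .
qed

text \<open>Under this assumption both error exponents in \<open>eval_K_1\<close> are positive, so
  \<open>eval_fps R z\<close> tends to 0. As the coefficients are absolutely summable, the limit is
  also their sum.\<close>

lemma R_sums_0: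
  assumes "p - \<delta> < 1/2"
  shows "(\<lambda>n. R $ n) sums 0"
proof -
  obtain C where C: "C > 0" "\<And>n. \<bar>R $ n\<bar> \<le> C * real (Suc n) powr (p - 3/2 - \<delta>)"
    using bigo_nat_bound[OF R_bigo] by auto
  have "summable (\<lambda>n. real n powr (p - 3/2 - \<delta>))"
    using assms by (simp add: summable_real_powr_iff)
  then have "summable (\<lambda>n. C * real (Suc n) powr (p - 3/2 - \<delta>))"
    by (intro summable_mult) (subst summable_Suc_iff)
  then have summable: "summable (\<lambda>n. \<bar>R $ n\<bar>)"
    by (rule summable_comparison_test[rotated]) (use C in auto)
  have "((\<lambda>z. eval_fps R z) \<longlongrightarrow> 0) (at_left (1::real))"
  proof -
    have exps: "min 1 (1/2 - p + m) > 0"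
      using assms by (auto simp: \<delta>_def min_def split: if_splits)
    have "((\<lambda>z. (1 - z) powr min 1 (1/2 - p + m)) \<longlongrightarrow> 0) (at_left (1::real))"
      using exps by real_asymp
    then have "(\<lambda>z. (1 - z) powr min 1 (1/2 - p + m)) \<in> o[at_left (1::real)](\<lambda>_. 1)"
      by (intro smalloI_tendsto) auto
    then have "(\<lambda>z. eval_fps (K 1) z - (\<kappa> * (1 - z) powr (1/2 - p) + \<epsilon> * (1 - z) powr (1/2))) \<in> o[at_left 1](\<lambda>_. 1)"
      by (rule landau_o.big_small_trans[OF eval_K_1])
    then have "((\<lambda>z. eval_fps (K 1) z - (\<kappa> * (1 - z) powr (1/2 - p) + \<epsilon> * (1 - z) powr (1/2))) \<longlongrightarrow> 0) (at_left 1)"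
      by (auto dest: smalloD_tendsto)
    moreover have "((\<lambda>z. \<epsilon> * (1 - z) powr (1/2)) \<longlongrightarrow> 0) (at_left (1::real))"
      by (intro tendsto_mult_right_zero) real_asymp
    ultimately have lim: "((\<lambda>z. eval_fps (K 1) z - (\<kappa> * (1 - z) powr (1/2 - p) + \<epsilon> * (1 - z) powr (1/2))
        + \<epsilon> * (1 - z) powr (1/2)) \<longlongrightarrow> 0 + 0) (at_left 1)"
      by (rule tendsto_add)
    have "\<forall>\<^sub>F z in at_left 1. eval_fps (K 1) z - (\<kappa> * (1 - z) powr (1/2 - p) + \<epsilon> * (1 - z) powr (1/2))
        + \<epsilon> * (1 - z) powr (1/2) = eval_fps R z"
      using at_left_1_unit
    proof eventually_elim
      case (elim z)
      have z: "ereal (norm z) < fps_conv_radius F" if "fps_conv_radius F \<ge> 1" for F :: "real fps"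
        using elim that by (intro less_conv_radius) auto
      have "K 1 = R + fps_const \<kappa> * binser (p - 1/2)" by (simp add: R_def)
      also have "eval_fps \<dots> z = eval_fps R z + \<kappa> * (1 - z) powr (1/2 - p)"
      proof -
        have b: "fps_conv_radius (binser (p - 1/2)) \<ge> 1" by (rule plog_conv_radius[OF binser_plog[OF order_refl]])
        have kb: "fps_conv_radius (fps_const \<kappa> * binser (p - 1/2)) \<ge> 1"
          by (rule plog_conv_radius[OF plog_cmult[OF binser_plog[OF order_refl]]])
        have "eval_fps (binser (p - 1/2)) z = (1 - z) powr (1/2 - p)"
          using elim by (simp add: eval_binser)
        then show ?thesis
          by (simp add: eval_fps_add[OF z[OF conv_radius_K_1(2)] z[OF kb]]
              eval_fps_mult[of z "fps_const \<kappa>", OF _ z[OF b], simplified])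
      qed
      finally show ?case by simp
    qed
    then show ?thesis using Lim_transform_eventually[OF lim] by simp
  qed
  moreover have "((\<lambda>z. eval_fps R z) \<longlongrightarrow> (\<Sum>n. R $ n)) (at_left (1::real))"
    by (rule Abel_limit_abs[OF summable])
  ultimately have "(\<Sum>n. R $ n) = 0" by (intro tendsto_unique[of "at_left (1::real)"]) auto
  then show ?thesis using summable_rabs_cancel[OF summable] by (simp add: sums_iff)
qed

end

section \<open>Induction on the order of the moment\<close>

lemma fps_half_double: "fps_const (1/2) * (2 * F) = (F :: real fps)"
  by (rule fps_ext) (simp only: fps_mult_left_const_nth mult_2 fps_add_nth, simp)

context slice_weight
begin

text \<open>The exponent of the singular part of \<open>E s\<close>, with its sign reversed. The
  value \<open>a 0 = -1/2\<close> matches the singular term \<open>- (1 - z) powr (1/2)\<close> of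
  \<open>E 0\<close>, which is also why \<open>mu_E p 0 = -1/2\<close>.\<close>

definition a :: "nat \<Rightarrow> real" where "a s = (p + 1/2) * real s - 1/2"

text \<open>If \<open>p - \<delta> < 1/2\<close>, the general convolution bound would stop at
  \<open>n powr (-1/2)\<close>, and the vanishing sum of \<open>R\<close> removes this contribution.
  Otherwise \<open>n powr (-1/2)\<close> is within the target order.\<close>

lemma binser_half_R_plog: "binser (1/2) * R \<in> plog (p - 1 - \<delta>)"
proof (cases "p - \<delta> < 1/2")
  case True
  obtain C where C: "\<And>n. \<bar>R $ n\<bar> \<le> C * real (Suc n) powr (p - 3/2 - \<delta>)"
    using bigo_nat_bound[OF R_bigo] by auto
  have "binser (1/2) * R \<in> plog (p - 3/2 - \<delta> + 1/2)"
    by (rule binser_half_mult_plog[OF C]) (use True \<delta> R_sums_0 in auto)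
  then show ?thesis by (simp add: algebra_simps)
next
  case False
  then show ?thesis
    by (intro plog_mult[OF binser_plog[OF order_refl] plog_bigo[OF R_bigo]]) auto
qed

lemma binser_lead_E_1: "binser_lead (E 1) (2 * mu_E p 1) p \<delta>"
proof -
  have R: "R \<in> plog (p - 1/2 - 1 - \<delta>)" using plog_bigo[OF R_bigo] by (simp add: algebra_simps)
  have K1: "binser_lead (K 1) \<kappa> (p - 1/2) \<delta>"
    using R by (simp add: binser_lead_def R_def)
  have "binser_lead (K 1) 0 (p - 1/2 + 1/2) \<delta>"
    using \<delta> by (intro binser_lead_weaken_exponent[OF K1]) auto
  moreover have "binser_lead (binser (1/2) * K 1) \<kappa> p \<delta>"
  proof -
    have "binser (1/2) * R = binser (1/2) * K 1 - fps_const \<kappa> * (binser (1/2) * binser (p - 1/2))"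
      by (simp only: R_def right_diff_distrib mult.left_commute)
    then show ?thesis using binser_half_R_plog by (simp add: binser_lead_def binser_mult)
  qed
  ultimately have "binser_lead (binser (1/2) * K 1 - K 1) (\<kappa> - 0) p \<delta>"
    by (intro binser_lead_diff) auto
  moreover have "2 * E 1 = binser (1/2) * K 1 - K 1"
    using exc_fps_formula[of 1 \<omega> \<epsilon>] by (simp add: left_diff_distrib)
  ultimately have "binser_lead (2 * E 1) \<kappa> p \<delta>" by simp
  then have "binser_lead (fps_const (1/2) * (2 * E 1)) (1/2 * \<kappa>) p \<delta>"
    by (rule binser_lead_cmult)
  then show ?thesis unfolding fps_half_double by (simp add: mu_E.simps)
qed

text \<open>Each of the \<open>j - i\<close> factors of the weight contributes \<open>p\<close>,
  whereas each unit of \<open>j\<close> is worth \<open>p + 1/2\<close>; this leaves the deficit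
  \<open>real (j - i) / 2\<close>.\<close>

lemma twist_term_plog:
  assumes "E i \<in> plog ((p + 1/2) * real i - 3/2)" "i < j"
  shows "Abs_fps (\<lambda>N. E i $ N * ((\<omega> N - \<epsilon>) ^ (j - i) / fact (j - i)))
          \<in> plog ((p + 1/2) * real j - real (j - i) / 2 - 3/2)"
proof -
  have "real j = real i + real (j - i)" using assms(2) by simp
  then have "(p + 1/2) * real i - 3/2 + p * real (j - i) = (p + 1/2) * real j - real (j - i) / 2 - 3/2"
    by (simp only: distrib_left distrib_right)
  from plog_hadamard[OF assms(1) weight_power_bigo[of "j - i"], unfolded this] show ?thesis .
qed

lemma K_plog:
  assumes "\<And>i. i < j \<Longrightarrow> E i \<in> plog ((p + 1/2) * real i - 3/2)"
  shows "K j \<in> plog ((p + 1/2) * real j - 2)"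
  unfolding twist_fps_def
proof (rule plog_sum)
  fix i assume i: "i \<in> {..<j}"
  then have "real (j - i) \<ge> 1" by auto
  then have "(p + 1/2) * real j - real (j - i) / 2 - 3/2 \<le> (p + 1/2) * real j - 2" by linarith
  then show "Abs_fps (\<lambda>N. E i $ N * ((\<omega> N - \<epsilon>) ^ (j - i) / fact (j - i))) \<in> plog ((p + 1/2) * real j - 2)"
    using i assms by (intro plog_mono[OF twist_term_plog]) auto
qed

text \<open>Only \<open>i = s - 1\<close> has the smallest deficit \<open>1/2\<close>; the other
  terms of \<open>K s\<close> fall behind by at least another \<open>1/2\<close>. The quotient of
  Gamma values arises from passing to powers of \<open>n\<close>, multiplying by
  \<open>n powr p\<close> and passing back to \<open>binser b\<close>.\<close>

lemma binser_lead_K: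
  assumes s: "s \<ge> 2"
    and lead: "binser_lead (E (s - 1)) c (a (s - 1)) \<delta>"
    and E: "\<And>i. i < s \<Longrightarrow> E i \<in> plog ((p + 1/2) * real i - 3/2)"
  defines "b \<equiv> (p + 1/2) * real s - 1"
  shows "binser_lead (K s) (c * (Gamma b / Gamma (b - p))) b \<delta>"
proof -
  let ?a = "a (s - 1)" and ?w = "\<lambda>N. \<omega> N - \<epsilon>"
  have s1: "real (s - 1) = real s - 1" "real s \<ge> 2" using s by auto
  have ab: "?a = b - p" unfolding a_def b_def s1(1) by (simp add: algebra_simps diff_divide_distrib)
  \<comment> \<open>From \<open>s \<ge> 2\<close> even \<open>b - p \<ge> p\<close>; both Gamma
    arguments thus stay away from the poles.\<close>
  have b_p: "b - p > 0"
  proof -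
    have "(p + 1/2) * real s \<ge> (p + 1/2) * 2" using s1 p_pos by (intro mult_left_mono) auto
    then show ?thesis using p_pos by (simp add: b_def)
  qed
  have "{..<s} = insert (s - 1) {..<s - 1}" using s by auto
  then have K: "K s = Abs_fps (\<lambda>N. E (s - 1) $ N * ?w N) +
      (\<Sum>i<s - 1. Abs_fps (\<lambda>N. E i $ N * (?w N ^ (s - i) / fact (s - i))))"
    using s by (simp add: twist_fps_def)
  have "(\<Sum>i<s - 1. Abs_fps (\<lambda>N. E i $ N * (?w N ^ (s - i) / fact (s - i)))) \<in> plog (b - 1 - \<delta>)"
  proof (rule plog_sum)
    fix i assume i: "i \<in> {..<s - 1}"
    then have "real (s - i) \<ge> 2" using s by auto
    then have "(p + 1/2) * real s - real (s - i) / 2 - 3/2 \<le> b - 1 - \<delta>"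
      using \<delta> unfolding b_def by linarith
    then show "Abs_fps (\<lambda>N. E i $ N * (?w N ^ (s - i) / fact (s - i))) \<in> plog (b - 1 - \<delta>)"
      using i E by (intro plog_mono[OF twist_term_plog]) auto
  qed
  then have rest: "binser_lead (\<Sum>i<s - 1. Abs_fps (\<lambda>N. E i $ N * (?w N ^ (s - i) / fact (s - i)))) 0 b \<delta>"
    by (rule plog_binser_lead)
  let ?Q = "E (s - 1) - fps_const c * binser ?a"
  have "Abs_fps (\<lambda>N. ?Q $ N * ?w N) \<in> plog (?a - 1 - \<delta> + p)"
    using lead powr_asymp_bigo[OF powr_asymp_weight] \<delta> unfolding binser_lead_def
    by (intro plog_hadamard) auto
  moreover have "?a - 1 - \<delta> + p = b - 1 - \<delta>" using ab by simp
  ultimately have Q: "Abs_fps (\<lambda>N. ?Q $ N * ?w N) \<in> plog (b - 1 - \<delta>)" by (simp only:)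
  have "powr_asymp (\<lambda>n. binser ?a $ n * ?w n) (rGamma ?a * 1) (?a - 1 + p) \<delta>"
    using \<delta> by (intro powr_asymp_mult powr_asymp_weight powr_asymp_weaken[OF powr_asymp_binser]) auto
  then have 1: "(\<lambda>n. binser ?a $ n * ?w n - rGamma ?a * real (Suc n) powr (b - 1)) \<in> O(\<lambda>n. real (Suc n) powr (b - 1 - \<delta>))"
  proof -
    have "?a - 1 + p = b - 1" using ab by simp
    from \<open>powr_asymp (\<lambda>n. binser ?a $ n * ?w n) (rGamma ?a * 1) (?a - 1 + p) \<delta>\<close>[unfolded this]
    show ?thesis by (simp add: powr_asymp_def)
  qed
  have "powr_asymp (\<lambda>n. binser b $ n) (rGamma b) (b - 1) \<delta>"
    using \<delta> by (intro powr_asymp_weaken[OF powr_asymp_binser]) auto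
  then have 2: "(\<lambda>n. Gamma b / Gamma (b - p) * (binser b $ n - rGamma b * real (Suc n) powr (b - 1))) \<in> O(\<lambda>n. real (Suc n) powr (b - 1 - \<delta>))"
    unfolding powr_asymp_def by (rule cmult_bigo)
  have "Gamma b / Gamma (b - p) * rGamma b = rGamma ?a"
    using b_p p_pos unfolding ab by (simp add: rGamma_inverse_Gamma field_simps Gamma_nonzero)
  then have "Gamma b / Gamma (b - p) * (rGamma b * real (Suc n) powr (b - 1)) = rGamma ?a * real (Suc n) powr (b - 1)" for n
    by (simp only: mult.assoc[symmetric])
  then have "(\<lambda>n. (binser ?a $ n * ?w n - rGamma ?a * real (Suc n) powr (b - 1)) -
      Gamma b / Gamma (b - p) * (binser b $ n - rGamma b * real (Suc n) powr (b - 1))) =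
     (\<lambda>n. (Abs_fps (\<lambda>n. binser ?a $ n * ?w n) - fps_const (Gamma b / Gamma (b - p)) * binser b) $ n)"
    unfolding right_diff_distrib by (simp add: fun_eq_iff)
  then have "Abs_fps (\<lambda>n. binser ?a $ n * ?w n) - fps_const (Gamma b / Gamma (b - p)) * binser b \<in> plog (b - 1 - \<delta>)"
    using sum_in_bigo(2)[OF 1 2] by (intro plog_bigo) simp
  then have "binser_lead (Abs_fps (\<lambda>n. binser ?a $ n * ?w n)) (Gamma b / Gamma (b - p)) b \<delta>"
    by (simp add: binser_lead_def)
  then have "binser_lead (fps_const c * Abs_fps (\<lambda>n. binser ?a $ n * ?w n) + Abs_fps (\<lambda>N. ?Q $ N * ?w N))
      (c * (Gamma b / Gamma (b - p)) + 0) b \<delta>"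
    by (intro binser_lead_add binser_lead_cmult plog_binser_lead Q)
  moreover have "fps_const c * Abs_fps (\<lambda>n. binser ?a $ n * ?w n) + Abs_fps (\<lambda>N. ?Q $ N * ?w N) =
      Abs_fps (\<lambda>N. E (s - 1) $ N * ?w N)"
    by (rule fps_ext) (simp add: algebra_simps)
  ultimately have "binser_lead (Abs_fps (\<lambda>N. E (s - 1) $ N * ?w N)) (c * (Gamma b / Gamma (b - p))) b \<delta>"
    by simp
  from binser_lead_add[OF this rest] show ?thesis by (simp add: K)
qed

lemma binser_lead_E:
  "s \<ge> 1 \<Longrightarrow> binser_lead (E s) (2 * mu_E p s) (a s) \<delta>"
proof (induction s rule: less_induct)
  case (less s)
  show ?case
  proof (cases "s = 1")
    case True
    then show ?thesis using binser_lead_E_1 by (simp add: a_def)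
  next
    case False
    then have s: "s \<ge> 2" using less.prems by simp
    have E: "E i \<in> plog ((p + 1/2) * real i - 3/2)" if "i < s" for i
    proof (cases "i = 0")
      case True
      then show ?thesis using exc_fps_0_plog by simp
    next
      case False
      then have "E i \<in> plog (a i - 1)" using less.IH[OF that] \<delta> by (intro binser_lead_plog) auto
      then show ?thesis by (simp add: a_def algebra_simps)
    qed
    \<comment> \<open>\<open>b\<close> is the exponent before the division by the square root:
      \<open>b + 1/2 = a s\<close>, and \<open>a j + a (s - j) = b\<close> for every
      product.\<close>
    define b where "b = (p + 1/2) * real s - 1"
    have big: "(p + 1/2) * real i \<ge> p + 1/2" if "i \<ge> 1" for i :: nat
      using mult_left_mono[of 1 "real i" "p + 1/2"] that p_pos by simp
    have a_ge: "\<delta> \<le> a i" if "i \<ge> 1" for i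
      using big[OF that] \<delta> unfolding a_def by linarith
    have b_ge: "b \<ge> \<delta>"
      using mult_left_mono[of 2 "real s" "p + 1/2"] s p_pos \<delta> by (simp add: b_def)
    define c where "c = 2 * mu_E p (s - 1) * (Gamma b / Gamma (b - p))"
    have K: "binser_lead (K s) c b \<delta>"
      unfolding c_def b_def using s E less.IH[of "s - 1"] by (intro binser_lead_K) auto
    have HE: "binser_lead (arch_fps \<omega> \<epsilon> j * E (s - j)) (4 * (mu_E p j * mu_E p (s - j))) b \<delta>"
      if j: "j \<in> {1..s-1}" for j
    proof -
      have js: "1 \<le> j" "j < s" "1 \<le> s - j" "s - j < s" using j s by auto
      have sum: "(p + 1/2) * real j + (p + 1/2) * real (s - j) = (p + 1/2) * real s"
      proof -
        have "real s = real j + real (s - j)" using js by simp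
        then show ?thesis by (simp only: distrib_left)
      qed
      have "a j + a (s - j) = b" using sum by (simp add: a_def b_def)
      moreover have "binser_lead (E j * E (s - j)) (2 * mu_E p j * (2 * mu_E p (s - j))) (a j + a (s - j)) \<delta>"
        using js a_ge \<delta> by (intro binser_lead_mult less.IH) auto
      \<comment> \<open>The bound for \<open>K j\<close> is smaller than that for \<open>E j\<close>
        by the factor \<open>n powr (-1/2)\<close>, so to leading order \<open>arch_fps\<close> may
        be replaced by \<open>E j\<close>.\<close>
      moreover have "K j * E (s - j) \<in> plog (b - 1 - \<delta>)"
      proof (rule plog_mult[OF K_plog E])
        note bounds = sum big[OF js(1)] big[OF js(3)] \<delta>
        show "(p + 1/2) * real j - 2 \<le> b - 1 - \<delta>"
          using bounds unfolding b_def by linarith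
        show "(p + 1/2) * real (s - j) - 3/2 \<le> b - 1 - \<delta>"
          using bounds unfolding b_def by linarith
        show "(p + 1/2) * real j - 2 + ((p + 1/2) * real (s - j) - 3/2) + 1 \<le> b - 1 - \<delta>"
          using bounds unfolding b_def by linarith
      qed (use js E in auto)
      then have "binser_lead (K j * E (s - j)) 0 b \<delta>" by (rule plog_binser_lead)
      ultimately have "binser_lead (E j * E (s - j) + K j * E (s - j)) (2 * mu_E p j * (2 * mu_E p (s - j)) + 0) b \<delta>"
        by (intro binser_lead_add) auto
      moreover have "2 * mu_E p j * (2 * mu_E p (s - j)) + 0 = 4 * (mu_E p j * mu_E p (s - j))" by simp
      ultimately show ?thesis by (simp only: arch_fps_eq distrib_right)
    qed
    define S where "S = (\<Sum>j=1..s-1. arch_fps \<omega> \<epsilon> j * E (s - j))"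
    define d where "d = 4 * (\<Sum>j\<in>{1..s-1}. mu_E p j * mu_E p (s - j))"
    have "binser_lead S d b \<delta>"
      unfolding S_def d_def sum_distrib_left by (intro binser_lead_sum HE)
    then have XS: "binser_lead (fps_X * S) d b \<delta>" using \<delta> by (intro binser_lead_X_mult) auto
    have "binser_lead (K s) 0 (b + 1/2) \<delta>"
      using \<delta> by (intro binser_lead_weaken_exponent[OF K]) auto
    then have "binser_lead (binser (1/2) * K s - K s + binser (1/2) * (fps_X * S)) (c - 0 + d) (b + 1/2) \<delta>"
      using \<delta> b_ge by (intro binser_lead_add binser_lead_diff binser_lead_half_mult K XS) auto
    moreover have "2 * E s = binser (1/2) * K s - K s + binser (1/2) * (fps_X * S)"
      using exc_fps_formula[OF less.prems, of \<omega> \<epsilon>] by (simp add: left_diff_distrib S_def)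
    ultimately have "binser_lead (2 * E s) (c + d) (b + 1/2) \<delta>" by simp
    then have "binser_lead (fps_const (1/2) * (2 * E s)) (1/2 * (c + d)) (b + 1/2) \<delta>"
      by (rule binser_lead_cmult)
    moreover have "b + 1/2 = a s" by (simp add: a_def b_def)
    \<comment> \<open>The factors 2 in \<open>c\<close> and 4 in \<open>d\<close> come from the
      leading constants \<open>2 * mu_E\<close>. Division of \<open>c + d\<close> by 4 leaves the
      recursion, including the 2 in front of the lower Gamma value.\<close>
    moreover have "1/2 * (c + d) = 2 * mu_E p s"
    proof -
      have "mu_E p s = mu_E p (s - 1) * (Gamma (real s * (p + 1/2) - 1) / (2 * Gamma (real s * (p + 1/2) - p - 1)))
           + (\<Sum>k\<in>{1..s-1}. mu_E p k * mu_E p (s - k))"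
        using s by (subst mu_E.simps) simp
      moreover have "real s * (p + 1/2) - 1 = b" "real s * (p + 1/2) - p - 1 = b - p"
        by (simp_all add: b_def mult.commute)
      ultimately show ?thesis by (simp add: c_def d_def)
    qed
    ultimately show ?thesis unfolding fps_half_double by simp
  qed
qed

end

section \<open>Asymptotic relations at the singularity\<close>

lemma O_tilde_bigo:
  assumes "f \<in> O[at_left 1](\<lambda>z. (1 - z) powr b)"
  shows "f \<in> O_tilde b"
proof -
  have "(\<lambda>z::real. (1 - z) powr b) \<in> O[at_left 1](\<lambda>z. (1 - z) powr b * \<bar>ln (1 - z)\<bar> powr 0)"
    by real_asymp
  with assms have "f \<in> O[at_left 1](\<lambda>z. (1 - z) powr b * \<bar>ln (1 - z)\<bar> powr 0)"
    by (rule landau_o.big_trans)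
  then show ?thesis unfolding O_tilde_def by blast
qed

lemma O_tilde_weight_mono:
  assumes "b \<le> a" "c \<le> d"
  shows "(\<lambda>z. (1 - z) powr a * \<bar>ln (1 - z)\<bar> powr c) \<in>
         O[at_left 1](\<lambda>z::real. (1 - z) powr b * \<bar>ln (1 - z)\<bar> powr d)"
proof (rule landau_o.bigI[of 1])
  have "\<forall>\<^sub>F z in at_left (1::real). \<bar>ln (1 - z)\<bar> \<ge> 1" by real_asymp
  then show "\<forall>\<^sub>F z in at_left 1. norm ((1 - z) powr a * \<bar>ln (1 - z)\<bar> powr c) \<le>
               1 * norm ((1 - z) powr b * \<bar>ln (1 - z)\<bar> powr d)"
    using at_left_1_unit
  proof eventually_elim
    case (elim z)
    then have "(1 - z) powr a * \<bar>ln (1 - z)\<bar> powr c \<le> (1 - z) powr b * \<bar>ln (1 - z)\<bar> powr d"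
      using assms by (intro mult_mono powr_mono powr_mono') auto
    then show ?case by (simp add: abs_mult)
  qed
qed simp

lemma O_tilde_mono:
  assumes "f \<in> O_tilde a" "b \<le> a"
  shows "f \<in> O_tilde b"
  using assms landau_o.big_trans[OF _ O_tilde_weight_mono[OF assms(2) order_refl]]
  unfolding O_tilde_def by blast

lemma O_tilde_add:
  assumes "f \<in> O_tilde b" "g \<in> O_tilde b"
  shows "(\<lambda>z. f z + g z) \<in> O_tilde b"
proof -
  obtain c d where c: "f \<in> O[at_left 1](\<lambda>z. (1 - z) powr b * \<bar>ln (1 - z)\<bar> powr c)"
    and d: "g \<in> O[at_left 1](\<lambda>z. (1 - z) powr b * \<bar>ln (1 - z)\<bar> powr d)"
    using assms unfolding O_tilde_def by blast
  have "(\<lambda>z. f z + g z) \<in> O[at_left 1](\<lambda>z. (1 - z) powr b * \<bar>ln (1 - z)\<bar> powr max c d)"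
    by (intro sum_in_bigo landau_o.big_trans[OF c O_tilde_weight_mono] landau_o.big_trans[OF d O_tilde_weight_mono]) auto
  then show ?thesis unfolding O_tilde_def by blast
qed

lemma O_tilde_mult:
  assumes "f \<in> O_tilde a" "g \<in> O_tilde b"
  shows "(\<lambda>z. f z * g z) \<in> O_tilde (a + b)"
proof -
  obtain c d where c: "f \<in> O[at_left 1](\<lambda>z. (1 - z) powr a * \<bar>ln (1 - z)\<bar> powr c)"
    and d: "g \<in> O[at_left 1](\<lambda>z. (1 - z) powr b * \<bar>ln (1 - z)\<bar> powr d)"
    using assms unfolding O_tilde_def by blast
  have "(\<lambda>z. f z * g z) \<in> O[at_left 1](\<lambda>z. (1 - z) powr (a + b) * \<bar>ln (1 - z)\<bar> powr (c + d))"
    using landau_o.big.mult[OF c d] by (simp add: powr_add mult_ac)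
  then show ?thesis unfolding O_tilde_def by blast
qed

lemma O_tilde_powr: "b \<le> a \<Longrightarrow> (\<lambda>z. (1 - z) powr a) \<in> O_tilde b"
  by (intro O_tilde_bigo powr_at_left_bigo_mono)

lemma O_tilde_const: "b \<le> 0 \<Longrightarrow> (\<lambda>z. c) \<in> O_tilde b"
proof -
  assume "b \<le> 0"
  then have "(\<lambda>z. (1 - z) powr 0) \<in> O[at_left 1](\<lambda>z::real. (1 - z) powr b)"
    by (rule powr_at_left_bigo_mono)
  moreover have "(\<lambda>z::real. c) \<in> O[at_left 1](\<lambda>z. (1 - z) powr 0)" by real_asymp
  ultimately show ?thesis by (intro O_tilde_bigo) (rule landau_o.big_trans)
qed

lemma O_tilde_cmult: "f \<in> O_tilde b \<Longrightarrow> (\<lambda>z. c * f z) \<in> O_tilde b"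
  using O_tilde_mult[OF O_tilde_const[of 0 c], of f b] by simp

lemma O_tilde_cong:
  assumes "\<forall>\<^sub>F z in at_left 1. f z = g z"
  shows "f \<in> O_tilde b \<longleftrightarrow> g \<in> O_tilde b"
  unfolding O_tilde_def by (simp add: landau_o.big.in_cong[OF assms])

lemma asymp_rel_cong:
  assumes "\<forall>\<^sub>F z in at_left 1. f z = g z"
  shows "asymp_rel f c a d \<longleftrightarrow> asymp_rel g c a d"
  unfolding asymp_rel_def
  by (rule O_tilde_cong) (use assms in \<open>auto elim: eventually_mono\<close>)

lemma asymp_rel_O_tilde:
  assumes "asymp_rel f c a d" "d \<ge> 0"
  shows "f \<in> O_tilde a"
proof -
  have "(\<lambda>z. (f z - c * (1 - z) powr a) + c * (1 - z) powr a) \<in> O_tilde a"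
    using assms by (intro O_tilde_add O_tilde_cmult O_tilde_powr)
      (auto simp: asymp_rel_def intro: O_tilde_mono)
  then show ?thesis by simp
qed

lemma asymp_rel_of_O_tilde: "f \<in> O_tilde (a + d) \<Longrightarrow> asymp_rel f 0 a d"
  by (simp add: asymp_rel_def)

lemma asymp_rel_add:
  assumes "asymp_rel f b a d" "asymp_rel g c a d"
  shows "asymp_rel (\<lambda>z. f z + g z) (b + c) a d"
  using O_tilde_add[OF assms[unfolded asymp_rel_def]] by (simp add: asymp_rel_def algebra_simps)

lemma asymp_rel_sum:
  "(\<And>i. i \<in> A \<Longrightarrow> asymp_rel (f i) (c i) a d) \<Longrightarrow> asymp_rel (\<lambda>z. \<Sum>i\<in>A. f i z) (sum c A) a d"
proof (induction A rule: infinite_finite_induct)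
  case (insert x A)
  then show ?case by (simp add: asymp_rel_add)
qed (simp_all add: asymp_rel_of_O_tilde O_tilde_def)

lemma asymp_rel_mult:
  assumes f: "asymp_rel f b u d" and g: "asymp_rel g c v d" and d: "d \<ge> 0"
  shows "asymp_rel (\<lambda>z. f z * g z) (b * c) (u + v) d"
proof -
  have "(\<lambda>z. (f z - b * (1 - z) powr u) * g z) \<in> O_tilde (u + d + v)"
    using f asymp_rel_O_tilde[OF g d] unfolding asymp_rel_def by (rule O_tilde_mult)
  moreover have "(\<lambda>z. b * (1 - z) powr u * (g z - c * (1 - z) powr v)) \<in> O_tilde (u + (v + d))"
    using g unfolding asymp_rel_def by (intro O_tilde_mult O_tilde_cmult O_tilde_powr) auto
  ultimately have "(\<lambda>z. (f z - b * (1 - z) powr u) * g z + b * (1 - z) powr u * (g z - c * (1 - z) powr v))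
      \<in> O_tilde (u + v + d)"
    by (intro O_tilde_add) (simp_all add: add_ac)
  then show ?thesis by (simp add: asymp_rel_def powr_add algebra_simps)
qed

section \<open>Evaluation of power series\<close>

lemma conv_radius_add_ge: "fps_conv_radius F \<ge> 1 \<Longrightarrow> fps_conv_radius G \<ge> 1 \<Longrightarrow> fps_conv_radius (F + G) \<ge> 1"
  by (rule order_trans[OF _ fps_conv_radius_add]) simp

lemma conv_radius_sum_ge:
  "(\<And>i. i \<in> A \<Longrightarrow> fps_conv_radius (F i) \<ge> 1) \<Longrightarrow> fps_conv_radius (sum F A) \<ge> 1"
  by (induction A rule: infinite_finite_induct) (simp_all add: conv_radius_add_ge)

lemma conv_radius_mult_ge: "fps_conv_radius F \<ge> 1 \<Longrightarrow> fps_conv_radius G \<ge> 1 \<Longrightarrow> fps_conv_radius (F * G) \<ge> 1"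
  by (rule order_trans[OF _ fps_conv_radius_mult]) simp

lemma conv_radius_binser: "fps_conv_radius (binser a) \<ge> 1"
  by (rule plog_conv_radius[OF binser_plog[OF order_refl]])

lemma eval_fps_sum:
  fixes F :: "'a \<Rightarrow> real fps"
  assumes "\<And>i. i \<in> A \<Longrightarrow> fps_conv_radius (F i) \<ge> 1" "\<bar>z\<bar> < 1"
  shows "eval_fps (sum F A) z = (\<Sum>i\<in>A. eval_fps (F i) z)"
  using assms
proof (induction A rule: infinite_finite_induct)
  case (insert x A)
  then have "eval_fps (F x + sum F A) z = eval_fps (F x) z + eval_fps (sum F A) z"
    by (intro eval_fps_add less_conv_radius conv_radius_sum_ge) auto
  then show ?case using insert by simp
qed simp_all

text \<open>\<open>d < a\<close> puts the exponent of the error series above -1, as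
  \<open>plog_eval_O_tilde\<close> requires. It fails for \<open>s = 1\<close> if
  \<open>\<delta> = p\<close>, when a constant is as large as the error.\<close>

lemma binser_lead_asymp_rel:
  assumes F: "binser_lead F c a d" and d: "d < a"
  shows "asymp_rel (\<lambda>z. eval_fps F z) c (-a) d"
proof -
  let ?Q = "F - fps_const c * binser a"
  have Q: "?Q \<in> plog (a - 1 - d)" using F by (simp add: binser_lead_def)
  then have "(\<lambda>z. eval_fps ?Q z) \<in> O_tilde (- (a - 1 - d) - 1)"
    by (rule plog_eval_O_tilde) (use d in simp)
  then have "asymp_rel (\<lambda>z. eval_fps ?Q z) 0 (-a) d"
    by (intro asymp_rel_of_O_tilde) simp
  moreover have "asymp_rel (\<lambda>z. c * (1 - z) powr (-a)) c (-a) d"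
    by (simp add: asymp_rel_def O_tilde_def)
  ultimately have "asymp_rel (\<lambda>z. eval_fps ?Q z + c * (1 - z) powr (-a)) (0 + c) (-a) d"
    by (rule asymp_rel_add)
  moreover have "\<forall>\<^sub>F z in at_left 1. eval_fps ?Q z + c * (1 - z) powr (-a) = eval_fps F z"
    using at_left_1_unit
  proof eventually_elim
    case (elim z)
    then have z: "\<bar>z\<bar> < 1" by simp
    have cb: "fps_conv_radius (fps_const c * binser a) \<ge> 1"
      by (intro conv_radius_mult_ge conv_radius_binser) simp
    have "eval_fps (?Q + fps_const c * binser a) z = eval_fps ?Q z + eval_fps (fps_const c * binser a) z"
      by (intro eval_fps_add less_conv_radius plog_conv_radius[OF Q] cb z)
    also have "eval_fps (fps_const c * binser a) z = c * (1 - z) powr (-a)"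
      using z by (subst eval_fps_mult) (auto simp: eval_binser less_conv_radius conv_radius_binser less_conv_radius[simplified])
    finally show ?case by simp
  qed
  ultimately show ?thesis by (simp add: asymp_rel_cong)
qed

lemma E_gf_eval:
  assumes "fps_conv_radius (exc_fps \<omega> \<epsilon> s) \<ge> 1" "\<bar>z\<bar> < 1"
  shows "E_gf \<omega> \<epsilon> s z = eval_fps (exc_fps \<omega> \<epsilon> s) z"
proof -
  have "(\<lambda>N. 2 * (exc_fps \<omega> \<epsilon> s $ N * z ^ N)) sums (2 * eval_fps (exc_fps \<omega> \<epsilon> s) z)"
    by (intro sums_mult sums_eval_fps less_conv_radius assms)
  also have "(\<lambda>N. 2 * (exc_fps \<omega> \<epsilon> s $ N * z ^ N)) =
    (\<lambda>N. (\<Sum>w \<in> dyck_excursions N. path_functional \<omega> \<epsilon> w ^ s / fact s) * (z/4) ^ N)"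
    by (rule ext) (simp add: exc_fps_def power_divide)
  finally show ?thesis by (simp add: E_gf_def sums_iff)
qed

lemma B_gf_eval: "B_gf \<omega> \<epsilon> s z = eval_fps (bri_fps \<omega> \<epsilon> s) z"
  by (simp add: B_gf_def eval_fps_def bri_fps_def power_divide)

section \<open>Moments of excursions and bridges as functions of \<open>z\<close>\<close>

context slice_weight
begin

abbreviation "B \<equiv> bri_fps \<omega> \<epsilon>"

lemma E_conv_radius: "fps_conv_radius (E s) \<ge> 1"
proof (cases "s = 0")
  case True
  then show ?thesis using plog_conv_radius[OF exc_fps_0_plog] by simp
next
  case False
  then show ?thesis using \<delta> by (intro plog_conv_radius[OF binser_lead_plog[OF binser_lead_E]]) auto
qed

lemma B_conv_radius: "fps_conv_radius (B s) \<ge> 1"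
proof (induction s rule: less_induct)
  case (less s)
  show ?case
  proof (cases "s = 0")
    case True
    then show ?thesis by (simp add: bri_fps_0 conv_radius_binser)
  next
    case False
    then have B: "B s = (1 + binser (1/2)) * (E s + (\<Sum>k=0..s-1. B k * E (s - k)))"
      by (intro bri_fps_formula) simp
    show ?thesis unfolding B using False less
      by (intro conv_radius_mult_ge conv_radius_add_ge conv_radius_sum_ge conv_radius_binser E_conv_radius) auto
  qed
qed

lemma eval_B:
  assumes "s \<ge> 1" "\<bar>z\<bar> < 1"
  shows "eval_fps (B s) z = (1 + (1 - z) powr (-1/2)) *
    (eval_fps (E s) z + (\<Sum>k=0..s-1. eval_fps (B k) z * eval_fps (E (s - k)) z))"
proof -
  note conv = less_conv_radius[OF _ assms(2)] conv_radius_mult_ge conv_radius_add_ge conv_radius_sum_ge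
    conv_radius_binser E_conv_radius B_conv_radius
  have one: "fps_conv_radius (1 :: real fps) \<ge> 1" by simp
  have "eval_fps (B s) z = eval_fps ((1 + binser (1/2)) * (E s + (\<Sum>k=0..s-1. B k * E (s - k)))) z"
    using bri_fps_formula[OF assms(1)] by simp
  also have "\<dots> = eval_fps (1 + binser (1/2)) z * eval_fps (E s + (\<Sum>k=0..s-1. B k * E (s - k))) z"
    by (intro eval_fps_mult conv one)
  also have "eval_fps (1 + binser (1/2)) z = eval_fps 1 z + eval_fps (binser (1/2)) z"
    by (intro eval_fps_add conv one)
  also have "eval_fps (E s + (\<Sum>k=0..s-1. B k * E (s - k))) z =
      eval_fps (E s) z + eval_fps (\<Sum>k=0..s-1. B k * E (s - k)) z"
    by (intro eval_fps_add conv)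
  also have "eval_fps (\<Sum>k=0..s-1. B k * E (s - k)) z = (\<Sum>k=0..s-1. eval_fps (B k * E (s - k)) z)"
    by (intro eval_fps_sum conv assms)
  also have "\<dots> = (\<Sum>k=0..s-1. eval_fps (B k) z * eval_fps (E (s - k)) z)"
    by (intro sum.cong refl eval_fps_mult conv)
  finally show ?thesis using assms(2) by (simp add: eval_binser)
qed

lemma a_ge:
  assumes "s \<ge> 1"
  shows "a s \<ge> p"
proof -
  have "(p + 1/2) * 1 \<le> (p + 1/2) * real s" using assms p_pos by (intro mult_left_mono) auto
  then show ?thesis by (simp only: a_def mult_1_right le_diff_eq)
qed

text \<open>For \<open>s = 1\<close> the constant \<open>\<epsilon> / 2\<close> cannot be seen in the coefficients, so this case is read
  off from the hypothesis on \<open>\<epsilon>\<close> directly.\<close>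

lemma E_1_asymp_rel: "asymp_rel (\<lambda>z. eval_fps (E 1) z - \<epsilon> / 2) (2 * mu_E p 1) (- p) m"
proof -
  define r where "r = (\<lambda>z. eval_fps (K 1) z - (\<kappa> * (1 - z) powr (1/2 - p) + \<epsilon> * (1 - z) powr (1/2)))"
  have r: "r \<in> O_tilde (min 1 (1/2 - p + m))"
    unfolding r_def by (intro O_tilde_bigo eval_K_1)
  have m: "m \<le> 1/2" by simp
  have r': "r \<in> O_tilde (- p + m)"
    by (rule O_tilde_mono[OF r]) (use p_pos m in \<open>simp add: min_def\<close>)
  have "(\<lambda>z. (1 - z) powr (-1/2) * r z) \<in> O_tilde (-1/2 + min 1 (1/2 - p + m))"
    by (intro O_tilde_mult r O_tilde_powr) simp
  \<comment> \<open>Both alternatives of the minimum are good enough: \<open>-1/2 + 1\<close>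
    exceeds \<open>- p + m\<close> because \<open>m \<le> 1/2\<close>, and
    \<open>-1/2 + (1/2 - p + m)\<close> equals it.\<close>
  then have yr: "(\<lambda>z. (1 - z) powr (-1/2) * r z) \<in> O_tilde (- p + m)"
    by (rule O_tilde_mono) (use p_pos m in \<open>simp add: min_def\<close>)
  have "(\<lambda>z. (1/2) * ((1 - z) powr (-1/2) * r z) + (-1/2) * r z + ((-\<kappa>/2) * (1 - z) powr (1/2 - p) + (-\<epsilon>/2) * (1 - z) powr (1/2)))
     \<in> O_tilde (- p + m)"
    using p_pos m by (intro O_tilde_add O_tilde_cmult yr r' O_tilde_powr) auto
  moreover have "\<forall>\<^sub>F z in at_left 1. (1/2) * ((1 - z) powr (-1/2) * r z) + (-1/2) * r z +
      ((-\<kappa>/2) * (1 - z) powr (1/2 - p) + (-\<epsilon>/2) * (1 - z) powr (1/2)) =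
      (eval_fps (E 1) z - \<epsilon> / 2) - 2 * mu_E p 1 * (1 - z) powr (- p)"
    using at_left_1_unit
  proof eventually_elim
    case (elim z)
    then have z: "\<bar>z\<bar> < 1" by simp
    have "E 1 = fps_const (1/2) * ((binser (1/2) - 1) * K 1)"
      using exc_fps_formula[of 1 \<omega> \<epsilon>] fps_half_double[of "E 1"] by simp
    also have "\<dots> = fps_const (1/2) * (binser (1/2) * K 1 - K 1)"
      by (simp add: left_diff_distrib)
    also have "eval_fps \<dots> z = 1/2 * ((1 - z) powr (-1/2) * eval_fps (K 1) z - eval_fps (K 1) z)"
    proof -
      have bK: "fps_conv_radius (binser (1/2) * K 1) \<ge> 1"
        by (intro conv_radius_mult_ge conv_radius_binser conv_radius_K_1)
      have diff: "fps_conv_radius (binser (1/2) * K 1 - K 1) \<ge> 1"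
        using bK conv_radius_K_1 by (intro order_trans[OF _ fps_conv_radius_diff]) simp
      have half: "fps_conv_radius (fps_const (1/2) :: real fps) \<ge> 1" by simp
      note conv = less_conv_radius[OF _ z]
      have "eval_fps (fps_const (1/2) * (binser (1/2) * K 1 - K 1)) z =
          eval_fps (fps_const (1/2)) z * eval_fps (binser (1/2) * K 1 - K 1) z"
        by (intro eval_fps_mult conv half diff)
      also have "eval_fps (binser (1/2) * K 1 - K 1) z = eval_fps (binser (1/2) * K 1) z - eval_fps (K 1) z"
        by (intro eval_fps_diff conv bK conv_radius_K_1)
      also have "eval_fps (binser (1/2) * K 1) z = eval_fps (binser (1/2)) z * eval_fps (K 1) z"
        by (intro eval_fps_mult conv conv_radius_binser conv_radius_K_1)
      finally show ?thesis using z by (simp add: eval_binser)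
    qed
    finally have E1: "eval_fps (E 1) z = 1/2 * ((1 - z) powr (-1/2) * eval_fps (K 1) z - eval_fps (K 1) z)" .
    have K1: "eval_fps (K 1) z = r z + \<kappa> * (1 - z) powr (1/2 - p) + \<epsilon> * (1 - z) powr (1/2)"
      by (simp add: r_def)
    have pow: "(1 - z) powr (-1/2) * (1 - z) powr (1/2 - p) = (1 - z) powr (- p)"
      "(1 - z) powr (-1/2) * (1 - z) powr (1/2) = 1"
      using elim by (simp_all add: powr_add[symmetric])
    have "(1 - z) powr (-1/2) * eval_fps (K 1) z =
       (1 - z) powr (-1/2) * r z + \<kappa> * ((1 - z) powr (-1/2) * (1 - z) powr (1/2 - p)) +
       \<epsilon> * ((1 - z) powr (-1/2) * (1 - z) powr (1/2))"
      unfolding K1 by (simp add: algebra_simps)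
    \<comment> \<open>The term \<open>\<epsilon> * (1 - z) powr (1/2)\<close> of
      \<open>eval_K_1\<close> has become the constant \<open>\<epsilon>\<close>, the origin of
      \<open>\<epsilon> / 2\<close> in the statement.\<close>
    then have YK: "(1 - z) powr (-1/2) * eval_fps (K 1) z = (1 - z) powr (-1/2) * r z + \<kappa> * (1 - z) powr (- p) + \<epsilon>"
      unfolding pow by simp
    have mu: "2 * mu_E p 1 = \<kappa> / 2" by (simp add: mu_E.simps)
    show ?case unfolding E1 YK mu unfolding K1 by (simp add: field_simps)
  qed
  ultimately show ?thesis unfolding asymp_rel_def by (simp only: O_tilde_cong)
qed

text \<open>For \<open>s = 1\<close> the constant \<open>\<epsilon> / 2\<close> is absorbed in the
  error because \<open>\<delta> \<le> p\<close>; for \<open>s \<ge> 2\<close> the coefficients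
  suffice, as \<open>a s\<close> is then greater than \<open>\<delta>\<close>.\<close>

lemma E_asymp_rel:
  assumes s: "s \<ge> 1"
  shows "asymp_rel (\<lambda>z. eval_fps (E s) z) (2 * mu_E p s) (- a s) \<delta>"
proof (cases "s = 1")
  case True
  have "(\<lambda>z. (eval_fps (E 1) z - \<epsilon> / 2) - 2 * mu_E p 1 * (1 - z) powr (- p) + \<epsilon> / 2) \<in> O_tilde (- p + \<delta>)"
    using E_1_asymp_rel[unfolded asymp_rel_def] \<delta>
    by (intro O_tilde_add O_tilde_const O_tilde_mono[OF E_1_asymp_rel[unfolded asymp_rel_def]]) (auto simp: \<delta>_def)
  then show ?thesis by (simp add: True asymp_rel_def a_def)
next
  case False
  have "real s \<ge> 2" using s False by simp
  then have "a s > \<delta>"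
    using mult_left_mono[of 2 "real s" "p + 1/2"] p_pos \<delta> by (simp add: a_def)
  then show ?thesis using binser_lead_E[OF s] by (rule binser_lead_asymp_rel[rotated])
qed

text \<open>In \<open>eval_B\<close> all products of the sum have the same order. The factor in
  front contributes \<open>(1 - z) powr (-1/2)\<close>; its summand 1 and the single term
  \<open>E s\<close> fall behind by \<open>1/2\<close>.\<close>

lemma B_asymp_rel: "asymp_rel (\<lambda>z. eval_fps (B s) z) (mu_B p s) (- a s - 1) \<delta>"
proof (induction s rule: less_induct)
  case (less s)
  show ?case
  proof (cases "s = 0")
    case True
    have "\<forall>\<^sub>F z in at_left 1. (1 - z) powr (-1/2) = eval_fps (B s) z"
      using at_left_1_unit by eventually_elim (simp add: True bri_fps_0 eval_binser)
    moreover have "asymp_rel (\<lambda>z. (1 - z) powr (-1/2)) (mu_B p s) (- a s - 1) \<delta>"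
      by (simp add: True asymp_rel_def a_def mu_B.simps O_tilde_def)
    ultimately show ?thesis by (simp only: asymp_rel_cong)
  next
    case False
    let ?e = "- ((p + 1/2) * real s)"
    have prod: "asymp_rel (\<lambda>z. eval_fps (B k) z * eval_fps (E (s - k)) z) (mu_B p k * (2 * mu_E p (s - k))) ?e \<delta>"
      if k: "k \<in> {0..s-1}" for k
    proof -
      have "real s = real k + real (s - k)" using k False by auto
      then have e: "(- a k - 1) + (- a (s - k)) = ?e"
        by (simp only: a_def distrib_left)
      have "asymp_rel (\<lambda>z. eval_fps (B k) z * eval_fps (E (s - k)) z) (mu_B p k * (2 * mu_E p (s - k)))
          ((- a k - 1) + (- a (s - k))) \<delta>"
        using k False \<delta> by (intro asymp_rel_mult less.IH E_asymp_rel) auto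
      then show ?thesis unfolding e .
    qed
    have "asymp_rel (\<lambda>z. eval_fps (E s) z) 0 ?e \<delta>"
      using asymp_rel_O_tilde[OF E_asymp_rel] \<delta> False
      by (intro asymp_rel_of_O_tilde O_tilde_mono[OF asymp_rel_O_tilde[OF E_asymp_rel]]) (auto simp: a_def)
    then have "asymp_rel (\<lambda>z. eval_fps (E s) z + (\<Sum>k=0..s-1. eval_fps (B k) z * eval_fps (E (s - k)) z))
        (0 + (\<Sum>k=0..s-1. mu_B p k * (2 * mu_E p (s - k)))) ?e \<delta>"
      by (intro asymp_rel_add asymp_rel_sum prod)
    moreover have "asymp_rel (\<lambda>z. 1 + (1 - z) powr (-1/2)) (0 + 1) (-1/2) \<delta>"
    proof (rule asymp_rel_add)
      show "asymp_rel (\<lambda>z. 1) 0 (-1/2) \<delta>"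
        using \<delta> by (intro asymp_rel_of_O_tilde O_tilde_const) simp
    qed (simp add: asymp_rel_def O_tilde_def)
    ultimately have "asymp_rel (\<lambda>z. (1 + (1 - z) powr (-1/2)) *
        (eval_fps (E s) z + (\<Sum>k=0..s-1. eval_fps (B k) z * eval_fps (E (s - k)) z)))
        ((0 + 1) * (0 + (\<Sum>k=0..s-1. mu_B p k * (2 * mu_E p (s - k))))) (-1/2 + ?e) \<delta>"
      using \<delta> by (intro asymp_rel_mult) auto
    moreover have "(0 + 1) * (0 + (\<Sum>k=0..s-1. mu_B p k * (2 * mu_E p (s - k)))) = mu_B p s"
      using False by (subst (2) mu_B.simps) (simp add: sum_distrib_left mult_ac)
    moreover have "-1/2 + ?e = - a s - 1" by (simp add: a_def)
    moreover have "\<forall>\<^sub>F z in at_left 1. (1 + (1 - z) powr (-1/2)) *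
        (eval_fps (E s) z + (\<Sum>k=0..s-1. eval_fps (B k) z * eval_fps (E (s - k)) z)) = eval_fps (B s) z"
      using at_left_1_unit by eventually_elim (subst eval_B, use False in auto)
    ultimately show ?thesis by (simp only: asymp_rel_cong)
  qed
qed

text \<open>With \<open>y = (1 - z) powr (-1/2)\<close>, \<open>eval_B\<close> reads
  \<open>(1 + y)^2\<close> times the value of \<open>E 1\<close>. The part \<open>y * y\<close>
  turns \<open>\<epsilon> / 2\<close> into \<open>\<epsilon> / (2 * (1 - z))\<close>, and the rest
  is smaller by at least \<open>1/2\<close> in the exponent, which \<open>m \<le> 1/2\<close>
  permits.\<close>

lemma B_1_asymp_rel:
  "asymp_rel (\<lambda>z. eval_fps (B 1) z - \<epsilon> / (2 * (1 - z))) (mu_B p 1) (- p - 1) m"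
proof -
  have m: "m \<le> 1/2" by simp
  have mu: "mu_B p 1 = 2 * mu_E p 1" by (subst mu_B.simps) (simp add: mu_B.simps[of p 0])
  define r where "r = (\<lambda>z. (eval_fps (E 1) z - \<epsilon> / 2) - 2 * mu_E p 1 * (1 - z) powr (- p))"
  have r: "r \<in> O_tilde (- p + m)" using E_1_asymp_rel by (simp add: r_def asymp_rel_def)
  have E: "(\<lambda>z. eval_fps (E 1) z) \<in> O_tilde (- p)"
    using asymp_rel_O_tilde[OF E_asymp_rel[of 1]] \<delta> by (simp add: a_def)
  have "(\<lambda>z. (1 - z) powr (-1) * r z) \<in> O_tilde (- p - 1 + m)"
    using O_tilde_mult[OF O_tilde_powr[OF order_refl, of "-1"] r] by (simp add: algebra_simps)
  moreover have "(\<lambda>z. (1 - z) powr (-1/2) * eval_fps (E 1) z) \<in> O_tilde (- p - 1 + m)"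
    by (rule O_tilde_mono[OF O_tilde_mult[OF O_tilde_powr[OF order_refl, of "-1/2"] E]]) (use m in simp)
  moreover have "(\<lambda>z. eval_fps (E 1) z) \<in> O_tilde (- p - 1 + m)"
    by (rule O_tilde_mono[OF E]) (use m in simp)
  ultimately have "(\<lambda>z. (1 - z) powr (-1) * r z + 2 * ((1 - z) powr (-1/2) * eval_fps (E 1) z) + eval_fps (E 1) z)
      \<in> O_tilde (- p - 1 + m)"
    by (intro O_tilde_add O_tilde_cmult)
  moreover have "\<forall>\<^sub>F z in at_left 1. (1 - z) powr (-1) * r z + 2 * ((1 - z) powr (-1/2) * eval_fps (E 1) z) + eval_fps (E 1) z
      = (eval_fps (B 1) z - \<epsilon> / (2 * (1 - z))) - mu_B p 1 * (1 - z) powr (- p - 1)"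
    using at_left_1_unit
  proof eventually_elim
    case (elim z)
    define y where "y = (1 - z) powr (-1/2)"
    have yy: "y * y = (1 - z) powr (-1)" by (simp add: y_def powr_add[symmetric])
    have yp: "(1 - z) powr (- p - 1) = (1 - z) powr (-1) * (1 - z) powr (- p)"
    proof -
      have "- p - 1 = -1 + - p" by simp
      then show ?thesis by (simp only: powr_add)
    qed
    have inv: "(1 - z) powr (-1) = 1 / (1 - z)" using elim by (simp add: powr_minus field_simps)
    have "eval_fps (B 1) z = (1 + y) * (eval_fps (E 1) z + y * eval_fps (E 1) z)"
      using eval_B[of 1 z] elim by (simp add: bri_fps_0 eval_binser y_def)
    also have "\<dots> = eval_fps (E 1) z + 2 * (y * eval_fps (E 1) z) + (y * y) * eval_fps (E 1) z"
      by (simp add: algebra_simps)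
    also have "(y * y) * eval_fps (E 1) z =
        (1 - z) powr (-1) * r z + \<epsilon> / (2 * (1 - z)) + 2 * mu_E p 1 * (1 - z) powr (- p - 1)"
      unfolding yy yp r_def inv by (simp add: right_diff_distrib)
    finally show ?case unfolding y_def mu by simp
  qed
  ultimately show ?thesis unfolding asymp_rel_def by (simp only: O_tilde_cong)
qed

end

text \<open>Taking the minimum with \<open>p\<close> affects only \<open>s = 1\<close>, where the
  contributions of \<open>\<epsilon>\<close> limit the rate. The last two conjuncts subtract them
  and reach \<open>eta_exp\<close> itself.\<close>

theorem proposition4:
  fixes p \<eta> \<epsilon> :: real and \<omega> :: "nat \<Rightarrow> real"
  assumes "p > 0" and "p \<noteq> 1/2" and "\<eta> > 0"
    and "\<And>N. \<omega> N > 0"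
    and "(\<lambda>N. \<omega> N / real N powr p - 1) \<in> O(\<lambda>N. real N powr (-\<eta>))"
    and "is_alpha p \<eta> \<omega> \<epsilon>"
  shows
    "(\<forall>s\<ge>1.
        asymp_rel (E_gf \<omega> \<epsilon> s) (2 * mu_E p s) (- (p + 1/2) * real s + 1/2) (min p (eta_exp \<eta> p s)) \<and>
        asymp_rel (B_gf \<omega> \<epsilon> s) (mu_B p s) (- (p + 1/2) * real s - 1/2) (min p (eta_exp \<eta> p s)))
     \<and> asymp_rel (\<lambda>z. E_gf \<omega> \<epsilon> 1 z - \<epsilon> / 2) (2 * mu_E p 1) (- p) (eta_exp \<eta> p 1)
     \<and> asymp_rel (\<lambda>z. B_gf \<omega> \<epsilon> 1 z - \<epsilon> / (2 * (1 - z))) (mu_B p 1) (- p - 1) (eta_exp \<eta> p 1)"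
proof -
  interpret slice_weight p \<eta> \<epsilon> \<omega>
    using assms by unfold_locales auto
  have E_gf: "\<forall>\<^sub>F z in at_left 1. eval_fps (E s) z = E_gf \<omega> \<epsilon> s z" for s
    using at_left_1_unit by eventually_elim (simp add: E_gf_eval E_conv_radius)
  have B_gf: "B_gf \<omega> \<epsilon> s = (\<lambda>z. eval_fps (B s) z)" for s
    by (rule ext) (rule B_gf_eval)
  have "asymp_rel (E_gf \<omega> \<epsilon> s) (2 * mu_E p s) (- (p + 1/2) * real s + 1/2) (min p (eta_exp \<eta> p s)) \<and>
        asymp_rel (B_gf \<omega> \<epsilon> s) (mu_B p s) (- (p + 1/2) * real s - 1/2) (min p (eta_exp \<eta> p s))"
    if s: "s \<ge> 1" for s
  proof -
    have "min p (eta_exp \<eta> p s) = \<delta>" using s by (auto simp: eta_exp_def \<delta>_def)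
    moreover have "- (p + 1/2) * real s + 1/2 = - a s" "- (p + 1/2) * real s - 1/2 = - a s - 1"
      by (simp_all add: a_def algebra_simps)
    ultimately show ?thesis
      using E_asymp_rel[OF s] B_asymp_rel[of s] by (simp only: B_gf asymp_rel_cong[OF E_gf])
  qed
  moreover have "asymp_rel (\<lambda>z. E_gf \<omega> \<epsilon> 1 z - \<epsilon> / 2) (2 * mu_E p 1) (- p) (eta_exp \<eta> p 1)"
  proof -
    have "\<forall>\<^sub>F z in at_left 1. eval_fps (E 1) z - \<epsilon> / 2 = E_gf \<omega> \<epsilon> 1 z - \<epsilon> / 2"
      using E_gf[of 1] by eventually_elim simp
    from E_1_asymp_rel[unfolded asymp_rel_cong[OF this]] show ?thesis by (simp add: eta_exp_def)
  qed
  moreover have "asymp_rel (\<lambda>z. B_gf \<omega> \<epsilon> 1 z - \<epsilon> / (2 * (1 - z))) (mu_B p 1) (- p - 1) (eta_exp \<eta> p 1)"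
    using B_1_asymp_rel by (simp add: B_gf eta_exp_def)
  ultimately show ?thesis by blast
qed

end
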